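(* Fix positive reals $\alpha,\beta,M$. Then $(\Gamma_M^+,\Lambda_{\alpha,\beta})$ is a Heisenberg uniqueness pair if and only if $\alpha\beta M^2<16\pi^2$. Moreover, in the critical case $\alpha\beta M^2=16\pi^2$, the space $\mathrm{AC}(\Gamma_M^+;\Lambda_{\alpha,\beta})$ is the one-dimensional space spanned by the measure $\mu_0\in\mathrm{AC}(\Gamma_M^+;\Lambda_{\alpha,\beta})$ whose $x_1$-compression is given by $$\mathrm{d}\boldsymbol{\pi}_1\mu_0(t)=\left\{\frac{1_{[0,2/\alpha]}(t)}{2(2+\alpha t)}-\frac{1_{[2/\alpha,+\infty[}(t)}{\alpha t(2+\alpha t)}\right\}\mathrm{d}t.$$
   Context: For a finite complex-valued Borel measure $\mu$ on $\mathbb{R}^2$, its Fourier transform is $\hat\mu(\xi)=\int_{\mathbb{R}^2}\mathrm{e}^{\mathrm{i}\pi\langle x,\xi\rangle}\,\mathrm{d}\mu(x)$, where $\langle x,\xi\rangle=x_1\xi_1+x_2\xi_2$. For a finite disjoint union $\Gamma\subset\mathbb{R}^2$ of smooth curves, $\mathrm{AC}(\Gamma)$ is the space of finite complex-valued Borel measures on $\mathbb{R}^2$ supported on $\Gamma$ that are absolutely continuous with respect to arc length measure on $\Gamma$. For $\Lambda\subset\mathbb{R}^2$, $\mathrm{AC}(\Gamma;\Lambda)$ is the subspace of those $\mu\in\mathrm{AC}(\Gamma)$ with $\hat\mu=0$ on $\Lambda$. The pair $(\Gamma,\Lambda)$ is a Heisenberg uniqueness pair if $\mathrm{AC}(\Gamma;\Lambda)=\{0\}$,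 i.e. $\mu\in\mathrm{AC}(\Gamma)$ and $\hat\mu|_\Lambda=0$ imply $\mu=0$. $\Gamma_M^+=\{x\in\mathbb{R}^2:\ x_1x_2=M^2/(4\pi^2),\ x_1>0\}$ is one branch of a hyperbola, and $\Lambda_{\alpha,\beta}=(\alpha\mathbb{Z}\times\{0\})\cup(\{0\}\times\beta\mathbb{Z})$ is the lattice-cross. The $x_1$-compression of $\mu$ is the Borel measure on $\mathbb{R}$ given by $\boldsymbol{\pi}_1\mu(E)=\mu(E\times\mathbb{R})$; a measure supported on the hyperbola is determined by its $x_1$-compression. $1_E$ is the characteristic function of $E$. *)

theory Defs
  imports "HOL-Analysis.Analysis"
begin

text \<open>
  Complex Borel measures are countably additive set functions with values in the complex numbers
  (so they are finite). The value on non-Borel sets is fixed to be 0, so that equality of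
  measures is equality of functions.
\<close>

definition complex_borel_measure :: "('a::topological_space set \<Rightarrow> complex) \<Rightarrow> bool" where
  "complex_borel_measure \<mu> \<longleftrightarrow>
     (\<forall>E. E \<notin> sets borel \<longrightarrow> \<mu> E = 0) \<and>
     (\<forall>A::nat \<Rightarrow> 'a set. range A \<subseteq> sets borel \<longrightarrow> disjoint_family A \<longrightarrow>
        (\<lambda>n. \<mu> (A n)) sums \<mu> (\<Union>n. A n))"

text \<open>
  The positive part of the Jordan decomposition of a finite signed Borel measure; the negative
  part is the positive part of the negated set function. Negative values of \<open>\<nu> A\<close> are
  truncated to 0 by \<^const>\<open>ennreal\<close>, which is harmless because the empty set competes
  in the supremum.
\<close>

definition positive_variation :: "('a::topological_space set \<Rightarrow> real) \<Rightarrow> 'a measure" where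
  "positive_variation \<nu> =
     measure_of UNIV (sets borel) (\<lambda>E. SUP A\<in>{A \<in> sets borel. A \<subseteq> E}. ennreal (\<nu> A))"

definition signed_integral ::
    "('a::topological_space set \<Rightarrow> real) \<Rightarrow> ('a \<Rightarrow> complex) \<Rightarrow> complex" where
  "signed_integral \<nu> f =
     (\<integral>x. f x \<partial>positive_variation \<nu>) - (\<integral>x. f x \<partial>positive_variation (\<lambda>E. - \<nu> E))"

definition complex_measure_integral ::
    "('a::topological_space set \<Rightarrow> complex) \<Rightarrow> ('a \<Rightarrow> complex) \<Rightarrow> complex" where
  "complex_measure_integral \<mu> f =
     signed_integral (\<lambda>E. Re (\<mu> E)) f + \<i> * signed_integral (\<lambda>E. Im (\<mu> E)) f"

definition fourier_transform ::
    "((real \<times> real) set \<Rightarrow> complex) \<Rightarrow> real \<times> real \<Rightarrow> complex" where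
  "fourier_transform \<mu> \<xi> =
     complex_measure_integral \<mu> (\<lambda>x. exp (\<i> * complex_of_real (pi * (x \<bullet> \<xi>))))"

text \<open>
  Arc length of subsets of smooth curves, as one-dimensional Hausdorff (outer) measure; this
  depends only on the set and not on a parametrization. Boundedness of the covering sets is
  required because \<^const>\<open>diameter\<close> is meaningless for unbounded sets.
\<close>

definition arc_length :: "'a::metric_space set \<Rightarrow> ennreal" where
  "arc_length E =
     (SUP \<delta>\<in>{0<..}. INF U\<in>{U :: nat \<Rightarrow> 'a set.
          E \<subseteq> (\<Union>n. U n) \<and> (\<forall>n. bounded (U n) \<and> diameter (U n) \<le> \<delta>)}.
        (\<Sum>n. ennreal (diameter (U n))))"

definition AC :: "(real \<times> real) set \<Rightarrow> ((real \<times> real) set \<Rightarrow> complex) set" where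
  "AC \<Gamma> = {\<mu>. complex_borel_measure \<mu> \<and>
     (\<forall>E\<in>sets borel. E \<inter> \<Gamma> = {} \<longrightarrow> \<mu> E = 0) \<and>
     (\<forall>E\<in>sets borel. arc_length (E \<inter> \<Gamma>) = 0 \<longrightarrow> \<mu> E = 0)}"

definition AC_vanishing ::
    "(real \<times> real) set \<Rightarrow> (real \<times> real) set \<Rightarrow> ((real \<times> real) set \<Rightarrow> complex) set" where
  "AC_vanishing \<Gamma> \<Lambda> = {\<mu> \<in> AC \<Gamma>. \<forall>\<xi>\<in>\<Lambda>. fourier_transform \<mu> \<xi> = 0}"

definition heisenberg_uniqueness_pair ::
    "(real \<times> real) set \<Rightarrow> (real \<times> real) set \<Rightarrow> bool" where
  "heisenberg_uniqueness_pair \<Gamma> \<Lambda> \<longleftrightarrow> AC_vanishing \<Gamma> \<Lambda> = {\<lambda>E. 0}"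

definition hyperbola_branch :: "real \<Rightarrow> (real \<times> real) set" where
  "hyperbola_branch M = {(x1, x2). x1 * x2 = M\<^sup>2 / (4 * pi\<^sup>2) \<and> x1 > 0}"

definition lattice_cross :: "real \<Rightarrow> real \<Rightarrow> (real \<times> real) set" where
  "lattice_cross \<alpha> \<beta> =
     (range (\<lambda>m::int. \<alpha> * of_int m) \<times> {0}) \<union> ({0} \<times> range (\<lambda>n::int. \<beta> * of_int n))"

definition x1_compression :: "((real \<times> real) set \<Rightarrow> complex) \<Rightarrow> real set \<Rightarrow> complex" where
  "x1_compression \<mu> E = \<mu> (E \<times> UNIV)"

definition critical_density :: "real \<Rightarrow> real \<Rightarrow> real" where
  "critical_density \<alpha> t =
     indicator {0..2 / \<alpha>} t / (2 * (2 + \<alpha> * t)) -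
     indicator {2 / \<alpha>..} t / (\<alpha> * t * (2 + \<alpha> * t))"

end

theory Submission
  imports Defs "HOL-Real_Asymp.Real_Asymp" "HOL-Complex_Analysis.Great_Picard"
begin

text \<open>
  After the rescaling \<open>x = \<alpha> t / 2\<close> and with \<open>\<gamma> = \<alpha> \<beta> M\<^sup>2 / (16 \<pi>\<^sup>2)\<close>, the two arms of the
  lattice-cross say that the density \<open>k\<close> of the compression and its image under \<open>x \<mapsto> \<gamma> / x\<close> both
  have a vanishing periodization. Eliminating the part of \<open>k\<close> on \<open>[1, \<infinity>)\<close>, one finds that the
  restriction of \<open>k\<close> to \<open>[0, 1)\<close> is, for \<open>\<gamma> \<le> 1\<close>, invariant under the second iterate of the
  transfer operator of \<open>x \<mapsto> \<gamma> / x mod 1\<close>. If \<open>\<gamma> < 1\<close>, mass with respect to the weight \<open>1 / (\<gamma> + x)\<close> escapes under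
  iteration, so \<open>k = 0\<close>. If \<open>\<gamma> = 1\<close>, this is the Gauss map, whose normalized transfer operator contracts
  Lipschitz constants, so the invariant density \<open>1 / (1 + x)\<close> is unique up to a factor. If \<open>\<gamma> > 1\<close>,
  split the circle by a smooth partition of unity \<open>\<eta>(x) + \<eta>(x + 1) = 1\<close> supported where
  \<open>x \<mapsto> \<gamma> / x\<close> is expanding: the resulting random map has a stationary density \<open>h\<close> by a bound on the
  variation of the iterated densities, and \<open>k\<close> is the difference between \<open>\<eta> h\<close> and its image
  under \<open>x \<mapsto> \<gamma> / x\<close>.
\<close>

section \<open>Jordan decomposition of signed Borel measures\<close>

text \<open>Since \<open>k\<close> is only integrable, both arms are read weakly, as vanishing
  integrals of \<open>k\<close> against bounded Borel functions of \<open>frac x\<close> and of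
  \<open>frac (\<gamma> / x)\<close>; the dynamics acts on the test functions by composition. The
  threshold is geometric. If \<gamma> \<le> 1, inversion sends the ray beyond 1 into (0, 1] without
  folding, so \<open>k\<close> on the ray is minus a transported copy of \<open>k\<close> on [0, 1),
  and pairing this minus sign with that of the first arm is why a second iterate occurs. If \<gamma>
  < 1, inversion maps (\<gamma>, 1) to itself and the elimination stops there: this is the hole
  through which mass escapes. If \<gamma> > 1, there is a gap between [0, 1) and its inverted image,
  which leaves room for a cutoff reaching up to 1 + b. The single condition (1 + b)^2 < \<gamma>
  makes inversion expanding on the support of the cutoff and keeps that support apart from its
  image, so the two pieces of \<open>k\<close> cannot cancel. A sharp cutoff at 1 would in general
  create jumps at the incomplete last branch; the smooth one keeps the iterated densities
  continuously differentiable with uniformly bounded derivatives, so that a compactness argument in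
  continuous functions suffices.\<close>

definition signed_borel_measure :: "('a::topological_space set \<Rightarrow> real) \<Rightarrow> bool" where
  "signed_borel_measure \<nu> \<longleftrightarrow>
     (\<forall>A::nat \<Rightarrow> 'a set. range A \<subseteq> sets borel \<longrightarrow> disjoint_family A \<longrightarrow>
        (\<lambda>n. \<nu> (A n)) sums \<nu> (\<Union>n. A n))"

lemma signed_borel_measure_sums:
  assumes "signed_borel_measure \<nu>" "\<And>n. A n \<in> sets borel" "disjoint_family A"
  shows "(\<lambda>n::nat. \<nu> (A n)) sums \<nu> (\<Union>n. A n)"
  using assms by (simp add: signed_borel_measure_def image_subset_iff)

lemma signed_borel_measure_uminus:
  "signed_borel_measure \<nu> \<Longrightarrow> signed_borel_measure (\<lambda>E. - \<nu> E)"
  by (simp add: signed_borel_measure_def sums_minus)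

lemma signed_borel_measure_Re:
  "complex_borel_measure \<mu> \<Longrightarrow> signed_borel_measure (\<lambda>E. Re (\<mu> E))"
  by (simp add: signed_borel_measure_def complex_borel_measure_def sums_Re)

lemma signed_borel_measure_Im:
  "complex_borel_measure \<mu> \<Longrightarrow> signed_borel_measure (\<lambda>E. Im (\<mu> E))"
  by (simp add: signed_borel_measure_def complex_borel_measure_def sums_Im)

lemma signed_borel_measure_empty:
  assumes "signed_borel_measure \<nu>" shows "\<nu> {} = 0"
proof -
  have "(\<lambda>n::nat. \<nu> {}) sums \<nu> (\<Union>n::nat. {})"
    using signed_borel_measure_sums[OF assms, of "\<lambda>_. {}"] by (simp add: disjoint_family_on_def)
  then have "summable (\<lambda>n::nat. \<nu> {})" by (rule sums_summable)
  then show ?thesis by (simp add: summable_const_iff)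
qed

lemma signed_borel_measure_Un:
  assumes "signed_borel_measure \<nu>" and [measurable]: "A \<in> sets borel" "B \<in> sets borel" and "A \<inter> B = {}"
  shows "\<nu> (A \<union> B) = \<nu> A + \<nu> B"
proof -
  let ?A = "binaryset A B"
  have "(\<lambda>n. \<nu> (?A n)) sums \<nu> (\<Union>n. ?A n)"
    by (rule signed_borel_measure_sums[OF assms(1)])
      (use assms(4) in \<open>auto simp: binaryset_def disjoint_family_on_def\<close>)
  moreover have "(\<lambda>n. \<nu> (?A n)) sums (\<nu> A + \<nu> B)"
    by (rule binaryset_sums) (rule signed_borel_measure_empty[OF assms(1)])
  ultimately show ?thesis
    using sums_unique2 by (fastforce simp: UN_binaryset_eq)
qed

text \<open>Named separately because \<open>measure_of\<close> agrees with this set function only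
  once it is known to be countably additive.\<close>

definition upper_variation :: "('a::topological_space set \<Rightarrow> real) \<Rightarrow> 'a set \<Rightarrow> ennreal" where
  "upper_variation \<nu> E = (SUP A\<in>{A \<in> sets borel. A \<subseteq> E}. ennreal (\<nu> A))"

lemma upper_variation_upper:
  "A \<in> sets borel \<Longrightarrow> A \<subseteq> E \<Longrightarrow> ennreal (\<nu> A) \<le> upper_variation \<nu> E"
  unfolding upper_variation_def by (rule SUP_upper) auto

text \<open>A competitor inside the union splits along the pieces, which gives one inequality in the
  limit of partial sums. Competitors inside disjoint pieces can be united, which gives
  superadditivity for finitely many pieces and then for the series.\<close>

lemma countably_additive_upper_variation:
  assumes "signed_borel_measure \<nu>"
  shows "countably_additive (sets borel) (upper_variation \<nu>)"
proof (rule countably_additiveI)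
  fix A :: "nat \<Rightarrow> 'a set"
  assume A: "range A \<subseteq> sets borel" "disjoint_family A" and U: "(\<Union>n. A n) \<in> sets borel"
  then have Am[measurable]: "A n \<in> sets borel" for n by auto
  show "(\<Sum>n. upper_variation \<nu> (A n)) = upper_variation \<nu> (\<Union>n. A n)"
  proof (rule antisym)
    show "upper_variation \<nu> (\<Union>n. A n) \<le> (\<Sum>n. upper_variation \<nu> (A n))"
      unfolding upper_variation_def[of _ "\<Union>n. A n"]
    proof (rule SUP_least, clarify)
      fix B :: "'a set" assume B[measurable]: "B \<in> sets borel" and "B \<subseteq> (\<Union>n. A n)"
      then have B_eq: "(\<Union>n. B \<inter> A n) = B" by auto
      have "(\<lambda>n. \<nu> (B \<inter> A n)) sums \<nu> (\<Union>n. B \<inter> A n)"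
        by (rule signed_borel_measure_sums[OF assms])
          (use A(2) in \<open>auto simp: disjoint_family_on_def\<close>)
      then have lim: "(\<lambda>N. ennreal (\<Sum>n<N. \<nu> (B \<inter> A n))) \<longlonglongrightarrow> ennreal (\<nu> B)"
        unfolding B_eq sums_def by (rule tendsto_ennrealI)
      show "ennreal (\<nu> B) \<le> (\<Sum>n. upper_variation \<nu> (A n))"
      proof (rule LIMSEQ_le_const2[OF lim], intro exI allI impI)
        fix N
        \<comment> \<open>Pieces may have negative mass, and \<open>ennreal\<close> is additive only
          on nonnegative reals; truncating by \<open>max 0\<close> first is harmless because only an
          upper bound is wanted.\<close>
        have "ennreal (\<Sum>n<N. \<nu> (B \<inter> A n)) \<le> ennreal (\<Sum>n<N. max 0 (\<nu> (B \<inter> A n)))"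
          by (intro ennreal_leI sum_mono) auto
        also have "\<dots> = (\<Sum>n<N. ennreal (max 0 (\<nu> (B \<inter> A n))))"
          by (rule sum_ennreal[symmetric]) auto
        also have "\<dots> \<le> (\<Sum>n<N. upper_variation \<nu> (A n))"
        proof (rule sum_mono)
          fix n
          have "ennreal (\<nu> (B \<inter> A n)) \<le> upper_variation \<nu> (A n)"
            by (rule upper_variation_upper) auto
          then show "ennreal (max 0 (\<nu> (B \<inter> A n))) \<le> upper_variation \<nu> (A n)"
            by (cases "\<nu> (B \<inter> A n) \<ge> 0") (auto simp: max_def)
        qed
        also have "\<dots> \<le> (\<Sum>n. upper_variation \<nu> (A n))"
          by (rule sum_le_suminf) auto
        finally show "ennreal (\<Sum>n<N. \<nu> (B \<inter> A n)) \<le> (\<Sum>n. upper_variation \<nu> (A n))" .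
      qed
    qed
  next
    show "(\<Sum>n. upper_variation \<nu> (A n)) \<le> upper_variation \<nu> (\<Union>n. A n)"
    proof (rule suminf_le_const)
      fix N
      have "(\<Sum>n<N. upper_variation \<nu> (A n)) \<le> upper_variation \<nu> (\<Union>n<N. A n)"
      proof (induction N)
        case 0 then show ?case by simp
      next
        case (Suc N)
        have step: "upper_variation \<nu> E + upper_variation \<nu> F \<le> upper_variation \<nu> (E \<union> F)"
          if "E \<inter> F = {}" for E F
        proof -
          have "upper_variation \<nu> E + ennreal (\<nu> B) \<le> upper_variation \<nu> (E \<union> F)"
            if B: "B \<in> sets borel" "B \<subseteq> F" for B
          proof -
            have *: "ennreal (\<nu> C) + ennreal (\<nu> B) \<le> upper_variation \<nu> (E \<union> F)"
              if C: "C \<in> sets borel" "C \<subseteq> E" for C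
            \<comment> \<open>If one competitor has negative mass, its truncated value is 0, and the
              other one alone competes on the union.\<close>
            proof (cases "\<nu> C \<ge> 0 \<and> \<nu> B \<ge> 0")
              case True
              have "\<nu> (C \<union> B) = \<nu> C + \<nu> B"
                by (rule signed_borel_measure_Un[OF assms]) (use B C \<open>E \<inter> F = {}\<close> in auto)
              then have "ennreal (\<nu> C) + ennreal (\<nu> B) = ennreal (\<nu> (C \<union> B))" using True by simp
              also have "\<dots> \<le> upper_variation \<nu> (E \<union> F)"
                by (rule upper_variation_upper) (use B C in auto)
              finally show ?thesis .
            next
              case False
              then have "ennreal (\<nu> C) = 0 \<or> ennreal (\<nu> B) = 0"
                by (auto simp: ennreal_eq_0_iff)
              moreover have "ennreal (\<nu> C) \<le> upper_variation \<nu> (E \<union> F)" "ennreal (\<nu> B) \<le> upper_variation \<nu> (E \<union> F)"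
                by (rule upper_variation_upper; use B C in auto)+
              ultimately show ?thesis by auto
            qed
            show ?thesis
              unfolding upper_variation_def[of _ E]
              by (subst ennreal_SUP_add_left[symmetric]) (use * in \<open>auto intro!: SUP_least\<close>)
          qed
          then show ?thesis
            unfolding upper_variation_def[of _ F]
            by (subst ennreal_SUP_add_right) (auto intro!: SUP_least)
        qed
        have "A n \<inter> A N = {}" if "n < N" for n
          using disjoint_family_onD[OF A(2), of n N] that by simp
        then have disj: "(\<Union>n<N. A n) \<inter> A N = {}" by blast
        have "(\<Sum>n<Suc N. upper_variation \<nu> (A n)) \<le> upper_variation \<nu> (\<Union>n<N. A n) + upper_variation \<nu> (A N)"
          using Suc by (simp add: add_right_mono)
        also have "\<dots> \<le> upper_variation \<nu> ((\<Union>n<N. A n) \<union> A N)" by (rule step) (rule disj)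
        also have "(\<Union>n<N. A n) \<union> A N = (\<Union>n<Suc N. A n)" by (auto simp: lessThan_Suc)
        finally show ?case .
      qed
      also have "\<dots> \<le> upper_variation \<nu> (\<Union>n. A n)"
        unfolding upper_variation_def by (rule SUP_subset_mono) auto
      finally show "(\<Sum>n<N. upper_variation \<nu> (A n)) \<le> upper_variation \<nu> (\<Union>n. A n)" .
    qed simp
  qed
qed

lemma
  assumes "signed_borel_measure \<nu>"
  shows sets_positive_variation[simp]: "sets (positive_variation \<nu>) = sets borel"
    and space_positive_variation[simp]: "space (positive_variation \<nu>) = UNIV"
    and emeasure_positive_variation:
      "E \<in> sets borel \<Longrightarrow> emeasure (positive_variation \<nu>) E = upper_variation \<nu> E"
proof -
  have eq: "positive_variation \<nu> = measure_of UNIV (sets borel) (upper_variation \<nu>)"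
    unfolding positive_variation_def upper_variation_def ..
  show "sets (positive_variation \<nu>) = sets borel" "space (positive_variation \<nu>) = UNIV"
    unfolding eq using sets.sets_measure_of_eq[of borel] by (auto simp: space_measure_of_conv)
  assume E: "E \<in> sets borel"
  show "emeasure (positive_variation \<nu>) E = upper_variation \<nu> E"
    unfolding eq
  proof (rule emeasure_measure_of_sigma[OF _ _ _ E])
    show "sigma_algebra UNIV (sets borel)" using sets.sigma_algebra_axioms[of borel] by simp
    show "positive (sets borel) (upper_variation \<nu>)"
      unfolding positive_def upper_variation_def
      using signed_borel_measure_empty[OF assms] by (auto simp: subset_empty conj_commute cong: conj_cong)
  qed (rule countably_additive_upper_variation[OF assms])
qed

text \<open>If the variation were infinite, one could split off again and again a piece of mass
  larger than 1 in absolute value while keeping infinite variation in the remainder. The pieces are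
  disjoint, so their masses would have to tend to 0.\<close>

lemma upper_variation_finite:
  fixes \<nu> :: "'a::topological_space set \<Rightarrow> real"
  assumes \<nu>: "signed_borel_measure \<nu>"
  shows "upper_variation \<nu> UNIV < \<infinity>"
proof (rule ccontr)
  assume "\<not> upper_variation \<nu> UNIV < \<infinity>"
  then have inf0: "upper_variation \<nu> UNIV = \<infinity>" by (metis infinity_ennreal_def less_top)
  have split: "\<exists>F\<in>sets borel. F \<subseteq> E \<and> upper_variation \<nu> F = \<infinity> \<and> \<bar>\<nu> (E - F)\<bar> > 1"
    if E[measurable]: "E \<in> sets borel" and inf: "upper_variation \<nu> E = \<infinity>" for E
  proof -
    \<comment> \<open>Exceeding \<open>1 + \<bar>\<nu> E\<bar>\<close> forces both \<open>A\<close>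
      and \<open>E - A\<close> to have mass above 1 in absolute value, so whichever half inherits
      the infinite variation can be kept.\<close>
    have "ennreal (1 + \<bar>\<nu> E\<bar>) < upper_variation \<nu> E" unfolding inf by simp
    then obtain A where A[measurable]: "A \<in> sets borel" and AE: "A \<subseteq> E"
      and "ennreal (1 + \<bar>\<nu> E\<bar>) < ennreal (\<nu> A)"
      unfolding upper_variation_def less_SUP_iff by auto
    then have A1: "\<nu> A > 1 + \<bar>\<nu> E\<bar>" by (subst (asm) ennreal_less_iff) simp_all
    have "\<nu> (A \<union> (E - A)) = \<nu> A + \<nu> (E - A)"
      by (rule signed_borel_measure_Un[OF \<nu>]) auto
    moreover have "A \<union> (E - A) = E" "E - (E - A) = A" using AE by auto
    ultimately have B1: "\<bar>\<nu> (E - A)\<bar> > 1" using A1 by simp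
    have "upper_variation \<nu> E = upper_variation \<nu> A + upper_variation \<nu> (E - A)"
      using plus_emeasure[of A "positive_variation \<nu>" "E - A"] \<open>A \<union> (E - A) = E\<close>
      by (simp add: sets_positive_variation[OF \<nu>] emeasure_positive_variation[OF \<nu>])
    then have "upper_variation \<nu> A = \<infinity> \<or> upper_variation \<nu> (E - A) = \<infinity>"
      using inf unfolding infinity_ennreal_def by (metis ennreal_add_eq_top)
    then show ?thesis
    proof
      assume "upper_variation \<nu> A = \<infinity>"
      then show ?thesis using A AE B1 by blast
    next
      assume "upper_variation \<nu> (E - A) = \<infinity>"
      moreover have "\<bar>\<nu> (E - (E - A))\<bar> > 1" using A1 unfolding \<open>E - (E - A) = A\<close> by linarith
      moreover have "E - A \<in> sets borel" "E - A \<subseteq> E" by auto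
      ultimately show ?thesis by blast
    qed
  qed
  have "\<exists>F. \<forall>n::nat. (F n \<in> sets borel \<and> upper_variation \<nu> (F n) = \<infinity>)
      \<and> (F (Suc n) \<subseteq> F n \<and> \<bar>\<nu> (F n - F (Suc n))\<bar> > 1)"
  proof (rule dependent_nat_choice)
    show "\<exists>E. E \<in> sets borel \<and> upper_variation \<nu> E = \<infinity>" using inf0 by (intro exI[of _ UNIV]) simp
    show "\<exists>F. (F \<in> sets borel \<and> upper_variation \<nu> F = \<infinity>) \<and> F \<subseteq> E \<and> \<bar>\<nu> (E - F)\<bar> > 1"
      if "E \<in> sets borel \<and> upper_variation \<nu> E = \<infinity>" for E and n :: nat
      using split[of E] that by blast
  qed
  then obtain F where F: "\<And>n::nat. (F n \<in> sets borel \<and> upper_variation \<nu> (F n) = \<infinity>)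
      \<and> (F (Suc n) \<subseteq> F n \<and> \<bar>\<nu> (F n - F (Suc n))\<bar> > 1)" by blast
  have dec: "decseq F" by (rule decseq_SucI) (use F in blast)
  have "(\<lambda>n. \<nu> (F n - F (Suc n))) sums \<nu> (\<Union>n. F n - F (Suc n))"
  proof (rule signed_borel_measure_sums[OF \<nu>])
    show "disjoint_family (\<lambda>n. F n - F (Suc n))"
      unfolding disjoint_family_on_def
    proof (intro ballI impI)
      fix m n :: nat assume "m \<noteq> n"
      then show "(F m - F (Suc m)) \<inter> (F n - F (Suc n)) = {}"
        using dec[unfolded decseq_def, rule_format, of "Suc m" n]
              dec[unfolded decseq_def, rule_format, of "Suc n" m]
        by (cases "m < n") (auto simp: Suc_le_eq)
    qed
    show "F n - F (Suc n) \<in> sets borel" for n using F[of n] F[of "Suc n"] by (intro sets.Diff) simp_all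
  qed
  then have "(\<lambda>n. \<nu> (F n - F (Suc n))) \<longlonglongrightarrow> 0"
    using summable_LIMSEQ_zero sums_summable by blast
  from LIMSEQ_D[OF this, of 1] obtain n where "norm (\<nu> (F n - F (Suc n)) - 0) < 1"
    by (meson order_refl zero_less_one)
  then show False using F[of n] by simp
qed

lemma finite_measure_positive_variation:
  fixes \<nu> :: "'a::topological_space set \<Rightarrow> real"
  assumes \<nu>: "signed_borel_measure \<nu>"
  shows "finite_measure (positive_variation \<nu>)"
proof
  have "(UNIV :: 'a set) \<in> sets borel" by simp
  from emeasure_positive_variation[OF \<nu> this] upper_variation_finite[OF \<nu>]
  show "emeasure (positive_variation \<nu>) (space (positive_variation \<nu>)) \<noteq> \<infinity>"
    unfolding space_positive_variation[OF \<nu>] by (metis less_irrefl)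
qed

text \<open>For \<open>A\<close> inside \<open>E\<close> the mass of \<open>A\<close> is that of
  \<open>E\<close> minus that of \<open>E - A\<close>, so complements exchange competitors for
  \<open>\<nu>\<close> with competitors for its negative; finiteness of both variations permits the
  subtraction.\<close>

lemma Jordan_decomposition:
  assumes \<nu>: "signed_borel_measure \<nu>" and E[measurable]: "E \<in> sets borel"
  shows "\<nu> E = measure (positive_variation \<nu>) E - measure (positive_variation (\<lambda>E. - \<nu> E)) E"
proof -
  note \<nu>' = signed_borel_measure_uminus[OF \<nu>]
  interpret P: finite_measure "positive_variation \<nu>" by (rule finite_measure_positive_variation[OF \<nu>])
  interpret N: finite_measure "positive_variation (\<lambda>E. - \<nu> E)" by (rule finite_measure_positive_variation[OF \<nu>'])
  have ub: "\<rho> A \<le> measure (positive_variation \<rho>) F"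
    if \<rho>: "signed_borel_measure \<rho>" and "A \<in> sets borel" "A \<subseteq> F" "F \<in> sets borel" for \<rho> :: "'a set \<Rightarrow> real" and A F
  proof -
    interpret R: finite_measure "positive_variation \<rho>" by (rule finite_measure_positive_variation[OF \<rho>])
    show ?thesis
      using upper_variation_upper[OF that(2,3), of \<rho>] emeasure_positive_variation[OF \<rho> that(4)]
      unfolding R.emeasure_eq_measure by (metis ennreal_le_iff measure_nonneg)
  qed
  have lub: "measure (positive_variation \<rho>) F \<le> c"
    if \<rho>: "signed_borel_measure \<rho>" and c: "c \<ge> 0" "\<And>A. A \<in> sets borel \<Longrightarrow> A \<subseteq> F \<Longrightarrow> \<rho> A \<le> c" "F \<in> sets borel"
    for \<rho> :: "'a set \<Rightarrow> real" and c F
  proof -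
    interpret R: finite_measure "positive_variation \<rho>" by (rule finite_measure_positive_variation[OF \<rho>])
    have "emeasure (positive_variation \<rho>) F \<le> ennreal c"
      unfolding emeasure_positive_variation[OF \<rho> c(3)] upper_variation_def
      by (rule SUP_least) (use c in \<open>auto intro: ennreal_leI\<close>)
    then show ?thesis using c(1) by (simp add: R.emeasure_eq_measure ennreal_le_iff)
  qed
  have compl: "\<nu> E = \<nu> A + \<nu> (E - A)" if "A \<in> sets borel" "A \<subseteq> E" for A
  proof -
    have "A \<union> (E - A) = E" using that by auto
    then show ?thesis using signed_borel_measure_Un[OF \<nu>, of A "E - A"] that by auto
  qed
  have nn: "measure (positive_variation (\<lambda>E. - \<nu> E)) E + \<nu> E \<ge> 0"
    using ub[OF \<nu>', of E E] by simp
  have "measure (positive_variation \<nu>) E \<le> measure (positive_variation (\<lambda>E. - \<nu> E)) E + \<nu> E"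
  proof (rule lub[OF \<nu> nn _ E])
    fix A :: "'a set" assume A: "A \<in> sets borel" "A \<subseteq> E"
    then have "- \<nu> (E - A) \<le> measure (positive_variation (\<lambda>E. - \<nu> E)) E"
      by (intro ub[OF \<nu>']) auto
    then show "\<nu> A \<le> measure (positive_variation (\<lambda>E. - \<nu> E)) E + \<nu> E" using compl[OF A] by simp
  qed
  moreover have "measure (positive_variation (\<lambda>E. - \<nu> E)) E \<le> measure (positive_variation \<nu>) E - \<nu> E"
  proof (rule lub[OF \<nu>' _ _ E])
    show "0 \<le> measure (positive_variation \<nu>) E - \<nu> E" using ub[OF \<nu>, of E E] by simp
    fix A :: "'a set" assume A: "A \<in> sets borel" "A \<subseteq> E"
    then have "\<nu> (E - A) \<le> measure (positive_variation \<nu>) E"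
      by (intro ub[OF \<nu>]) auto
    then show "- \<nu> A \<le> measure (positive_variation \<nu>) E - \<nu> E" using compl[OF A] by simp
  qed
  ultimately show ?thesis by simp
qed

section \<open>Arc length and densities on the hyperbola\<close>

text \<open>One number can bound both the diameters and the total length, because a cover admissible
  for a small \<delta> stays admissible for a larger one.\<close>

lemma arc_length_eq_0I:
  assumes "\<And>\<delta>. \<delta> > 0 \<Longrightarrow> \<exists>U::nat \<Rightarrow> 'a::metric_space set. E \<subseteq> (\<Union>n. U n) \<and>
    (\<forall>n. bounded (U n) \<and> diameter (U n) \<le> \<delta>) \<and> (\<Sum>n. ennreal (diameter (U n))) \<le> ennreal \<delta>"
  shows "arc_length E = 0"
proof -
  have "(INF U\<in>{U :: nat \<Rightarrow> 'a set. E \<subseteq> (\<Union>n. U n) \<and> (\<forall>n. bounded (U n) \<and> diameter (U n) \<le> \<delta>)}.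
        (\<Sum>n. ennreal (diameter (U n)))) \<le> 0" if "\<delta> > 0" for \<delta> :: real
  proof (rule ennreal_le_epsilon)
    fix e :: real assume "e > 0"
    then obtain U :: "nat \<Rightarrow> 'a set" where U: "E \<subseteq> (\<Union>n. U n)" "\<forall>n. bounded (U n) \<and> diameter (U n) \<le> min \<delta> e"
      "(\<Sum>n. ennreal (diameter (U n))) \<le> ennreal (min \<delta> e)"
      using assms[of "min \<delta> e"] \<open>\<delta> > 0\<close> by auto
    have "(INF U\<in>{U :: nat \<Rightarrow> 'a set. E \<subseteq> (\<Union>n. U n) \<and> (\<forall>n. bounded (U n) \<and> diameter (U n) \<le> \<delta>)}.
        (\<Sum>n. ennreal (diameter (U n)))) \<le> (\<Sum>n. ennreal (diameter (U n)))"
      by (rule INF_lower) (use U in auto)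
    also note U(3)
    also have "ennreal (min \<delta> e) \<le> 0 + ennreal e" by (simp add: ennreal_leI)
    finally show "(INF U\<in>{U :: nat \<Rightarrow> 'a set. E \<subseteq> (\<Union>n. U n) \<and> (\<forall>n. bounded (U n) \<and> diameter (U n) \<le> \<delta>)}.
        (\<Sum>n. ennreal (diameter (U n)))) \<le> 0 + ennreal e" .
  qed
  then show ?thesis
    unfolding arc_length_def by (intro antisym SUP_least) auto
qed

lemma arc_length_mono: "E \<subseteq> F \<Longrightarrow> arc_length E \<le> arc_length F"
  unfolding arc_length_def by (intro SUP_mono' INF_superset_mono) auto

text \<open>A null set has covers by nonoverlapping intervals of arbitrarily small total length, and
  a Lipschitz map enlarges diameters at most by the factor \<open>L\<close>.\<close>

lemma arc_length_Lipschitz_null: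
  fixes f :: "real \<Rightarrow> 'a::real_normed_vector"
  assumes N: "N \<in> null_sets lborel" "N \<subseteq> {a..b}"
    and lip: "\<And>x y. x \<in> {a..b} \<Longrightarrow> y \<in> {a..b} \<Longrightarrow> dist (f x) (f y) \<le> L * \<bar>x - y\<bar>" and "L > 0"
  shows "arc_length (f ` N) = 0"
proof (rule arc_length_eq_0I)
  fix \<delta> :: real assume "\<delta> > 0"
  define e where "e = \<delta> / L"
  have "e > 0" using \<open>\<delta> > 0\<close> \<open>L > 0\<close> by (simp add: e_def)
  have Nl: "N \<in> null_sets lebesgue" using N(1) null_sets_completionI by blast
  have "N \<in> lmeasurable" using Nl by (rule fmeasurableI_null_sets)
  have mN: "measure lebesgue N = 0" using Nl by (simp add: measure_def null_sets_def)
  obtain \<D> where D: "countable \<D>"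
    and DK: "\<And>K. K \<in> \<D> \<Longrightarrow> K \<subseteq> cbox a b \<and> K \<noteq> {} \<and> (\<exists>c d. K = cbox c d)"
    and Dpw: "pairwise (\<lambda>A B. interior A \<inter> interior B = {}) \<D>"
    and Dcov: "N \<subseteq> \<Union>\<D>" and DM: "\<Union>\<D> \<in> lmeasurable"
    and Dle: "measure lebesgue (\<Union>\<D>) \<le> measure lebesgue N + e"
    by (rule measurable_outer_intervals_bounded[OF \<open>N \<in> lmeasurable\<close> _ \<open>e > 0\<close>, of a b])
      (use N(2) in auto)
  define U where "U n = \<Union>{K\<in>\<D>. to_nat_on \<D> K = n}" for n
  have Ucases: "U n = {} \<or> (U n \<in> \<D> \<and> to_nat_on \<D> (U n) = n)" for n
  proof (cases "\<exists>K\<in>\<D>. to_nat_on \<D> K = n")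
    case True
    then obtain K where K: "K \<in> \<D>" "to_nat_on \<D> K = n" by auto
    then have "{K\<in>\<D>. to_nat_on \<D> K = n} = {K}"
      using inj_on_to_nat_on[OF D] by (auto dest: inj_onD)
    then show ?thesis using K by (simp add: U_def)
  qed (auto simp: U_def)
  have Ucov: "(\<Union>n. U n) = \<Union>\<D>" by (auto simp: U_def)
  have disj: "disjoint_family (\<lambda>n. interior (U n))"
    unfolding disjoint_family_on_def
  proof (intro ballI impI)
    fix m n :: nat assume "m \<noteq> n"
    show "interior (U m) \<inter> interior (U n) = {}"
    proof (cases "U m = {} \<or> U n = {}")
      case False
      then have "U m \<in> \<D>" "U n \<in> \<D>" "U m \<noteq> U n" using Ucases[of m] Ucases[of n] \<open>m \<noteq> n\<close> by auto
      then show ?thesis using Dpw by (auto simp: pairwise_def)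
    qed auto
  qed
  have Uint: "U n = {} \<or> (\<exists>c d. c \<le> d \<and> U n = {c..d})" for n
  proof (cases "U n = {}")
    case False
    then have "U n \<in> \<D>" using Ucases[of n] by simp
    then obtain c d where "U n = cbox c d" using DK by blast
    with False show ?thesis by (intro disjI2 exI[of _ c] exI[of _ d]) auto
  qed simp
  \<comment> \<open>The intervals may share endpoints, so lengths are measured on the interiors,
    which are disjoint and equally long.\<close>
  have diamU: "ennreal (diameter (U n)) = emeasure lborel (interior (U n))" for n
    using Uint[of n] by (auto simp: diameter_closed_interval)
  have sumU: "(\<Sum>n. ennreal (diameter (U n))) \<le> ennreal e"
  proof -
    have "(\<Sum>n. ennreal (diameter (U n))) = emeasure lborel (\<Union>n. interior (U n))"
      unfolding diamU by (rule suminf_emeasure) (use disj in auto)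
    also have "\<dots> = emeasure lebesgue (\<Union>n. interior (U n))"
      by (subst emeasure_completion) (auto intro!: borel_open)
    also have "\<dots> \<le> emeasure lebesgue (\<Union>\<D>)"
    proof (rule emeasure_mono)
      show "(\<Union>n. interior (U n)) \<subseteq> \<Union>\<D>"
        unfolding Ucov[symmetric] by (intro UN_mono interior_subset order_refl)
    qed (use DM in \<open>simp add: fmeasurableD\<close>)
    also have "\<dots> \<le> ennreal e"
      using Dle emeasure_eq_measure2[OF DM] by (simp add: mN ennreal_leI)
    finally show ?thesis .
  qed
  have diamU_le: "diameter (U n) \<le> e" for n
  proof -
    have "ennreal (diameter (U n)) \<le> (\<Sum>n. ennreal (diameter (U n)))"
      using sum_le_suminf[of "\<lambda>n. ennreal (diameter (U n))" "{n}"] by simp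
    also note sumU
    finally show ?thesis using \<open>e > 0\<close> by simp
  qed
  have Usub: "U n \<subseteq> {a..b}" for n using Ucases[of n] DK[of "U n"] by auto
  have bU: "bounded (U n)" for n by (rule bounded_subset[OF _ Usub]) simp
  have dfU: "dist (f x) (f y) \<le> L * diameter (U n)" if "x \<in> U n" "y \<in> U n" for x y n
  proof -
    have "dist (f x) (f y) \<le> L * \<bar>x - y\<bar>" using lip Usub that by blast
    also have "\<dots> \<le> L * diameter (U n)"
      using diameter_bounded_bound[OF bU that] \<open>L > 0\<close> by (simp add: dist_real_def)
    finally show ?thesis .
  qed
  have diam_f: "diameter (f ` U n) \<le> L * diameter (U n)" for n
    by (rule diameter_le) (use dfU \<open>L > 0\<close> diameter_ge_0[OF bU] in \<open>auto simp: dist_norm\<close>)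
  have bf: "bounded (f ` U n)" for n
    unfolding bounded_two_points using dfU by blast
  have Le: "L * e = \<delta>" using \<open>L > 0\<close> by (simp add: e_def)
  show "\<exists>V. f ` N \<subseteq> (\<Union>n. V n) \<and>
    (\<forall>n. bounded (V n) \<and> diameter (V n) \<le> \<delta>) \<and> (\<Sum>n. ennreal (diameter (V n))) \<le> ennreal \<delta>"
  proof (intro exI[of _ "\<lambda>n. f ` U n"] conjI allI)
    show "f ` N \<subseteq> (\<Union>n. f ` U n)" 
      using Dcov unfolding Ucov[symmetric] image_UN[symmetric] by (rule image_mono)
    show "bounded (f ` U n)" for n by (rule bf)
    show "diameter (f ` U n) \<le> \<delta>" for n
      using diam_f[of n] mult_left_mono[OF diamU_le[of n], of L] \<open>L > 0\<close> Le by simp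
    have "(\<Sum>n. ennreal (diameter (f ` U n))) \<le> (\<Sum>n. ennreal L * ennreal (diameter (U n)))"
      by (rule suminf_le)
        (use diam_f \<open>L > 0\<close> diameter_ge_0[OF bU] in \<open>auto simp: ennreal_mult[symmetric] intro!: ennreal_leI\<close>)
    also have "\<dots> \<le> ennreal L * ennreal e"
      using sumU by (simp add: mult_left_mono)
    also have "\<dots> = ennreal \<delta>" using \<open>L > 0\<close> \<open>e > 0\<close> Le by (simp add: ennreal_mult[symmetric])
    finally show "(\<Sum>n. ennreal (diameter (f ` U n))) \<le> ennreal \<delta>" .
  qed
qed

text \<open>The first projection does not increase distances, so a cover of a piece of the plane
  projects to a cover of its shadow by intervals of comparable total length.\<close>

lemma null_sets_of_arc_length_null:
  fixes E :: "(real \<times> real) set"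
  assumes "arc_length E = 0" and B: "B \<in> sets borel" "B \<subseteq> fst ` E"
  shows "B \<in> null_sets lborel"
proof -
  have "emeasure lborel B \<le> 0"
  proof (rule ennreal_le_epsilon)
    fix e :: real assume "e > 0"
    have "(INF U\<in>{U :: nat \<Rightarrow> (real \<times> real) set. E \<subseteq> (\<Union>n. U n) \<and> (\<forall>n. bounded (U n) \<and> diameter (U n) \<le> 1)}.
        (\<Sum>n. ennreal (diameter (U n)))) \<le> arc_length E"
      unfolding arc_length_def by (rule SUP_upper[of 1 "{0<..}" "\<lambda>\<delta>. INF U\<in>{U :: nat \<Rightarrow> (real \<times> real) set. E \<subseteq> (\<Union>n. U n) \<and> (\<forall>n. bounded (U n) \<and> diameter (U n) \<le> \<delta>)}.
        (\<Sum>n. ennreal (diameter (U n)))"]) simp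
    also have "\<dots> < ennreal (e / 2)" using \<open>e > 0\<close> assms(1) by simp
    finally obtain U :: "nat \<Rightarrow> (real \<times> real) set" where U: "E \<subseteq> (\<Union>n. U n)" "\<And>n. bounded (U n)"
      "(\<Sum>n. ennreal (diameter (U n))) < ennreal (e / 2)"
      unfolding INF_less_iff by auto
    \<comment> \<open>An interval centred at the projection of a point of \<open>U n\<close> with
      the diameter as radius has twice that length, which is why the cover was chosen with sum below
      \<open>e / 2\<close>.\<close>
    have "\<exists>J. J \<in> sets borel \<and> fst ` U n \<subseteq> J \<and> emeasure lborel J \<le> 2 * ennreal (diameter (U n))" for n
    proof (cases "U n = {}")
      case False
      then obtain p where p: "p \<in> U n" by auto
      let ?d = "diameter (U n)"
      have "?d \<ge> 0" by (rule diameter_ge_0[OF U(2)])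
      have "fst ` U n \<subseteq> {fst p - ?d..fst p + ?d}"
      proof clarify
        fix x y assume "(x, y) \<in> U n"
        have "\<bar>x - fst p\<bar> \<le> dist (x, y) p" using dist_fst_le[of "(x,y)" p] by (simp add: dist_real_def)
        also have "\<dots> \<le> ?d" by (rule diameter_bounded_bound[OF U(2) \<open>(x, y) \<in> U n\<close> p])
        finally show "fst (x, y) \<in> {fst p - ?d..fst p + ?d}" by auto
      qed
      moreover have "emeasure lborel {fst p - ?d..fst p + ?d} = 2 * ennreal ?d"
        using \<open>?d \<ge> 0\<close> by (simp add: ennreal_mult[symmetric] flip: ennreal_numeral)
      ultimately show ?thesis by (intro exI[of _ "{fst p - ?d..fst p + ?d}"]) auto
    qed (intro exI[of _ "{}"], auto)
    then obtain J where J: "\<And>n. J n \<in> sets borel" "\<And>n. fst ` U n \<subseteq> J n"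
      "\<And>n. emeasure lborel (J n) \<le> 2 * ennreal (diameter (U n))" by metis
    have "B \<subseteq> (\<Union>n. J n)" using B(2) U(1) J(2) by fastforce
    then have "emeasure lborel B \<le> emeasure lborel (\<Union>n. J n)"
      by (rule emeasure_mono) (use J(1) in auto)
    also have "\<dots> \<le> (\<Sum>n. emeasure lborel (J n))"
      by (rule emeasure_subadditive_countably) (use J(1) in auto)
    also have "\<dots> \<le> (\<Sum>n. 2 * ennreal (diameter (U n)))"
      by (rule suminf_le) (use J(3) in auto)
    also have "\<dots> = 2 * (\<Sum>n. ennreal (diameter (U n)))" by simp
    also have "\<dots> \<le> 2 * ennreal (e / 2)" using U(3) by (intro mult_left_mono) auto
    also have "\<dots> = ennreal e" using \<open>e > 0\<close> by (simp add: ennreal_mult[symmetric] flip: ennreal_numeral)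
    finally show "emeasure lborel B \<le> 0 + ennreal e" by simp
  qed
  then show ?thesis using B(1) by (simp add: null_sets_def)
qed

section \<open>Measures on the branch and their densities along the first axis\<close>

definition curve_measure :: "real \<Rightarrow> (real \<Rightarrow> complex) \<Rightarrow> (real \<times> real) set \<Rightarrow> complex" where
  "curve_measure c k E =
     (if E \<in> sets borel then \<integral>x. indicator E (x, c / x) *\<^sub>R k x \<partial>lborel else 0)"

lemma hyperbola_branch_iff:
  "z \<in> hyperbola_branch M \<longleftrightarrow> fst z > 0 \<and> snd z = M\<^sup>2 / (4 * pi\<^sup>2) / fst z"
  by (cases z) (auto simp: hyperbola_branch_def field_simps)

lemma borel_measurable_graph[measurable]: "(\<lambda>x::real. (x, c / x)) \<in> borel_measurable borel"
  by (intro borel_measurable_Pair) auto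

lemma borel_measurable_fst_snd:
  "fst \<in> borel_measurable (borel :: (real \<times> real) measure)"
  "snd \<in> borel_measurable (borel :: (real \<times> real) measure)"
  by (auto intro!: borel_measurable_continuous_onI continuous_intros)

lemma hyperbola_branch_borel: "hyperbola_branch M \<in> sets borel"
proof -
  note [measurable] = borel_measurable_fst_snd
  have "{z \<in> space borel. fst z > 0 \<and> snd z = M\<^sup>2 / (4 * pi\<^sup>2) / fst z} \<in> sets borel"
    by measurable
  also have "{z \<in> space borel. fst z > 0 \<and> snd z = M\<^sup>2 / (4 * pi\<^sup>2) / fst z} = hyperbola_branch M"
    by (auto simp: hyperbola_branch_iff)
  finally show ?thesis .
qed

text \<open>On an interval starting at a > 0 the slope of c / x is at most c / a^2 in absolute
  value. Near 0 there is no Lipschitz bound, so the whole branch has to be exhausted by such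
  pieces.\<close>

lemma arc_length_hyperbola_null:
  fixes a b c :: real
  assumes "N \<in> null_sets lborel" "N \<subseteq> {a..b}" "a > 0" "c > 0"
  shows "arc_length ((\<lambda>x. (x, c / x)) ` N) = 0"
proof (rule arc_length_Lipschitz_null[OF assms(1,2)])
  show "1 + c / a\<^sup>2 > 0" using assms by (simp add: add_pos_pos)
  fix x y assume "x \<in> {a..b}" "y \<in> {a..b}"
  then have xy: "a \<le> x" "a \<le> y" "0 < x" "0 < y" using assms(3) by auto
  have "dist (x, c / x) (y, c / y) \<le> \<bar>x - y\<bar> + \<bar>c / x - c / y\<bar>"
    unfolding dist_prod_def using sqrt_sum_squares_le_sum_abs by (simp add: dist_real_def)
  also have "c / x - c / y = c * (y - x) / (x * y)" using xy by (simp add: field_simps)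
  also have "\<bar>c * (y - x) / (x * y)\<bar> = c * \<bar>x - y\<bar> / (x * y)"
    using xy assms(4) by (simp add: abs_mult abs_minus_commute)
  also have "\<dots> \<le> c * \<bar>x - y\<bar> / a\<^sup>2"
    using xy assms(3,4) by (intro divide_left_mono) (auto simp: power2_eq_square intro!: mult_mono)
  finally show "dist (x, c / x) (y, c / y) \<le> (1 + c / a\<^sup>2) * \<bar>x - y\<bar>"
    by (simp add: algebra_simps)
qed

text \<open>On the branch a point is determined by its first coordinate, so \<open>P\<close> is
  recovered from its first marginal \<open>Q\<close>. Radon-Nikodym applies to \<open>Q\<close>
  because Lebesgue null sets of the axis lift to sets of zero arc length.\<close>

lemma hyperbola_density:
  fixes P :: "(real \<times> real) measure"
  assumes "finite_measure P" and sets_P[simp, measurable_cong]: "sets P = sets borel" and "M > 0"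
    and null: "\<And>E. E \<in> sets borel \<Longrightarrow> arc_length (E \<inter> hyperbola_branch M) = 0 \<Longrightarrow> emeasure P E = 0"
  obtains p where "integrable lborel p" "\<And>x. 0 \<le> p x" "\<And>x. x \<le> 0 \<Longrightarrow> p x = 0"
    "P = distr (density lborel (\<lambda>x. ennreal (p x))) borel (\<lambda>x. (x, M\<^sup>2 / (4 * pi\<^sup>2) / x))"
proof -
  define c where "c = M\<^sup>2 / (4 * pi\<^sup>2)"
  have "c > 0" using \<open>M > 0\<close> by (simp add: c_def)
  define g :: "real \<Rightarrow> real \<times> real" where "g x = (x, c / x)" for x
  have g[measurable]: "g \<in> borel_measurable borel" unfolding g_def by measurable
  note [measurable] = borel_measurable_fst_snd
  interpret P: finite_measure P by fact
  have spP: "space P = UNIV" using sets_eq_imp_space_eq[OF sets_P] by simp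
  let ?\<Gamma> = "hyperbola_branch M"
  note \<Gamma>[measurable] = hyperbola_branch_borel[of M]
  have \<Gamma>_iff: "z \<in> ?\<Gamma> \<longleftrightarrow> fst z > 0 \<and> z = g (fst z)" for z
    by (cases z) (auto simp: hyperbola_branch_iff g_def c_def)
  have fst_g[simp]: "fst (g x) = x" for x by (simp add: g_def)
  have arc0: "arc_length ({} :: (real \<times> real) set) = 0"
    by (rule arc_length_eq_0I) (auto intro!: exI[of _ "\<lambda>_. {}"])
  have "emeasure P (- ?\<Gamma>) = 0"
    by (rule null) (use arc0 in \<open>auto simp: Compl_disjoint2\<close>)
  then have AE\<Gamma>: "AE z in P. z \<in> ?\<Gamma>"
    by (intro AE_I[of _ _ "- ?\<Gamma>"]) auto
  define Q where "Q = distr P borel fst"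
  have [simp, measurable_cong]: "sets Q = sets borel" by (simp add: Q_def)
  have emQ: "emeasure Q A = emeasure P (fst -` A)" if "A \<in> sets borel" for A
    unfolding Q_def using that by (subst emeasure_distr) (auto simp: spP)
  have vi: "(fst -` A :: (real \<times> real) set) \<in> sets borel" if "A \<in> sets borel" for A :: "real set"
    using measurable_sets_borel[OF borel_measurable_fst_snd(1) that] .
  have Qneg: "emeasure Q {..0} = 0"
  proof -
    have "fst -` {..0::real} \<inter> ?\<Gamma> = {}" by (auto simp: hyperbola_branch_iff)
    then show ?thesis unfolding emQ[OF borel_closed[OF closed_atMost]]
      using null[OF vi[OF borel_closed[OF closed_atMost]]] arc0 by simp
  qed
  have ac: "absolutely_continuous lborel Q"
    unfolding absolutely_continuous_def
  proof
    fix N assume N: "N \<in> null_sets (lborel :: real measure)"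
    then have [measurable]: "N \<in> sets borel" by auto
    \<comment> \<open>Cuts the null set down to compact intervals inside the positive half-line, on
      which the parametrization is Lipschitz; what is left over is nonpositive and treated by
      \<open>Qneg\<close>.\<close>
    define A where "A n = N \<inter> {1 / real (Suc n)..real (Suc n)}" for n
    have [measurable]: "A n \<in> sets borel" for n by (simp add: A_def)
    have An: "A n \<in> null_sets lborel" for n
      using N by (auto simp: A_def intro: null_set_Int2)
    have "emeasure Q (A n) = 0" for n
      unfolding emQ[OF \<open>A n \<in> sets borel\<close>]
    proof (rule null)
      have "fst -` A n \<inter> ?\<Gamma> \<subseteq> g ` A n"
      proof
        fix z assume "z \<in> fst -` A n \<inter> ?\<Gamma>"
        then have "fst z \<in> A n" "z = g (fst z)" by (auto simp: \<Gamma>_iff)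
        then show "z \<in> g ` A n" by blast
      qed
      then have "arc_length (fst -` A n \<inter> ?\<Gamma>) \<le> arc_length (g ` A n)" by (rule arc_length_mono)
      also have "arc_length (g ` A n) = 0"
        unfolding g_def
        by (rule arc_length_hyperbola_null[OF An, of _ "1 / real (Suc n)" "real (Suc n)"])
          (use \<open>c > 0\<close> in \<open>auto simp: A_def\<close>)
      finally show "arc_length (fst -` A n \<inter> ?\<Gamma>) = 0" by simp
    qed (rule vi, simp)
    then have "(\<Union>n. A n) \<in> null_sets Q" by (intro null_sets_UN) auto
    moreover have "{..0} \<in> null_sets Q" using Qneg by auto
    ultimately have "(\<Union>n. A n) \<union> {..0} \<in> null_sets Q" by auto
    moreover have "N \<subseteq> (\<Union>n. A n) \<union> {..0}"
    proof
      fix x assume "x \<in> N"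
      show "x \<in> (\<Union>n. A n) \<union> {..0}"
      proof (cases "x > 0")
        case True
        obtain m :: nat where "max x (1 / x) \<le> real m" using real_arch_simple by blast
        then have "x \<le> real (Suc m)" "1 / x \<le> real (Suc m)" by auto
        then have "1 / real (Suc m) \<le> x" using True by (simp add: field_simps)
        then have "x \<in> A m" using \<open>x \<in> N\<close> \<open>x \<le> real (Suc m)\<close> by (simp add: A_def)
        then show ?thesis by blast
      qed auto
    qed
    ultimately show "N \<in> null_sets Q" using null_sets_subset[of "(\<Union>n. A n) \<union> {..0}" Q N] by simp
  qed
  obtain f where f[measurable]: "f \<in> borel_measurable lborel" and fQ: "density lborel f = Q"
    using sigma_finite_measure.Radon_Nikodym[OF sigma_finite_lborel ac] by auto
  have "(\<integral>\<^sup>+x. f x \<partial>lborel) = emeasure Q UNIV"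
    unfolding fQ[symmetric] by (subst emeasure_density) auto
  also have "\<dots> < \<infinity>" unfolding emQ[OF borel_open[OF open_UNIV]] by (simp add: P.emeasure_finite less_top[symmetric])
  finally have f_fin: "(\<integral>\<^sup>+x. f x \<partial>lborel) < \<infinity>" .
  then have AEf: "AE x in lborel. f x \<noteq> \<infinity>" by (intro nn_integral_PInf_AE) auto
  have "(\<integral>\<^sup>+x. f x * indicator {..0} x \<partial>lborel) = 0"
    using Qneg unfolding fQ[symmetric] by (subst (asm) emeasure_density) auto
  then have AEneg: "AE x in lborel. f x * indicator {..0} x = 0"
    by (subst (asm) nn_integral_0_iff_AE) auto
  \<comment> \<open>The density is finite almost everywhere and vanishes almost everywhere on the
    nonpositive half-line, so this real version, zero there at every point, gives the same
    measure.\<close>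
  define p where "p x = (if x > 0 then enn2real (f x) else 0)" for x :: real
  have [measurable]: "p \<in> borel_measurable borel" unfolding p_def by measurable
  have pf: "AE x in lborel. ennreal (p x) = f x"
    using AEf AEneg by eventually_elim (auto simp: p_def less_top indicator_def split: if_splits)
  have dp: "density lborel (\<lambda>x. ennreal (p x)) = Q"
    unfolding fQ[symmetric] by (rule density_cong) (use pf in auto)
  have int: "integrable lborel p"
  proof (rule integrableI_nonneg)
    show "(\<integral>\<^sup>+x. ennreal (p x) \<partial>lborel) < \<infinity>"
      using f_fin nn_integral_cong_AE[OF pf] by simp
  qed (auto simp: p_def)
  show ?thesis
  proof (rule that[of p])
    show "P = distr (density lborel (\<lambda>x. ennreal (p x))) borel (\<lambda>x. (x, M\<^sup>2 / (4 * pi\<^sup>2) / x))"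
      unfolding dp c_def[symmetric] g_def[symmetric]
    proof (rule measure_eqI)
      fix E assume "E \<in> sets P"
      then have E[measurable]: "E \<in> sets borel" by simp
      have gE: "g -` E \<in> sets borel" using measurable_sets_borel[OF g E] .
      have "emeasure (distr Q borel g) E = emeasure P (fst -` g -` E)"
        by (subst emeasure_distr) (auto simp: emQ[OF gE] sets_eq_imp_space_eq[of Q borel])
      also have "\<dots> = emeasure P E"
      proof (rule emeasure_eq_AE)
        show "AE z in P. z \<in> fst -` g -` E \<longleftrightarrow> z \<in> E"
          using AE\<Gamma> by eventually_elim (auto simp: \<Gamma>_iff)
      qed (use vi[OF gE] in auto)
      finally show "emeasure P E = emeasure (distr Q borel g) E" ..
    qed simp
  qed (auto simp: p_def int)
qed

lemma positive_variation_null: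
  assumes \<nu>: "signed_borel_measure \<nu>" and E: "E \<in> sets borel"
    and null: "\<And>A. A \<in> sets borel \<Longrightarrow> A \<subseteq> E \<Longrightarrow> \<nu> A = 0"
  shows "emeasure (positive_variation \<nu>) E = 0"
proof -
  have "upper_variation \<nu> E \<le> 0"
    unfolding upper_variation_def by (rule SUP_least) (use null in auto)
  then show ?thesis by (simp add: emeasure_positive_variation[OF \<nu> E])
qed

lemma
  fixes p :: "real \<Rightarrow> real" and f :: "'a::topological_space \<Rightarrow> 'b::{banach, second_countable_topology}"
  assumes p: "integrable lborel p" "\<And>x. 0 \<le> p x" and g[measurable]: "g \<in> borel_measurable borel"
    and P: "P = distr (density lborel (\<lambda>x. ennreal (p x))) borel g"
  shows integral_distr_density:
      "f \<in> borel_measurable borel \<Longrightarrow> (\<integral>z. f z \<partial>P) = (\<integral>x. p x *\<^sub>R f (g x) \<partial>lborel)"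
    and measure_distr_density:
      "E \<in> sets borel \<Longrightarrow> measure P E = (\<integral>x. p x * indicator E (g x) \<partial>lborel)"
proof -
  have [measurable]: "p \<in> borel_measurable borel" using p(1) by auto
  have main: "(\<integral>z. h z \<partial>P) = (\<integral>x. p x *\<^sub>R h (g x) \<partial>lborel)"
    if [measurable]: "h \<in> borel_measurable borel" for h :: "'a \<Rightarrow> 'c::{banach, second_countable_topology}"
    unfolding P using p(2) by (simp add: integral_distr integral_density)
  show "f \<in> borel_measurable borel \<Longrightarrow> (\<integral>z. f z \<partial>P) = (\<integral>x. p x *\<^sub>R f (g x) \<partial>lborel)"
    by (rule main)
  assume [measurable]: "E \<in> sets borel"
  have "(\<integral>z. indicator E z \<partial>P) = measure P E"
    by (subst Bochner_Integration.integral_indicator) (simp add: P)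
  then show "measure P E = (\<integral>x. p x * indicator E (g x) \<partial>lborel)"
    using main[of "indicator E :: _ \<Rightarrow> real"] by simp
qed

text \<open>The Fourier transform is defined through the Jordan parts of the real and imaginary
  parts of the measure. Each of the four parts inherits the null sets of \<open>\<mu>\<close>, hence
  has a density along the curve, and \<open>k\<close> is their complex combination.\<close>

lemma AC_hyperbola_density:
  assumes \<mu>: "\<mu> \<in> AC (hyperbola_branch M)" and "M > 0"
  obtains k where "integrable lborel k" "\<And>x. x \<le> 0 \<Longrightarrow> k x = 0"
    "\<mu> = curve_measure (M\<^sup>2 / (4 * pi\<^sup>2)) k"
    "\<And>\<xi>. fourier_transform \<mu> \<xi> =
       (\<integral>x. exp (\<i> * complex_of_real (pi * ((x, M\<^sup>2 / (4 * pi\<^sup>2) / x) \<bullet> \<xi>))) * k x \<partial>lborel)"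
proof -
  define c where "c = M\<^sup>2 / (4 * pi\<^sup>2)"
  define g :: "real \<Rightarrow> real \<times> real" where "g x = (x, c / x)" for x
  have g[measurable]: "g \<in> borel_measurable borel" unfolding g_def by measurable
  have cb: "complex_borel_measure \<mu>"
    and zero: "\<And>E. E \<in> sets borel \<Longrightarrow> arc_length (E \<inter> hyperbola_branch M) = 0 \<Longrightarrow> \<mu> E = 0"
    using \<mu> by (auto simp: AC_def)
  have ex: "\<exists>p. integrable lborel p \<and> (\<forall>x. 0 \<le> p x) \<and> (\<forall>x\<le>0. p x = 0) \<and>
      positive_variation \<nu> = distr (density lborel (\<lambda>x. ennreal (p x))) borel g"
    \<comment> \<open>Used for plus and minus the real and imaginary part of \<open>\<mu>\<close>;
      the hypothesis \<open>z\<close> hands the vanishing of \<open>\<mu>\<close> on to each of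
      them.\<close>
    if \<nu>: "signed_borel_measure \<nu>" and z: "\<And>E. \<mu> E = 0 \<Longrightarrow> \<nu> E = 0" for \<nu> :: "(real \<times> real) set \<Rightarrow> real"
  proof -
    have "emeasure (positive_variation \<nu>) E = 0"
      if E: "E \<in> sets borel" and arc: "arc_length (E \<inter> hyperbola_branch M) = 0" for E
    proof (rule positive_variation_null[OF \<nu> E])
      fix A assume A: "A \<in> sets borel" "A \<subseteq> E"
      have "arc_length (A \<inter> hyperbola_branch M) \<le> arc_length (E \<inter> hyperbola_branch M)"
        by (rule arc_length_mono) (use A in auto)
      then show "\<nu> A = 0" using z zero[OF A(1)] arc by simp
    qed
    from hyperbola_density[OF finite_measure_positive_variation[OF \<nu>] sets_positive_variation[OF \<nu>] \<open>M > 0\<close> this]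
    show ?thesis unfolding g_def c_def by metis
  qed
  note R = signed_borel_measure_Re[OF cb] and I = signed_borel_measure_Im[OF cb]
  obtain p1 where p1: "integrable lborel p1" "\<And>x. 0 \<le> p1 x" "\<And>x. x \<le> 0 \<Longrightarrow> p1 x = 0"
    and P1: "positive_variation (\<lambda>E. Re (\<mu> E)) = distr (density lborel (\<lambda>x. ennreal (p1 x))) borel g"
    using ex[OF R] by auto
  obtain p2 where p2: "integrable lborel p2" "\<And>x. 0 \<le> p2 x" "\<And>x. x \<le> 0 \<Longrightarrow> p2 x = 0"
    and P2: "positive_variation (\<lambda>E. - Re (\<mu> E)) = distr (density lborel (\<lambda>x. ennreal (p2 x))) borel g"
    using ex[OF signed_borel_measure_uminus[OF R]] by auto
  obtain p3 where p3: "integrable lborel p3" "\<And>x. 0 \<le> p3 x" "\<And>x. x \<le> 0 \<Longrightarrow> p3 x = 0"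
    and P3: "positive_variation (\<lambda>E. Im (\<mu> E)) = distr (density lborel (\<lambda>x. ennreal (p3 x))) borel g"
    using ex[OF I] by auto
  obtain p4 where p4: "integrable lborel p4" "\<And>x. 0 \<le> p4 x" "\<And>x. x \<le> 0 \<Longrightarrow> p4 x = 0"
    and P4: "positive_variation (\<lambda>E. - Im (\<mu> E)) = distr (density lborel (\<lambda>x. ennreal (p4 x))) borel g"
    using ex[OF signed_borel_measure_uminus[OF I]] by auto
  note [measurable] = borel_measurable_integrable[OF p1(1)] borel_measurable_integrable[OF p2(1)]
    borel_measurable_integrable[OF p3(1)] borel_measurable_integrable[OF p4(1)]
  define k where "k x = Complex (p1 x - p2 x) (p3 x - p4 x)" for x
  have k_eq: "k = (\<lambda>x. complex_of_real (p1 x) - complex_of_real (p2 x) + \<i> * (complex_of_real (p3 x) - complex_of_real (p4 x)))"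
    by (auto simp: k_def complex_eq_iff)
  have int: "integrable lborel k"
    unfolding k_eq using p1(1) p2(1) p3(1) p4(1) by (intro Bochner_Integration.integrable_add
      Bochner_Integration.integrable_diff integrable_mult_right integrable_of_real)
  have bdd: "integrable lborel (\<lambda>x. complex_of_real (p x) * f (g x))"
    if p: "integrable lborel p" and f[measurable]: "f \<in> borel_measurable borel" and b: "\<And>z. norm (f z) \<le> 1"
    for p :: "real \<Rightarrow> real" and f :: "real \<times> real \<Rightarrow> complex"
  proof (rule Bochner_Integration.integrable_bound[OF p])
    note [measurable] = borel_measurable_integrable[OF p]
    show "(\<lambda>x. complex_of_real (p x) * f (g x)) \<in> borel_measurable lborel" by measurable
    show "AE x in lborel. norm (complex_of_real (p x) * f (g x)) \<le> norm (p x)"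
    proof (rule AE_I2)
      fix x
      show "norm (complex_of_real (p x) * f (g x)) \<le> norm (p x)"
        using mult_left_mono[OF b[of "g x"], of "\<bar>p x\<bar>"] by (simp add: norm_mult)
    qed
  qed
  have fc: "complex_measure_integral \<mu> f = (\<integral>x. f (g x) * k x \<partial>lborel)"
    if f[measurable]: "f \<in> borel_measurable borel" and b: "\<And>z. norm (f z) \<le> 1" for f
  proof -
    note ii = bdd[OF _ f b]
    have "complex_measure_integral \<mu> f =
       (\<integral>x. complex_of_real (p1 x) * f (g x) \<partial>lborel) - (\<integral>x. complex_of_real (p2 x) * f (g x) \<partial>lborel)
       + \<i> * ((\<integral>x. complex_of_real (p3 x) * f (g x) \<partial>lborel) - (\<integral>x. complex_of_real (p4 x) * f (g x) \<partial>lborel))"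
      unfolding complex_measure_integral_def signed_integral_def
        integral_distr_density[OF p1(1,2) g P1 f] integral_distr_density[OF p2(1,2) g P2 f]
        integral_distr_density[OF p3(1,2) g P3 f] integral_distr_density[OF p4(1,2) g P4 f] scaleR_conv_of_real ..
    also have "\<dots> = (\<integral>x. complex_of_real (p1 x) * f (g x) - complex_of_real (p2 x) * f (g x)
       + \<i> * (complex_of_real (p3 x) * f (g x) - complex_of_real (p4 x) * f (g x)) \<partial>lborel)"
      using ii[OF p1(1)] ii[OF p2(1)] ii[OF p3(1)] ii[OF p4(1)] by simp
    also have "\<dots> = (\<integral>x. f (g x) * k x \<partial>lborel)"
      unfolding k_eq by (intro Bochner_Integration.integral_cong) (auto simp: algebra_simps)
    finally show ?thesis .
  qed
  have meas: "\<mu> E = curve_measure c k E" for E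
  proof (cases "E \<in> sets borel")
    case E[measurable]: True
    let ?i = "\<lambda>x. indicator E (g x) :: real"
    have ii: "integrable lborel (\<lambda>x. p x * ?i x)" if p: "integrable lborel p" for p
    proof (rule Bochner_Integration.integrable_bound[OF p])
      note [measurable] = borel_measurable_integrable[OF p]
      show "(\<lambda>x. p x * ?i x) \<in> borel_measurable lborel" by measurable
    qed (auto simp: indicator_def)
    have Re: "Re (\<mu> E) = (\<integral>x. p1 x * ?i x - p2 x * ?i x \<partial>lborel)"
      using Jordan_decomposition[OF R E] ii[OF p1(1)] ii[OF p2(1)]
      by (simp add: measure_distr_density[OF p1(1,2) g P1] measure_distr_density[OF p2(1,2) g P2])
    have Im: "Im (\<mu> E) = (\<integral>x. p3 x * ?i x - p4 x * ?i x \<partial>lborel)"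
      using Jordan_decomposition[OF I E] ii[OF p3(1)] ii[OF p4(1)]
      by (simp add: measure_distr_density[OF p3(1,2) g P3] measure_distr_density[OF p4(1,2) g P4])
    have ki: "integrable lborel (\<lambda>x. ?i x *\<^sub>R k x)"
    proof (rule Bochner_Integration.integrable_bound[OF int])
      note [measurable] = borel_measurable_integrable[OF int]
      show "(\<lambda>x. ?i x *\<^sub>R k x) \<in> borel_measurable lborel" by measurable
    qed (auto simp: indicator_def)
    have "curve_measure c k E = (\<integral>x. ?i x *\<^sub>R k x \<partial>lborel)"
      unfolding curve_measure_def g_def using E by simp
    also have "\<dots> = \<mu> E"
    proof (rule complex_eqI)
      show "Re (\<integral>x. ?i x *\<^sub>R k x \<partial>lborel) = Re (\<mu> E)"
        unfolding Re integral_Re[OF ki, symmetric]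
        by (intro Bochner_Integration.integral_cong) (auto simp: k_def algebra_simps)
      show "Im (\<integral>x. ?i x *\<^sub>R k x \<partial>lborel) = Im (\<mu> E)"
        unfolding Im integral_Im[OF ki, symmetric]
        by (intro Bochner_Integration.integral_cong) (auto simp: k_def algebra_simps)
    qed
    finally show ?thesis ..
  next
    case False
    then show ?thesis using cb by (simp add: curve_measure_def complex_borel_measure_def)
  qed
  show ?thesis
  proof (rule that[of k])
    show "integrable lborel k" by (rule int)
    show "k x = 0" if "x \<le> 0" for x using p1(3) p2(3) p3(3) p4(3) that by (simp add: k_def zero_complex.code)
    show "\<mu> = curve_measure (M\<^sup>2 / (4 * pi\<^sup>2)) k" using meas by (auto simp: c_def)
    show "fourier_transform \<mu> \<xi> =
       (\<integral>x. exp (\<i> * complex_of_real (pi * ((x, M\<^sup>2 / (4 * pi\<^sup>2) / x) \<bullet> \<xi>))) * k x \<partial>lborel)" for \<xi>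
      unfolding fourier_transform_def c_def[symmetric] g_def[symmetric]
    proof (rule fc)
      show "(\<lambda>x. exp (\<i> * complex_of_real (pi * (x \<bullet> \<xi>)))) \<in> borel_measurable borel"
        by (intro borel_measurable_continuous_onI continuous_intros)
    qed simp
  qed
qed

text \<open>A set of zero arc length has a Lebesgue null shadow on the axis, and over it the
  integral of \<open>k\<close> vanishes. Countable additivity is dominated convergence with majorant
  \<open>norm (k x)\<close>.\<close>

lemma curve_measure_AC:
  assumes k: "integrable lborel k" "\<And>x. x \<le> 0 \<Longrightarrow> k x = 0" and "M > 0"
  shows "curve_measure (M\<^sup>2 / (4 * pi\<^sup>2)) k \<in> AC (hyperbola_branch M)"
proof -
  define c where "c = M\<^sup>2 / (4 * pi\<^sup>2)"
  define g :: "real \<Rightarrow> real \<times> real" where "g x = (x, c / x)" for x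
  have g[measurable]: "g \<in> borel_measurable borel" unfolding g_def by measurable
  have cm: "curve_measure c k E = set_lebesgue_integral lborel (g -` E) k" if "E \<in> sets borel" for E
    using that by (simp add: curve_measure_def set_lebesgue_integral_def g_def indicator_def vimage_def)
  have gE: "g -` E \<in> sets borel" if "E \<in> sets borel" for E using measurable_sets_borel[OF g that] .
  have zero: "curve_measure c k E = 0" if E: "E \<in> sets borel" and arc: "arc_length (E \<inter> hyperbola_branch M) = 0" for E
  proof -
    have N: "g -` E \<inter> {0<..} \<in> null_sets lborel"
    proof (rule null_sets_of_arc_length_null[OF arc])
      show "g -` E \<inter> {0<..} \<in> sets borel" using gE[OF E] by auto
      show "g -` E \<inter> {0<..} \<subseteq> fst ` (E \<inter> hyperbola_branch M)"
      proof
        fix x assume "x \<in> g -` E \<inter> {0<..}"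
        then have "g x \<in> E \<inter> hyperbola_branch M" by (auto simp: hyperbola_branch_iff g_def c_def)
        moreover have "x = fst (g x)" by (simp add: g_def)
        ultimately show "x \<in> fst ` (E \<inter> hyperbola_branch M)" by (rule rev_image_eqI)
      qed
    qed
    have "AE x in lborel. indicator (g -` E) x *\<^sub>R k x = 0"
      using AE_not_in[OF N] by eventually_elim (use k(2) in \<open>auto simp: indicator_def not_less\<close>)
    then show ?thesis unfolding cm[OF E] set_lebesgue_integral_def by (rule integral_eq_zero_AE)
  qed
  have "complex_borel_measure (curve_measure c k)"
    unfolding complex_borel_measure_def
  proof (intro conjI allI impI)
    fix E assume "E \<notin> sets (borel :: (real \<times> real) measure)"
    then show "curve_measure c k E = 0" by (simp add: curve_measure_def)
  next
    fix A :: "nat \<Rightarrow> (real \<times> real) set" assume A: "range A \<subseteq> sets borel" "disjoint_family A"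
    have Ab: "A n \<in> sets borel" for n using A(1) by auto
    have UA: "(\<Union>n. A n) \<in> sets borel" using Ab by auto
    have si: "set_integrable lborel B k" if "B \<in> sets borel" for B
      using k(1) that unfolding set_integrable_def by (intro integrable_mult_indicator) auto
    have "(\<lambda>n. set_lebesgue_integral lborel (g -` A n) k) sums set_lebesgue_integral lborel (\<Union>n. g -` A n) k"
    proof -
      let ?f = "\<lambda>n x. indicator (g -` A n) x *\<^sub>R k x"
      have disj: "g -` A i \<inter> g -` A j = {}" if "i \<noteq> j" for i j
        using disjoint_family_onD[OF A(2), of i j] that by auto
      have "(\<lambda>N. set_lebesgue_integral lborel (\<Union>n<N. g -` A n) k) \<longlonglongrightarrow> set_lebesgue_integral lborel (\<Union>n. g -` A n) k"
        unfolding set_lebesgue_integral_def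
      proof (rule integral_dominated_convergence[where w="\<lambda>x. norm (k x)"])
        note [measurable] = borel_measurable_integrable[OF k(1)] gE[OF Ab]
        show "(\<lambda>x. indicator (\<Union>n. g -` A n) x *\<^sub>R k x) \<in> borel_measurable lborel" by measurable
        show "(\<lambda>x. indicator (\<Union>n<N. g -` A n) x *\<^sub>R k x) \<in> borel_measurable lborel" for N by measurable
        show "integrable lborel (\<lambda>x. norm (k x))" using k(1) by simp
        show "AE x in lborel. (\<lambda>N. indicator (\<Union>n<N. g -` A n) x *\<^sub>R k x) \<longlonglongrightarrow> indicator (\<Union>n. g -` A n) x *\<^sub>R k x"
          by (intro AE_I2 tendsto_scaleR tendsto_const LIMSEQ_indicator_UN)
        show "AE x in lborel. norm (indicator (\<Union>n<N. g -` A n) x *\<^sub>R k x) \<le> norm (k x)" for N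
          by (intro AE_I2) (auto simp: indicator_def)
      qed
      moreover have "set_lebesgue_integral lborel (\<Union>n<N. g -` A n) k = (\<Sum>n<N. set_lebesgue_integral lborel (g -` A n) k)" for N
        by (rule set_integral_finite_Union) (use disj si gE Ab in \<open>auto simp: disjoint_family_on_def\<close>)
      ultimately show ?thesis unfolding sums_def by simp
    qed
    then show "(\<lambda>n. curve_measure c k (A n)) sums curve_measure c k (\<Union>n. A n)"
      using cm[OF Ab] cm[OF UA] by (simp add: vimage_UN)
  qed
  moreover have "arc_length ({} :: (real \<times> real) set) = 0"
    by (rule arc_length_eq_0I) (auto intro!: exI[of _ "\<lambda>_. {}"])
  ultimately show ?thesis
    using zero unfolding AC_def c_def[symmetric] by auto
qed

text \<open>Vertical strips over Borel sets of the axis already recover all integrals of the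
  density.\<close>

lemma curve_measure_eqD:
  assumes "integrable lborel k" "integrable lborel k'" and eq: "curve_measure c k = curve_measure c k'"
  shows "AE x in lborel. k x = k' x"
proof (rule sigma_finite_measure.density_unique_banach[OF sigma_finite_lborel assms(1,2)])
  fix A :: "real set" assume "A \<in> sets lborel"
  then have A: "fst -` A \<in> sets (borel :: (real \<times> real) measure)"
    using measurable_sets_borel[OF borel_measurable_fst_snd(1), of A] by simp
  from fun_cong[OF eq, of "fst -` A"] A
  show "set_lebesgue_integral lborel A k = set_lebesgue_integral lborel A k'"
    by (simp add: curve_measure_def set_lebesgue_integral_def indicator_def)
qed

lemma curve_measure_cong_AE:
  assumes "AE x in lborel. k x = k' x" "k \<in> borel_measurable borel" "k' \<in> borel_measurable borel"
  shows "curve_measure c k = curve_measure c k'"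
proof
  note [measurable] = assms(2,3)
  fix E
  show "curve_measure c k E = curve_measure c k' E"
  proof (cases "E \<in> sets borel")
    case [measurable]: True
    have "(\<integral>x. indicator E (x, c / x) *\<^sub>R k x \<partial>lborel) = (\<integral>x. indicator E (x, c / x) *\<^sub>R k' x \<partial>lborel)"
      by (intro integral_cong_AE) (use assms(1) in auto)
    then show ?thesis by (simp add: curve_measure_def)
  qed (simp add: curve_measure_def)
qed

text \<open>This avoids computing the Jordan decomposition in terms of \<open>k\<close>: the density
  \<open>k'\<close> furnished by \<open>AC_hyperbola_density\<close> agrees with \<open>k\<close>
  almost everywhere by uniqueness.\<close>

lemma fourier_transform_curve_measure:
  assumes k: "integrable lborel k" "\<And>x. x \<le> 0 \<Longrightarrow> k x = 0" and "M > 0"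
  shows "fourier_transform (curve_measure (M\<^sup>2 / (4 * pi\<^sup>2)) k) \<xi> =
       (\<integral>x. exp (\<i> * complex_of_real (pi * ((x, M\<^sup>2 / (4 * pi\<^sup>2) / x) \<bullet> \<xi>))) * k x \<partial>lborel)"
proof -
  let ?c = "M\<^sup>2 / (4 * pi\<^sup>2)"
  let ?e = "\<lambda>x. exp (\<i> * complex_of_real (pi * ((x, ?c / x) \<bullet> \<xi>)))"
  have [measurable]: "?e \<in> borel_measurable borel" by (simp add: inner_prod_def)
  show ?thesis
  proof (rule AC_hyperbola_density[OF curve_measure_AC[OF assms] \<open>M > 0\<close>])
    fix k' assume k': "integrable lborel k'" "curve_measure ?c k = curve_measure ?c k'"
      and ft: "\<And>\<xi>. fourier_transform (curve_measure ?c k) \<xi> =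
        (\<integral>x. exp (\<i> * complex_of_real (pi * ((x, ?c / x) \<bullet> \<xi>))) * k' x \<partial>lborel)"
    note [measurable] = borel_measurable_integrable[OF k(1)] borel_measurable_integrable[OF k'(1)]
    have AE: "AE x in lborel. k x = k' x" by (rule curve_measure_eqD[OF k(1) k'])
    show ?thesis
      unfolding ft by (intro integral_cong_AE) (use AE in auto)
  qed
qed

lemma borel_measurable_frac[measurable]: "(frac :: real \<Rightarrow> real) \<in> borel_measurable borel"
  unfolding frac_def[abs_def] by measurable

section \<open>Functions with vanishing Fourier coefficients\<close>

lemma integrable_mult_bounded:
  fixes k :: "'a \<Rightarrow> real" and q :: "'a \<Rightarrow> 'b::{banach, real_normed_algebra, second_countable_topology}"
  assumes k: "integrable M k" and q: "q \<in> borel_measurable M" and b: "\<And>x. norm (q x) \<le> B"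
  shows "integrable M (\<lambda>x. k x *\<^sub>R q x)"
proof (rule Bochner_Integration.integrable_bound)
  show "integrable M (\<lambda>x. B * k x)" using k by simp
  show "(\<lambda>x. k x *\<^sub>R q x) \<in> borel_measurable M"
    using borel_measurable_integrable[OF k] q by measurable
  show "AE x in M. norm (k x *\<^sub>R q x) \<le> norm (B * k x)"
  proof (rule AE_I2)
    fix x
    have "B \<ge> 0" using order_trans[OF norm_ge_zero b] .
    then show "norm (k x *\<^sub>R q x) \<le> norm (B * k x)"
      using mult_left_mono[OF b[of x], of "\<bar>k x\<bar>"] by (simp add: abs_mult mult.commute)
  qed
qed

text \<open>The functions all of whose Fourier coefficients vanish are a module over the trigonometric
  polynomials, which are the real polynomial functions restricted to the unit circle.\<close>

lemma fourier_zero_mult_polynomial: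
  fixes S :: "real \<Rightarrow> real"
  assumes p: "real_polynomial_function p" and S[measurable]: "S \<in> borel_measurable borel"
  shows "integrable lborel k \<Longrightarrow> (\<And>m::int. (\<integral>x. k x *\<^sub>R cis (2 * pi * m * S x) \<partial>lborel) = 0) \<Longrightarrow>
    integrable lborel (\<lambda>x. k x * p (cis (2 * pi * S x))) \<and>
    (\<forall>m::int. (\<integral>x. (k x * p (cis (2 * pi * S x))) *\<^sub>R cis (2 * pi * m * S x) \<partial>lborel) = 0)"
  using p
proof (induction p arbitrary: k)
  case (linear f)
  have cis_m: "(\<lambda>x. cis (r * x)) \<in> borel_measurable borel" for r
    by (intro borel_measurable_continuous_onI continuous_intros)
  have [measurable]: "(\<lambda>x. cis (r * S x)) \<in> borel_measurable borel" for r
    using measurable_compose[OF S cis_m] by simp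
  have int: "integrable lborel (\<lambda>x. k x *\<^sub>R (c * cis (r * S x)))" for c r
    by (rule integrable_mult_bounded[OF linear.prems(1), where B = "norm c"]) (auto simp: norm_mult)
  \<comment> \<open>On the unit circle a real-linear function is a combination of
    \<open>cis t\<close> and \<open>cis (- t)\<close>; multiplying by it shifts frequencies by one
    in both directions.\<close>
  define A B where "A = (complex_of_real (f 1) - \<i> * f \<i>) / 2" and "B = (complex_of_real (f 1) + \<i> * f \<i>) / 2"
  interpret f: bounded_linear f by fact
  have f_eq: "complex_of_real (f (cis t)) = A * cis t + B * cis (- t)" for t
  proof -
    have "cis t = cos t *\<^sub>R 1 + sin t *\<^sub>R \<i>" by (simp add: complex_eq_iff)
    then have "f (cis t) = cos t * f 1 + sin t * f \<i>" by (simp only: f.add f.scaleR real_scaleR_def)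
    then show ?thesis by (simp add: A_def B_def complex_eq_iff field_simps)
  qed
  have eq: "(k x * f (cis (2 * pi * S x))) *\<^sub>R cis (2 * pi * m * S x) =
    k x *\<^sub>R (A * cis (2 * pi * (m + 1) * S x)) + k x *\<^sub>R (B * cis (2 * pi * (m - 1) * S x))" for m :: real and x
  proof -
    have "(k x * f (cis (2 * pi * S x))) *\<^sub>R cis (2 * pi * m * S x) =
      k x *\<^sub>R (complex_of_real (f (cis (2 * pi * S x))) * cis (2 * pi * m * S x))"
      by (simp add: scaleR_conv_of_real)
    also have "\<dots> = k x *\<^sub>R (A * (cis (2 * pi * S x) * cis (2 * pi * m * S x)) + B * (cis (- (2 * pi * S x)) * cis (2 * pi * m * S x)))"
      unfolding f_eq by (simp add: algebra_simps)
    also have "cis (2 * pi * S x) * cis (2 * pi * m * S x) = cis (2 * pi * (m + 1) * S x)"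
      unfolding cis_mult by (rule arg_cong[where f = cis]) (simp add: algebra_simps)
    also have "cis (- (2 * pi * S x)) * cis (2 * pi * m * S x) = cis (2 * pi * (m - 1) * S x)"
      unfolding cis_mult by (rule arg_cong[where f = cis]) (simp add: algebra_simps)
    finally show ?thesis by (simp only: scaleR_add_right)
  qed
  have zero: "(\<integral>x. k x *\<^sub>R (c * cis (2 * pi * m * S x)) \<partial>lborel) = 0" for c and m :: int
  proof -
    have "(\<integral>x. k x *\<^sub>R (c * cis (2 * pi * m * S x)) \<partial>lborel) = (\<integral>x. c * (k x *\<^sub>R cis (2 * pi * m * S x)) \<partial>lborel)"
      by (intro Bochner_Integration.integral_cong) auto
    also have "\<dots> = c * (\<integral>x. k x *\<^sub>R cis (2 * pi * m * S x) \<partial>lborel)"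
      by (rule integral_mult_right_zero)
    finally show ?thesis using linear.prems(2) by simp
  qed
  have "(\<integral>x. (k x * f (cis (2 * pi * S x))) *\<^sub>R cis (2 * pi * m * S x) \<partial>lborel) = 0" for m :: int
    unfolding eq using int[of A "2 * pi * (real_of_int m + 1)"] int[of B "2 * pi * (real_of_int m - 1)"]
      zero[of A "m + 1"] zero[of B "m - 1"] by simp
  moreover obtain K where K: "\<And>z. norm (f z) \<le> norm z * K" using f.bounded by auto
  have "integrable lborel (\<lambda>x. k x *\<^sub>R f (cis (2 * pi * S x)))"
  proof (rule integrable_mult_bounded[OF linear.prems(1)])
    show "norm (f (cis (2 * pi * S x))) \<le> K" for x using K[of "cis (2 * pi * S x)"] by simp
    have [measurable]: "f \<in> borel_measurable borel"
      by (rule borel_measurable_continuous_onI[OF linear_continuous_on[OF linear(1)]])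
    show "(\<lambda>x. f (cis (2 * pi * S x))) \<in> borel_measurable lborel" by measurable
  qed
  ultimately show ?case by simp
next
  case (const c)
  have "(\<integral>x. (k x * c) *\<^sub>R cis (2 * pi * m * S x) \<partial>lborel) = 0" for m :: int
  proof -
    have "(\<integral>x. (k x * c) *\<^sub>R cis (2 * pi * m * S x) \<partial>lborel) = (\<integral>x. c *\<^sub>R (k x *\<^sub>R cis (2 * pi * m * S x)) \<partial>lborel)"
      by (intro Bochner_Integration.integral_cong) auto
    also have "\<dots> = c *\<^sub>R (\<integral>x. k x *\<^sub>R cis (2 * pi * m * S x) \<partial>lborel)"
      by (rule integral_scaleR_right)
    finally show ?thesis using const(2) by simp
  qed
  then show ?case using const(1) by simp
next
  case (add f g)
  have cis_m: "(\<lambda>x. cis (r * x)) \<in> borel_measurable borel" for r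
    by (intro borel_measurable_continuous_onI continuous_intros)
  have [measurable]: "(\<lambda>x. cis (r * S x)) \<in> borel_measurable borel" for r
    using measurable_compose[OF S cis_m] by simp
  note F = add.IH(1)[OF add.prems] and G = add.IH(2)[OF add.prems]
  have int: "integrable lborel (\<lambda>x. h x *\<^sub>R cis (r * S x))" if "integrable lborel h" for h r
    by (rule integrable_mult_bounded[OF that, where B = 1]) auto
  have "(\<integral>x. (k x * (f (cis (2 * pi * S x)) + g (cis (2 * pi * S x)))) *\<^sub>R cis (2 * pi * m * S x) \<partial>lborel) = 0" for m :: int
    unfolding distrib_left scaleR_add_left
    using int[of "\<lambda>x. k x * f (cis (2 * pi * S x))" "2 * pi * m"] int[of "\<lambda>x. k x * g (cis (2 * pi * S x))" "2 * pi * m"] F G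
    by simp
  moreover have "integrable lborel (\<lambda>x. k x * (f (cis (2 * pi * S x)) + g (cis (2 * pi * S x))))"
    unfolding distrib_left using F G by simp
  ultimately show ?case by blast
next
  case (mult f g)
  note F = mult.IH(1)[OF mult.prems]
  from mult.IH(2)[OF conjunct1[OF F] conjunct2[OF F, rule_format]] show ?case
    by (simp add: mult.assoc)
qed

text \<open>Stone-Weierstrass on the circle: the polynomial part integrates to zero, and the uniform
  error is paid for with the integral of \<open>\<bar>k x\<bar>\<close>.\<close>

lemma fourier_zero_continuous:
  fixes S :: "real \<Rightarrow> real"
  assumes k: "integrable lborel k" "\<And>m::int. (\<integral>x. k x *\<^sub>R cis (2 * pi * m * S x) \<partial>lborel) = 0"
    and c: "continuous_on UNIV c" and S[measurable]: "S \<in> borel_measurable borel"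
  shows "(\<integral>x. k x * c (cis (2 * pi * S x)) \<partial>lborel) = (0::real)"
proof -
  let ?I = "\<integral>x. k x * c (cis (2 * pi * S x)) \<partial>lborel"
  let ?N = "\<integral>x. \<bar>k x\<bar> \<partial>lborel"
  have cis_m: "(\<lambda>x. cis (2 * pi * x)) \<in> borel_measurable borel"
    by (intro borel_measurable_continuous_onI continuous_intros)
  have [measurable]: "(\<lambda>x. cis (2 * pi * S x)) \<in> borel_measurable borel"
    using measurable_compose[OF S cis_m] by simp
  have [measurable]: "c \<in> borel_measurable borel" by (rule borel_measurable_continuous_onI[OF c])
  have "compact (c ` sphere 0 1)"
    by (intro compact_continuous_image continuous_on_subset[OF c]) auto
  then obtain B where B: "\<And>z. z \<in> sphere 0 1 \<Longrightarrow> norm (c z) \<le> B"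
    using compact_imp_bounded bounded_iff by (metis imageI)
  have int_c: "integrable lborel (\<lambda>x. k x *\<^sub>R c (cis (2 * pi * S x)))"
    by (rule integrable_mult_bounded[OF k(1), where B = B]) (use B in auto)
  have "\<bar>?I\<bar> \<le> e * ?N" if "e > 0" for e
  proof -
    obtain p where p: "real_polynomial_function p" "\<And>z. z \<in> sphere 0 1 \<Longrightarrow> \<bar>c z - p z\<bar> < e"
      using Stone_Weierstrass_real_polynomial_function[OF compact_sphere continuous_on_subset[OF c subset_UNIV] \<open>e > 0\<close>, of 0 1]
      by metis
    have P: "integrable lborel (\<lambda>x. k x * p (cis (2 * pi * S x)))"
      "\<And>m::int. (\<integral>x. (k x * p (cis (2 * pi * S x))) *\<^sub>R cis (2 * pi * m * S x) \<partial>lborel) = 0"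
      using fourier_zero_mult_polynomial[OF p(1) S k] by auto
    have P0: "(\<integral>x. k x * p (cis (2 * pi * S x)) \<partial>lborel) = 0"
    proof -
      have "complex_of_real (\<integral>x. k x * p (cis (2 * pi * S x)) \<partial>lborel) =
        (\<integral>x. complex_of_real (k x * p (cis (2 * pi * S x))) \<partial>lborel)"
        using P(1) by (rule integral_of_real[symmetric])
      also have "\<dots> = 0" using P(2)[of 0] by (simp add: scaleR_conv_of_real)
      finally show ?thesis by simp
    qed
    have "?I = (\<integral>x. k x * c (cis (2 * pi * S x)) - k x * p (cis (2 * pi * S x)) \<partial>lborel)"
      using int_c P P0 by simp
    then have "\<bar>?I\<bar> \<le> (\<integral>x. \<bar>k x * c (cis (2 * pi * S x)) - k x * p (cis (2 * pi * S x))\<bar> \<partial>lborel)"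
      using integral_norm_bound[of lborel "\<lambda>x. k x * c (cis (2 * pi * S x)) - k x * p (cis (2 * pi * S x))"]
      by simp
    also have "\<dots> \<le> (\<integral>x. e * \<bar>k x\<bar> \<partial>lborel)"
    proof (rule integral_mono)
      fix x
      have "\<bar>c (cis (2 * pi * S x)) - p (cis (2 * pi * S x))\<bar> \<le> e" using p(2)[of "cis (2 * pi * S x)"] by simp
      then have "\<bar>k x\<bar> * \<bar>c (cis (2 * pi * S x)) - p (cis (2 * pi * S x))\<bar> \<le> \<bar>k x\<bar> * e"
        by (rule mult_left_mono) simp
      then show "\<bar>k x * c (cis (2 * pi * S x)) - k x * p (cis (2 * pi * S x))\<bar> \<le> e * \<bar>k x\<bar>"
        unfolding right_diff_distrib[symmetric] abs_mult by (simp add: mult.commute)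
    qed (use int_c P k in auto)
    also have "\<dots> = e * ?N" by simp
    finally show ?thesis .
  qed
  then have lim: "\<bar>?I\<bar> \<le> e" if "e > 0" for e
  proof -
    have "?N \<ge> 0" by simp
    \<comment> \<open>The added 1 covers the case that \<open>?N\<close> is zero.\<close>
    then have "e / (?N + 1) > 0" using that by (intro divide_pos_pos add_nonneg_pos) auto
    with \<open>\<And>e. e > 0 \<Longrightarrow> \<bar>?I\<bar> \<le> e * ?N\<close> have "\<bar>?I\<bar> \<le> e / (?N + 1) * ?N" by blast
    also have "\<dots> = e * (?N / (?N + 1))" by simp
    also have "?N / (?N + 1) \<le> 1"
      using \<open>?N \<ge> 0\<close> by (subst divide_le_eq_1_pos) linarith+
    then have "e * (?N / (?N + 1)) \<le> e * 1" using that by (intro mult_left_mono) auto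
    also have "\<dots> = e" by simp
    finally show ?thesis .
  qed
  show ?thesis using field_le_epsilon[of "\<bar>?I\<bar>" 0] lim by auto
qed

lemma cis_2pi_eq_iff: "cis (2 * pi * x) = cis (2 * pi * y) \<longleftrightarrow> x - y \<in> \<int>"
proof
  assume "cis (2 * pi * x) = cis (2 * pi * y)"
  then have "cis (2 * pi * x) / cis (2 * pi * y) = 1" by simp
  then have "cos (2 * pi * (x - y)) = 1" by (simp add: cis_divide complex_eq_iff right_diff_distrib)
  then obtain n :: int where "2 * pi * (x - y) = n * 2 * pi" unfolding cos_one_2pi_int by auto
  then have "x - y = n" by simp
  then show "x - y \<in> \<int>" by simp
next
  assume "x - y \<in> \<int>"
  then obtain n :: int where "x - y = n" by (auto elim: Ints_cases)
  then have "2 * pi * x = 2 * pi * y + 2 * pi * n" by (simp add: algebra_simps)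
  then have "cis (2 * pi * x) = cis (2 * pi * y) * cis (2 * pi * n)" by (simp only: cis_mult)
  then show "cis (2 * pi * x) = cis (2 * pi * y)" by (simp add: cis_multiple_2pi)
qed

text \<open>The positive and the negative part of \<open>k\<close> are pushed forward by
  \<open>frac (S x)\<close> to two finite measures. These agree on closed sets, whose indicators are
  limits of continuous functions on the circle, and hence agree on all Borel sets.\<close>

proposition fourier_zero_periodic:
  fixes S :: "real \<Rightarrow> real"
  assumes k: "integrable lborel k" "\<And>m::int. (\<integral>x. k x *\<^sub>R cis (2 * pi * m * S x) \<partial>lborel) = 0"
    and q[measurable]: "q \<in> borel_measurable borel" and qb: "\<And>x. \<bar>q x\<bar> \<le> B"
    and S[measurable]: "S \<in> borel_measurable borel" and SZ: "AE x in lborel. S x \<notin> \<int>"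
  shows "(\<integral>x. k x * q (frac (S x)) \<partial>lborel) = (0::real)"
proof -
  note [measurable] = borel_measurable_integrable[OF k(1)]
  have cis_m: "(\<lambda>x. cis (2 * pi * x)) \<in> borel_measurable borel"
    by (intro borel_measurable_continuous_onI continuous_intros)
  have [measurable]: "(\<lambda>x. cis (2 * pi * S x)) \<in> borel_measurable borel"
    using measurable_compose[OF S cis_m] by simp
  define kp kn where "kp x = max 0 (k x)" and "kn x = max 0 (- k x)" for x
  have [measurable]: "kp \<in> borel_measurable borel" "kn \<in> borel_measurable borel"
    unfolding kp_def kn_def by measurable
  have ip: "integrable lborel kp" and "in": "integrable lborel kn"
    unfolding kp_def kn_def using k(1) by auto
  have kd: "k x = kp x - kn x" for x by (simp add: kp_def kn_def)
  have nn: "kp x \<ge> 0" "kn x \<ge> 0" for x by (auto simp: kp_def kn_def)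
  have closed0: "(\<integral>x. k x * indicator C (cis (2 * pi * S x)) \<partial>lborel) = 0" if C: "closed C" "C \<noteq> {}" for C
  proof -
    \<comment> \<open>Continuous functions decreasing to the indicator of the closed set as n
      grows.\<close>
    let ?c = "\<lambda>n z. max 0 (1 - real n * infdist z C)"
    have [measurable]: "C \<in> sets borel" using C(1) by auto
    have c_cont: "continuous_on UNIV (?c n)" for n by (intro continuous_intros)
    have [measurable]: "?c n \<in> borel_measurable borel" for n
      by (rule borel_measurable_continuous_onI[OF c_cont])
    have lim: "(\<lambda>n. ?c n z) \<longlonglongrightarrow> indicator C z" for z
    proof (cases "z \<in> C")
      case True then show ?thesis by simp
    next
      case False
      then have "infdist z C > 0"
        using in_closed_iff_infdist_zero[OF C] infdist_nonneg[of z C] by (metis le_neq_trans)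
      then obtain N :: nat where N: "1 < real N * infdist z C" using reals_Archimedean3 by blast
      have "eventually (\<lambda>n. ?c n z = 0) sequentially"
        using eventually_ge_at_top[of N]
      proof eventually_elim
        case (elim n)
        then have "real N * infdist z C \<le> real n * infdist z C"
          using \<open>infdist z C > 0\<close> by (intro mult_right_mono) auto
        then show "?c n z = 0" using N by simp
      qed
      then show ?thesis using False by (simp add: tendsto_eventually)
    qed
    have "(\<lambda>n. \<integral>x. k x * ?c n (cis (2 * pi * S x)) \<partial>lborel) \<longlonglongrightarrow> (\<integral>x. k x * indicator C (cis (2 * pi * S x)) \<partial>lborel)"
    proof (rule integral_dominated_convergence[where w = "\<lambda>x. \<bar>k x\<bar>"])
      show "AE x in lborel. (\<lambda>n. k x * ?c n (cis (2 * pi * S x))) \<longlonglongrightarrow> k x * indicator C (cis (2 * pi * S x))"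
        by (intro AE_I2 tendsto_mult tendsto_const lim)
      show "AE x in lborel. norm (k x * ?c n (cis (2 * pi * S x))) \<le> \<bar>k x\<bar>" for n
      proof (rule AE_I2)
        fix x
        have "\<bar>?c n (cis (2 * pi * S x))\<bar> \<le> 1" by (auto simp: infdist_nonneg)
        from mult_left_mono[OF this, of "\<bar>k x\<bar>"]
        show "norm (k x * ?c n (cis (2 * pi * S x))) \<le> \<bar>k x\<bar>" by (simp add: abs_mult)
      qed
    qed (use k in auto)
    moreover have "(\<integral>x. k x * ?c n (cis (2 * pi * S x)) \<partial>lborel) = 0" for n
      by (rule fourier_zero_continuous[OF k c_cont S])
    ultimately show ?thesis by (simp add: LIMSEQ_const_iff)
  qed
  have em: "emeasure (distr (density lborel (\<lambda>x. ennreal (p x))) borel R) A = ennreal (\<integral>x. p x * indicator A (R x) \<partial>lborel)"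
    if p: "integrable lborel p" "\<And>x. p x \<ge> 0" and [measurable]: "R \<in> borel_measurable borel" "A \<in> sets borel"
    for p :: "real \<Rightarrow> real" and R :: "real \<Rightarrow> real" and A
  proof -
    note [measurable] = borel_measurable_integrable[OF p(1)]
    have "emeasure (distr (density lborel (\<lambda>x. ennreal (p x))) borel R) A = (\<integral>\<^sup>+x. ennreal (p x) * indicator (R -` A) x \<partial>lborel)"
      using measurable_sets_borel[of R borel A] by (simp add: emeasure_distr emeasure_density)
    also have "\<dots> = (\<integral>\<^sup>+x. ennreal (p x * indicator A (R x)) \<partial>lborel)"
      by (intro nn_integral_cong) (auto simp: indicator_def)
    also have "\<dots> = ennreal (\<integral>x. p x * indicator A (R x) \<partial>lborel)"
    proof (rule nn_integral_eq_integral)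
      show "integrable lborel (\<lambda>x. p x * indicator A (R x))"
        using integrable_mult_bounded[OF p(1), of "\<lambda>x. indicator A (R x) :: real" 1] by simp
    qed (use p(2) in auto)
    finally show ?thesis .
  qed
  let ?D = "\<lambda>p. distr (density lborel (\<lambda>x. ennreal (p x))) borel (\<lambda>x. frac (S x))"
  have "?D kp = ?D kn"
  proof (rule measure_eqI_generator_eq[where E = "Collect closed" and \<Omega> = UNIV and A = "\<lambda>_. UNIV"])
    show "sets (?D kp) = sigma_sets UNIV (Collect closed)" "sets (?D kn) = sigma_sets UNIV (Collect closed)"
      by (simp_all add: borel_eq_closed)
    show "emeasure (?D kp) UNIV \<noteq> \<infinity>" for i :: nat using em[OF ip nn(1), of "\<lambda>x. frac (S x)" UNIV] by simp
    show "emeasure (?D kp) T = emeasure (?D kn) T" if "T \<in> Collect closed" for T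
    proof -
      have [measurable]: "T \<in> sets borel" using that by auto
      have "(\<integral>x. k x * indicator T (frac (S x)) \<partial>lborel) = 0"
      proof (cases "T \<inter> {0..1} = {}")
        case True
        then have "frac x \<notin> T" for x using frac_lt_1[of x] frac_ge_0[of x] by (auto simp: less_imp_le)
        then show ?thesis by simp
      next
        case False
        define C where "C = (\<lambda>x. cis (2 * pi * x)) ` (T \<inter> {0..1})"
        have "compact C" unfolding C_def
          by (intro compact_continuous_image continuous_intros closed_Int_compact) (use that in auto)
        then have "closed C" by (rule compact_imp_closed)
        have [measurable]: "C \<in> sets borel" using \<open>closed C\<close> by auto
        \<comment> \<open>On the circle 0 and 1 coincide, while \<open>frac\<close> never takes the
          value 1. If \<open>T\<close> contains 1 but not 0, the two memberships differ at integers,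
          which is why these are excluded.\<close>
        have *: "frac x \<in> T \<longleftrightarrow> cis (2 * pi * x) \<in> C" if "x \<notin> \<int>" for x
        proof
          assume "frac x \<in> T"
          moreover have "cis (2 * pi * x) = cis (2 * pi * frac x)"
            unfolding cis_2pi_eq_iff by (simp add: frac_def)
          ultimately show "cis (2 * pi * x) \<in> C"
            unfolding C_def using frac_lt_1[of x] frac_ge_0[of x] by (auto simp: less_imp_le)
        next
          assume "cis (2 * pi * x) \<in> C"
          then obtain s where s: "s \<in> T" "0 \<le> s" "s \<le> 1" "x - s \<in> \<int>"
            unfolding C_def by (auto simp: cis_2pi_eq_iff)
          have "s \<noteq> 1"
          proof
            assume "s = 1"
            have "x - s + 1 \<in> \<int>" by (intro Ints_add s(4) Ints_1)
            then show False using that \<open>s = 1\<close> by simp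
          qed
          have "frac x = s" unfolding frac_unique_iff using s \<open>s \<noteq> 1\<close> by auto
          then show "frac x \<in> T" using s by simp
        qed
        have ae: "AE x in lborel. k x * indicator T (frac (S x)) = k x * indicator C (cis (2 * pi * S x))"
          using SZ by eventually_elim (use * in \<open>auto simp: indicator_def\<close>)
        have "(\<integral>x. k x * indicator T (frac (S x)) \<partial>lborel) = (\<integral>x. k x * indicator C (cis (2 * pi * S x)) \<partial>lborel)"
          by (rule integral_cong_AE) (use ae in auto)
        also have "\<dots> = 0" by (rule closed0[OF \<open>closed C\<close>]) (use False in \<open>auto simp: C_def\<close>)
        finally show ?thesis .
      qed
      moreover have "integrable lborel (\<lambda>x. kp x * indicator T (frac (S x)))" "integrable lborel (\<lambda>x. kn x * indicator T (frac (S x)))"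
        using integrable_mult_bounded[OF ip, of "\<lambda>x. indicator T (frac (S x)) :: real" 1]
          integrable_mult_bounded[OF "in", of "\<lambda>x. indicator T (frac (S x)) :: real" 1] by simp_all
      ultimately have "(\<integral>x. kp x * indicator T (frac (S x)) \<partial>lborel) = (\<integral>x. kn x * indicator T (frac (S x)) \<partial>lborel)"
        unfolding kd by (simp add: left_diff_distrib)
      then show ?thesis by (simp add: em[OF ip nn(1)] em[OF "in" nn(2)])
    qed
  qed (auto simp: Int_stable_def)
  have tr: "(\<integral>x. p x * q (frac (S x)) \<partial>lborel) = (\<integral>x. q x \<partial>?D p)"
    if p: "integrable lborel p" "\<And>x. p x \<ge> 0" for p
  proof -
    note [measurable] = borel_measurable_integrable[OF p(1)]
    show ?thesis using p(2) by (simp add: integral_distr integral_density)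
  qed
  have "integrable lborel (\<lambda>x. kp x * q (frac (S x)))" "integrable lborel (\<lambda>x. kn x * q (frac (S x)))"
    using integrable_mult_bounded[OF ip, of "\<lambda>x. q (frac (S x))" B]
      integrable_mult_bounded[OF "in", of "\<lambda>x. q (frac (S x))" B] qb by simp_all
  then have "(\<integral>x. k x * q (frac (S x)) \<partial>lborel) = (\<integral>x. kp x * q (frac (S x)) \<partial>lborel) - (\<integral>x. kn x * q (frac (S x)) \<partial>lborel)"
    unfolding kd by (simp add: left_diff_distrib)
  also have "\<dots> = 0" using tr[OF ip nn(1)] tr[OF "in" nn(2)] \<open>?D kp = ?D kn\<close> by simp
  finally show ?thesis .
qed

section \<open>The map $x \mapsto \gamma/x$ modulo 1\<close>

text \<open>The change of variables y = \<gamma> / x, on compact intervals first and on the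
  half-line by monotone convergence.\<close>

lemma nn_integral_inversion:
  fixes F :: "real \<Rightarrow> ennreal"
  assumes F[measurable]: "F \<in> borel_measurable borel" and "\<gamma> > 0"
  shows "(\<integral>\<^sup>+x. F (\<gamma> / x) * ennreal (\<gamma> / x\<^sup>2) * indicator {0<..} x \<partial>lborel) = (\<integral>\<^sup>+y. F y * indicator {0<..} y \<partial>lborel)"
proof -
  have fin: "(\<integral>\<^sup>+x. F (\<gamma> / x) * ennreal (\<gamma> / x\<^sup>2) * indicator {a..b} x \<partial>lborel) = (\<integral>\<^sup>+y. F y * indicator {\<gamma> / b..\<gamma> / a} y \<partial>lborel)"
    if "0 < a" "a < b" for a b
  proof -
    \<comment> \<open>The reflection replaces the decreasing inversion by the increasing map
      \<open>- \<gamma> / x\<close>, whose derivative is nonnegative as the substitution rule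
      asks.\<close>
    have "(\<integral>\<^sup>+y. F y * indicator {\<gamma> / b..\<gamma> / a} y \<partial>lborel) = (\<integral>\<^sup>+y. F (- y) * indicator {\<gamma> / b..\<gamma> / a} (- y) \<partial>lborel)"
      using nn_integral_real_affine[of "\<lambda>y. F y * indicator {\<gamma> / b..\<gamma> / a} y" "-1" 0] by simp
    also have "\<dots> = (\<integral>\<^sup>+y. F (- y) * indicator {- \<gamma> / a..- \<gamma> / b} y \<partial>lborel)"
      by (intro nn_integral_cong) (auto simp: indicator_def)
    also have "\<dots> = (\<integral>\<^sup>+x. F (- (- \<gamma> / x)) * ennreal (\<gamma> / x\<^sup>2) * indicator {a..b} x \<partial>lborel)"
    proof (rule nn_integral_substitution_aux[where g = "\<lambda>x. - \<gamma> / x"])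
      show "((\<lambda>x. - \<gamma> / x) has_real_derivative \<gamma> / x\<^sup>2) (at x)" if "x \<in> {a..b}" for x
        using that \<open>0 < a\<close> by (auto intro!: derivative_eq_intros simp: power2_eq_square)
      show "continuous_on {a..b} (\<lambda>x. \<gamma> / x\<^sup>2)"
        using \<open>0 < a\<close> by (intro continuous_intros) auto
    qed (use that \<open>\<gamma> > 0\<close> in auto)
    finally show ?thesis by simp
  qed
  \<comment> \<open>Starting with [1 / 2, 2] makes every interval of the exhaustion
    nondegenerate.\<close>
  let ?a = "\<lambda>n. 1 / real (Suc (Suc n))" and ?b = "\<lambda>n. real (Suc (Suc n))"
  have mono_b: "?b m \<le> ?b n" if "m \<le> n" for m n using that by simp
  have mono_a: "?a n \<le> ?a m" if "m \<le> n" for m n using that by (simp add: frac_le)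
  have sup: "(\<integral>\<^sup>+x. G x * indicator {0<..} x \<partial>lborel) = (SUP n. \<integral>\<^sup>+x. G x * indicator {c * ?a n..c * ?b n} x \<partial>lborel)"
    if [measurable]: "G \<in> borel_measurable borel" and "c > 0" for G :: "real \<Rightarrow> ennreal" and c
  proof -
    have "(SUP n. G x * indicator {c * ?a n..c * ?b n} x) = G x * indicator {0<..} x" for x
    proof (cases "x > 0")
      case True
      obtain n :: nat where n: "max (x / c) (c / x) \<le> real n" using real_arch_simple by blast
      then have "x / c \<le> ?b n" "c / x \<le> ?b n" by auto
      then have "x \<in> {c * ?a n..c * ?b n}" using True \<open>c > 0\<close> by (auto simp: field_simps)
      then have "G x \<le> (SUP n. G x * indicator {c * ?a n..c * ?b n} x)"
        by (intro SUP_upper2[of n]) auto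
      moreover have "(SUP n. G x * indicator {c * ?a n..c * ?b n} x) \<le> G x"
        by (intro SUP_least) (auto simp: indicator_def)
      ultimately show ?thesis using True by (simp add: antisym)
    next
      case False
      have "x \<notin> {c * ?a n..c * ?b n}" for n
      proof -
        have "c * ?a n > 0" using \<open>c > 0\<close> by simp
        then show ?thesis using False by auto
      qed
      then have z: "(\<lambda>n. G x * indicator {c * ?a n..c * ?b n} x) = (\<lambda>_. 0)" by (intro ext) simp
      show ?thesis unfolding z using False by simp
    qed
    then have "(\<integral>\<^sup>+x. G x * indicator {0<..} x \<partial>lborel) = (\<integral>\<^sup>+x. (SUP n. G x * indicator {c * ?a n..c * ?b n} x) \<partial>lborel)"
      by simp
    also have "\<dots> = (SUP n. \<integral>\<^sup>+x. G x * indicator {c * ?a n..c * ?b n} x \<partial>lborel)"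
    proof (rule nn_integral_monotone_convergence_SUP)
      have "{c * ?a m..c * ?b m} \<subseteq> {c * ?a n..c * ?b n}" if "m \<le> n" for m n
        using mult_left_mono[OF mono_a[OF that], of c] mult_left_mono[OF mono_b[OF that], of c] \<open>c > 0\<close> by simp
      then show "incseq (\<lambda>n x. G x * indicator {c * ?a n..c * ?b n} x)"
        unfolding incseq_def le_fun_def
        by (intro allI impI mult_left_mono indicator_leI) (blast, simp)
    qed simp
    finally show ?thesis .
  qed
  have "(\<integral>\<^sup>+x. F (\<gamma> / x) * ennreal (\<gamma> / x\<^sup>2) * indicator {0<..} x \<partial>lborel) =
     (SUP n. \<integral>\<^sup>+x. F (\<gamma> / x) * ennreal (\<gamma> / x\<^sup>2) * indicator {1 * ?a n..1 * ?b n} x \<partial>lborel)"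
    by (rule sup) auto
  also have "\<dots> = (SUP n. \<integral>\<^sup>+y. F y * indicator {\<gamma> * ?a n..\<gamma> * ?b n} y \<partial>lborel)"
  proof (rule SUP_cong[OF refl])
    fix n
    have "0 < ?a n" "?a n < ?b n" using less_trans[of "?a n" 1 "?b n"] by simp_all
    from fin[OF this]
    show "(\<integral>\<^sup>+x. F (\<gamma> / x) * ennreal (\<gamma> / x\<^sup>2) * indicator {1 * ?a n..1 * ?b n} x \<partial>lborel) =
      (\<integral>\<^sup>+y. F y * indicator {\<gamma> * ?a n..\<gamma> * ?b n} y \<partial>lborel)" by simp
  qed
  also have "\<dots> = (\<integral>\<^sup>+y. F y * indicator {0<..} y \<partial>lborel)"
    by (rule sup[symmetric]) (use \<open>\<gamma> > 0\<close> in auto)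
  finally show ?thesis .
qed

lemma nn_integral_fold:
  fixes F :: "real \<Rightarrow> ennreal"
  assumes F[measurable]: "F \<in> borel_measurable borel"
  shows "(\<integral>\<^sup>+y. F y * indicator {1..} y \<partial>lborel) = (\<integral>\<^sup>+x. (\<Sum>n. F (x + real n + 1)) * indicator {0..<1} x \<partial>lborel)"
proof -
  have ind: "F y * indicator {1..} y = (\<Sum>n. F y * indicator {real n + 1..<real n + 2} y)" for y
  proof (cases "y \<ge> 1")
    case True
    define N where "N = nat \<lfloor>y - 1\<rfloor>"
    have N: "real N \<le> y - 1" "y - 1 < real N + 1" using True unfolding N_def by linarith+
    have "(\<Sum>n. F y * indicator {real n + 1..<real n + 2} y) = (\<Sum>n\<in>{N}. F y * indicator {real n + 1..<real n + 2} y)"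
    proof (rule suminf_finite)
      fix n assume "n \<notin> {N}"
      then have "n < N \<or> N < n" by auto
      then have "real n + 1 \<le> real N \<or> real N + 1 \<le> real n"
        using of_nat_le_iff[of "Suc n" N, where 'a = real] of_nat_le_iff[of "Suc N" n, where 'a = real] by auto
      then show "F y * indicator {real n + 1..<real n + 2} y = 0" using N by (auto simp: indicator_def)
    qed simp
    then show ?thesis using N True by (simp add: indicator_def)
  next
    case False
    then have "F y * indicator {real n + 1..<real n + 2} y = 0" for n by (auto simp: indicator_def)
    then show ?thesis using False by simp
  qed
  have "(\<integral>\<^sup>+y. F y * indicator {1..} y \<partial>lborel) = (\<Sum>n. \<integral>\<^sup>+y. F y * indicator {real n + 1..<real n + 2} y \<partial>lborel)"
    unfolding ind by (rule nn_integral_suminf) simp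
  also have "\<dots> = (\<Sum>n. \<integral>\<^sup>+x. F (x + real n + 1) * indicator {0..<1} x \<partial>lborel)"
  proof (rule suminf_cong)
    fix n
    have "(\<integral>\<^sup>+y. F y * indicator {real n + 1..<real n + 2} y \<partial>lborel) =
      (\<integral>\<^sup>+x. F (real n + 1 + 1 * x) * indicator {real n + 1..<real n + 2} (real n + 1 + 1 * x) \<partial>lborel)"
      using nn_integral_real_affine[of "\<lambda>y. F y * indicator {real n + 1..<real n + 2} y" 1 "real n + 1"] by simp
    also have "\<dots> = (\<integral>\<^sup>+x. F (x + real n + 1) * indicator {0..<1} x \<partial>lborel)"
      by (intro nn_integral_cong) (auto simp: indicator_def add_ac)
    finally show "(\<integral>\<^sup>+y. F y * indicator {real n + 1..<real n + 2} y \<partial>lborel) =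
      (\<integral>\<^sup>+x. F (x + real n + 1) * indicator {0..<1} x \<partial>lborel)" .
  qed
  also have "\<dots> = (\<integral>\<^sup>+x. (\<Sum>n. F (x + real n + 1) * indicator {0..<1} x) \<partial>lborel)"
    by (rule nn_integral_suminf[symmetric]) simp
  finally show ?thesis by simp
qed

text \<open>Equality on indicators identifies the image measure with the measure of density
  \<open>b\<close>, so the integrals of every Borel \<open>q\<close> agree; if one of them does not
  exist, neither does the other, and both are the default value 0.\<close>

lemma integral_transfer:
  fixes a b q S :: "real \<Rightarrow> real"
  assumes [measurable]: "a \<in> borel_measurable borel" "b \<in> borel_measurable borel" "S \<in> borel_measurable borel"
    and nn: "\<And>x. a x \<ge> 0" "\<And>x. b x \<ge> 0"
    and eq: "\<And>A. A \<in> sets borel \<Longrightarrow>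
      (\<integral>\<^sup>+x. ennreal (a x) * indicator A (S x) \<partial>lborel) = (\<integral>\<^sup>+x. ennreal (b x) * indicator A x \<partial>lborel)"
    and [measurable]: "q \<in> borel_measurable borel"
  shows "(\<integral>x. a x * q (S x) \<partial>lborel) = (\<integral>x. b x * q x \<partial>lborel)"
proof -
  have eqm: "distr (density lborel (\<lambda>x. ennreal (a x))) borel S = density lborel (\<lambda>x. ennreal (b x))"
  proof (rule measure_eqI)
    fix A assume "A \<in> sets (distr (density lborel (\<lambda>x. ennreal (a x))) borel S)"
    then have A[measurable]: "A \<in> sets borel" by simp
    have SA: "S -` A \<in> sets borel" using measurable_sets_borel[OF assms(3) A] .
    have "emeasure (distr (density lborel (\<lambda>x. ennreal (a x))) borel S) A = (\<integral>\<^sup>+x. ennreal (a x) * indicator (S -` A) x \<partial>lborel)"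
      using SA by (simp add: emeasure_distr emeasure_density)
    also have "\<dots> = (\<integral>\<^sup>+x. ennreal (a x) * indicator A (S x) \<partial>lborel)"
      by (simp add: indicator_def vimage_def)
    also have "\<dots> = emeasure (density lborel (\<lambda>x. ennreal (b x))) A"
      unfolding eq[OF A] by (simp add: emeasure_density)
    finally show "emeasure (distr (density lborel (\<lambda>x. ennreal (a x))) borel S) A = emeasure (density lborel (\<lambda>x. ennreal (b x))) A" .
  qed simp
  have "(\<integral>x. a x * q (S x) \<partial>lborel) = (\<integral>x. q x \<partial>distr (density lborel (\<lambda>x. ennreal (a x))) borel S)"
    using nn by (simp add: integral_distr integral_density)
  also have "\<dots> = (\<integral>x. b x * q x \<partial>lborel)"
    unfolding eqm using nn by (simp add: integral_density)
  finally show ?thesis .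
qed

text \<open>Composition with \<gamma> / x modulo 1, the dual of the transfer operator. It is set to
  zero outside (0, \<gamma>]: for \<gamma> < 1 this makes (\<gamma>, 1) a hole in which orbits
  stop.\<close>

definition koopman :: "real \<Rightarrow> (real \<Rightarrow> 'a::zero) \<Rightarrow> real \<Rightarrow> 'a" where
  "koopman \<gamma> \<psi> x = (if 0 < x \<and> x \<le> \<gamma> then \<psi> (frac (\<gamma> / x)) else 0)"

lemma borel_measurable_koopman[measurable]:
  fixes \<psi> :: "real \<Rightarrow> 'a::{zero, topological_space}"
  assumes [measurable]: "\<psi> \<in> borel_measurable borel"
  shows "koopman \<gamma> \<psi> \<in> borel_measurable borel"
  unfolding koopman_def[abs_def] by measurable

lemma koopman_ennreal: "ennreal (koopman \<gamma> \<psi> x) = koopman \<gamma> (\<lambda>x. ennreal (\<psi> x)) x"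
  by (simp add: koopman_def)

text \<open>The measure with density \<open>1 / (\<gamma> + x)\<close> is chosen so that its image under the map
  \<open>frac (\<gamma> / x)\<close> is a telescoping sum.\<close>

lemma nn_integral_koopman:
  fixes \<Phi> \<psi> :: "real \<Rightarrow> ennreal"
  assumes [measurable]: "\<Phi> \<in> borel_measurable borel" "\<psi> \<in> borel_measurable borel" and "\<gamma> > 0"
  shows "(\<integral>\<^sup>+x. \<Phi> x * ennreal (1 / (\<gamma> + x)) * koopman \<gamma> \<psi> x \<partial>lborel) =
    (\<integral>\<^sup>+x. (\<Sum>n. \<Phi> (\<gamma> / (x + real n + 1)) * ennreal (1 / ((x + real n + 1) * (x + real n + 2)))) * \<psi> x
      * indicator {0..<1} x \<partial>lborel)"
proof -
  let ?F = "\<lambda>y. \<Phi> (\<gamma> / y) * ennreal (1 / (y * (y + 1))) * \<psi> (frac y) * indicator {1..} y"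
  have "(\<integral>\<^sup>+x. \<Phi> x * ennreal (1 / (\<gamma> + x)) * koopman \<gamma> \<psi> x \<partial>lborel) =
     (\<integral>\<^sup>+x. ?F (\<gamma> / x) * ennreal (\<gamma> / x\<^sup>2) * indicator {0<..} x \<partial>lborel)"
  proof (rule nn_integral_cong)
    fix x :: real
    show "\<Phi> x * ennreal (1 / (\<gamma> + x)) * koopman \<gamma> \<psi> x = ?F (\<gamma> / x) * ennreal (\<gamma> / x\<^sup>2) * indicator {0<..} x"
    proof (cases "0 < x \<and> x \<le> \<gamma>")
      case True
      then have x: "0 < x" "\<gamma> / x \<ge> 1" using \<open>\<gamma> > 0\<close> by auto
      have "1 / (\<gamma> / x * (\<gamma> / x + 1)) * (\<gamma> / x\<^sup>2) = 1 / (\<gamma> + x)"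
        using x(1) \<open>\<gamma> > 0\<close> add_pos_pos[of "\<gamma> * \<gamma>" "\<gamma> * x"]
        by (simp add: field_simps power2_eq_square)
      then have e: "ennreal (1 / (\<gamma> + x)) = ennreal (1 / (\<gamma> / x * (\<gamma> / x + 1))) * ennreal (\<gamma> / x\<^sup>2)"
        using x(1) \<open>\<gamma> > 0\<close> by (subst ennreal_mult[symmetric]) auto
      have g: "\<gamma> / (\<gamma> / x) = x" using \<open>\<gamma> > 0\<close> by simp
      show ?thesis unfolding e g using True x by (simp add: koopman_def mult_ac)
    next
      case False
      then have "x \<le> 0 \<or> \<not> \<gamma> / x \<ge> 1" using \<open>\<gamma> > 0\<close> by (auto simp: field_simps)
      then show ?thesis using False by (auto simp: koopman_def indicator_def)
    qed
  qed
  also have "\<dots> = (\<integral>\<^sup>+y. ?F y * indicator {0<..} y \<partial>lborel)"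
    by (rule nn_integral_inversion) (use \<open>\<gamma> > 0\<close> in measurable)
  also have "\<dots> = (\<integral>\<^sup>+y. (\<Phi> (\<gamma> / y) * ennreal (1 / (y * (y + 1))) * \<psi> (frac y)) * indicator {1..} y \<partial>lborel)"
    by (intro nn_integral_cong) (auto simp: indicator_def)
  also have "\<dots> = (\<integral>\<^sup>+x. (\<Sum>n. \<Phi> (\<gamma> / (x + real n + 1)) * ennreal (1 / ((x + real n + 1) * ((x + real n + 1) + 1)))
      * \<psi> (frac (x + real n + 1))) * indicator {0..<1} x \<partial>lborel)"
    by (rule nn_integral_fold) measurable
  also have "\<dots> = (\<integral>\<^sup>+x. (\<Sum>n. \<Phi> (\<gamma> / (x + real n + 1)) * ennreal (1 / ((x + real n + 1) * (x + real n + 2)))) * \<psi> x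
      * indicator {0..<1} x \<partial>lborel)"
  proof (rule nn_integral_cong)
    fix x :: real
    show "(\<Sum>n. \<Phi> (\<gamma> / (x + real n + 1)) * ennreal (1 / ((x + real n + 1) * ((x + real n + 1) + 1)))
      * \<psi> (frac (x + real n + 1))) * indicator {0..<1} x =
      (\<Sum>n. \<Phi> (\<gamma> / (x + real n + 1)) * ennreal (1 / ((x + real n + 1) * (x + real n + 2)))) * \<psi> x * indicator {0..<1} x"
    proof (cases "x \<in> {0..<1}")
      case True
      have "frac (x + real n + 1) = x" for n
        unfolding frac_unique_iff using True by (auto simp: add.assoc)
      then show ?thesis by (simp add: add.assoc)
    qed simp
  qed
  finally show ?thesis .
qed

lemma sums_telescope_shift:
  fixes x :: real
  assumes "x \<ge> 0"
  shows "(\<lambda>n. 1 / ((x + real n + 1) * (x + real n + 2))) sums (1 / (x + 1))"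
proof -
  have "(\<lambda>n. 1 / (x + 1 + real n)) \<longlonglongrightarrow> 0"
    by real_asymp
  from telescope_sums'[OF this]
  have "(\<lambda>n. 1 / (x + 1 + real n) - 1 / (x + 1 + real (Suc n))) sums (1 / (x + 1))" by simp
  also have "(\<lambda>n. 1 / (x + 1 + real n) - 1 / (x + 1 + real (Suc n))) = (\<lambda>n. 1 / ((x + real n + 1) * (x + real n + 2)))"
  proof
    fix n
    have "x + real n + 1 \<noteq> 0" "x + real n + 2 \<noteq> 0" using assms by (auto simp: add_nonneg_eq_0_iff)
    then show "1 / (x + 1 + real n) - 1 / (x + 1 + real (Suc n)) = 1 / ((x + real n + 1) * (x + real n + 2))"
      by (simp add: divide_simps) (simp add: algebra_simps)
  qed
  finally show ?thesis .
qed

lemma suminf_telescope_ennreal: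
  fixes x :: real
  assumes "x \<ge> 0"
  shows "(\<Sum>n. ennreal (1 / ((x + real n + 1) * (x + real n + 2)))) = ennreal (1 / (1 + x))"
  unfolding add.commute[of 1 x]
proof (rule suminf_ennreal_eq[OF _ sums_telescope_shift[OF assms]])
  show "0 \<le> 1 / ((x + real n + 1) * (x + real n + 2))" for n using assms by simp
qed

text \<open>The image density 1 / (1 + x) does not depend on \<gamma>. For \<gamma> = 1 it is the
  density of departure, that of the Gauss measure; for \<gamma> < 1 it is smaller than 1 / (\<gamma>
  + x), and this is the loss of mass.\<close>

lemma nn_integral_koopman_1:
  fixes \<psi> :: "real \<Rightarrow> ennreal"
  assumes [measurable]: "\<psi> \<in> borel_measurable borel" and "\<gamma> > 0"
  shows "(\<integral>\<^sup>+x. ennreal (1 / (\<gamma> + x)) * koopman \<gamma> \<psi> x \<partial>lborel) =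
    (\<integral>\<^sup>+x. ennreal (1 / (1 + x)) * \<psi> x * indicator {0..<1} x \<partial>lborel)"
proof -
  have "(\<integral>\<^sup>+x. ennreal (1 / (\<gamma> + x)) * koopman \<gamma> \<psi> x \<partial>lborel) =
    (\<integral>\<^sup>+x. (\<Sum>n. ennreal (1 / ((x + real n + 1) * (x + real n + 2)))) * \<psi> x * indicator {0..<1} x \<partial>lborel)"
    using nn_integral_koopman[of "\<lambda>_. 1" \<psi> \<gamma>] assms by simp
  also have "\<dots> = (\<integral>\<^sup>+x. ennreal (1 / (1 + x)) * \<psi> x * indicator {0..<1} x \<partial>lborel)"
  proof (rule nn_integral_cong)
    fix x :: real
    show "(\<Sum>n. ennreal (1 / ((x + real n + 1) * (x + real n + 2)))) * \<psi> x * indicator {0..<1} x =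
      ennreal (1 / (1 + x)) * \<psi> x * indicator {0..<1} x"
    proof (cases "x \<in> {0..<1}")
      case True
      then have "x \<ge> 0" by simp
      show ?thesis unfolding suminf_telescope_ennreal[OF \<open>x \<ge> 0\<close>] ..
    qed simp
  qed
  finally show ?thesis .
qed

text \<open>After rescaling, the conditions on a density on the half line coming from the two arms of
  the lattice-cross.\<close>

definition critical_solution :: "real \<Rightarrow> (real \<Rightarrow> real) \<Rightarrow> bool" where
  "critical_solution \<gamma> k \<longleftrightarrow> integrable lborel k \<and> (\<forall>x\<le>0. k x = 0) \<and>
     (\<forall>m::int. (\<integral>x. k x *\<^sub>R cis (2 * pi * m * x) \<partial>lborel) = 0) \<and>
     (\<forall>m::int. (\<integral>x. k x *\<^sub>R cis (2 * pi * m * (\<gamma> / x)) \<partial>lborel) = 0)"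

section \<open>The two periodization conditions in weak form\<close>

lemma AE_notin_countable: "countable A \<Longrightarrow> AE x in (lborel :: real measure). x \<notin> A"
  by (rule AE_not_in[OF countable_imp_null_set_lborel])

text \<open>Passes from characters to bounded Borel test functions; on the second arm the points
  with integer \<gamma> / x form a countable, hence null, set.\<close>

lemma critical_solution_periodic:
  assumes k: "critical_solution \<gamma> k" and "\<gamma> > 0"
    and q: "q \<in> borel_measurable borel" "\<And>x. \<bar>q x\<bar> \<le> B"
  shows "(\<integral>x. k x * q (frac x) \<partial>lborel) = 0" "(\<integral>x. k x * q (frac (\<gamma> / x)) \<partial>lborel) = 0"
proof -
  have ZZ: "countable (\<int> :: real set)" by (simp add: Ints_def)
  show "(\<integral>x. k x * q (frac x) \<partial>lborel) = 0"
  proof (rule fourier_zero_periodic[where S = "\<lambda>x. x", OF _ _ q])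
    show "AE x in lborel. (x :: real) \<notin> \<int>" by (rule AE_notin_countable[OF ZZ])
  qed (use k in \<open>auto simp: critical_solution_def\<close>)
  show "(\<integral>x. k x * q (frac (\<gamma> / x)) \<partial>lborel) = 0"
  proof (rule fourier_zero_periodic[where S = "\<lambda>x. \<gamma> / x", OF _ _ q])
    have "AE x in lborel. x \<notin> (\<lambda>y. \<gamma> / y) ` \<int>"
      by (rule AE_notin_countable) (rule countable_image[OF ZZ])
    then show "AE x in lborel. \<gamma> / x \<notin> \<int>"
    proof eventually_elim
      case (elim x)
      have "x = \<gamma> / (\<gamma> / x)" using \<open>\<gamma> > 0\<close> by simp
      with elim show ?case by blast
    qed
  qed (use k in \<open>auto simp: critical_solution_def\<close>)
qed

lemma abs_koopman_le:
  fixes \<psi> :: "real \<Rightarrow> real"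
  assumes b: "\<And>x. \<bar>\<psi> x\<bar> \<le> B"
  shows "\<bar>koopman \<gamma> \<psi> x\<bar> \<le> B"
proof -
  have "B \<ge> 0" using order_trans[OF abs_ge_zero b] .
  then show ?thesis using b by (simp add: koopman_def)
qed

lemma integrable_mult_bounded_real:
  fixes k q :: "'a \<Rightarrow> real"
  assumes "integrable M k" "q \<in> borel_measurable M" "\<And>x. \<bar>q x\<bar> \<le> B"
  shows "integrable M (\<lambda>x. k x * q x)"
  using integrable_mult_bounded[of M k q B] assms by simp

lemma frac_eq_self: "0 \<le> x \<Longrightarrow> x < 1 \<Longrightarrow> frac x = x"
  by (simp add: frac_eq)

text \<open>Test the first condition with \<psi> and the second with
  \<open>koopman \<gamma> \<psi>\<close>. Beyond 1 the point \<gamma> / x is not folded, and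
  applying the map to it returns x modulo 1. Both conditions thus contain the same integral over the
  ray, and comparing them eliminates it.\<close>

lemma critical_solution_koopman:
  assumes k: "critical_solution \<gamma> k" and \<gamma>: "0 < \<gamma>" "\<gamma> \<le> 1"
    and \<psi>[measurable]: "\<psi> \<in> borel_measurable borel" and b: "\<And>x. \<bar>\<psi> x\<bar> \<le> B"
  shows "(\<integral>x. k x * (\<psi> x * indicator {0..<1} x) \<partial>lborel) =
    (\<integral>x. k x * (koopman \<gamma> (koopman \<gamma> \<psi>) x * indicator {0..<1} x) \<partial>lborel)"
proof -
  have ki: "integrable lborel k" and k0: "\<And>x. x \<le> 0 \<Longrightarrow> k x = 0"
    using k by (auto simp: critical_solution_def)
  note [measurable] = borel_measurable_integrable[OF ki]
  have bK: "\<bar>koopman \<gamma> \<psi> x\<bar> \<le> B" for x by (rule abs_koopman_le[OF b])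
  have bKK: "\<bar>koopman \<gamma> (koopman \<gamma> \<psi>) x\<bar> \<le> B" for x by (rule abs_koopman_le[OF bK])
  have "B \<ge> 0" using b[of 0] by simp
  have i1: "integrable lborel (\<lambda>x. k x * (\<psi> x * indicator {0..<1} x))"
    by (rule integrable_mult_bounded_real[OF ki, of _ B]) (use b \<open>B \<ge> 0\<close> in \<open>auto simp: indicator_def\<close>)
  have i2: "integrable lborel (\<lambda>x. k x * (koopman \<gamma> (koopman \<gamma> \<psi>) x * indicator {0..<1} x))"
    by (rule integrable_mult_bounded_real[OF ki, of _ B]) (use bKK \<open>B \<ge> 0\<close> in \<open>auto simp: indicator_def\<close>)
  have i3: "integrable lborel (\<lambda>x. k x * (\<psi> (frac x) * indicator {1..} x))"
    by (rule integrable_mult_bounded_real[OF ki, of _ B]) (use b \<open>B \<ge> 0\<close> in \<open>auto simp: indicator_def\<close>)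
  have "0 = (\<integral>x. k x * \<psi> (frac x) \<partial>lborel)"
    using critical_solution_periodic(1)[OF k \<gamma>(1) \<psi> b] by simp
  also have "\<dots> = (\<integral>x. k x * (\<psi> x * indicator {0..<1} x) + k x * (\<psi> (frac x) * indicator {1..} x) \<partial>lborel)"
  proof (rule Bochner_Integration.integral_cong[OF refl])
    fix x
    show "k x * \<psi> (frac x) = k x * (\<psi> x * indicator {0..<1} x) + k x * (\<psi> (frac x) * indicator {1..} x)"
      using k0[of x] frac_eq_self[of x] by (cases "x \<le> 0"; cases "x < 1") (auto simp: indicator_def)
  qed
  also have "\<dots> = (\<integral>x. k x * (\<psi> x * indicator {0..<1} x) \<partial>lborel) + (\<integral>x. k x * (\<psi> (frac x) * indicator {1..} x) \<partial>lborel)"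
    by (rule Bochner_Integration.integral_add[OF i1 i3])
  finally have e1: "(\<integral>x. k x * (\<psi> x * indicator {0..<1} x) \<partial>lborel) = - (\<integral>x. k x * (\<psi> (frac x) * indicator {1..} x) \<partial>lborel)"
    by linarith
  have "0 = (\<integral>x. k x * koopman \<gamma> \<psi> (frac (\<gamma> / x)) \<partial>lborel)"
    using critical_solution_periodic(2)[OF k \<gamma>(1) borel_measurable_koopman[OF \<psi>] bK] by simp
  also have "\<dots> = (\<integral>x. k x * (koopman \<gamma> (koopman \<gamma> \<psi>) x * indicator {0..<1} x) + k x * (\<psi> (frac x) * indicator {1..} x) \<partial>lborel)"
  proof (rule integral_cong_AE)
    have "AE x in lborel. x \<notin> {1::real}" by (rule AE_notin_countable) simp
    then show "AE x in lborel. k x * koopman \<gamma> \<psi> (frac (\<gamma> / x)) =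
      k x * (koopman \<gamma> (koopman \<gamma> \<psi>) x * indicator {0..<1} x) + k x * (\<psi> (frac x) * indicator {1..} x)"
    proof eventually_elim
      case (elim x)
      consider "x \<le> 0" | "0 < x" "x \<le> \<gamma>" "x < 1" | "\<gamma> < x" "x < 1" | "x > 1" using elim by fastforce
      then show ?case
      proof cases
        case 1 then show ?thesis by (simp add: k0)
      next
        case 2
        then show ?thesis by (simp add: koopman_def[of \<gamma> "koopman \<gamma> \<psi>"])
      next
        case 3
        have "0 < x" using 3 \<gamma> by simp
        \<comment> \<open>Inversion keeps x inside (\<gamma>, 1), where
          \<open>koopman \<gamma> \<psi>\<close> has been set to zero.\<close>
        have "\<gamma> / x < 1" "\<gamma> < \<gamma> / x" using 3 \<gamma> \<open>0 < x\<close> by (auto simp: field_simps)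
        then have "koopman \<gamma> \<psi> (frac (\<gamma> / x)) = 0"
          using \<gamma> \<open>0 < x\<close> by (simp add: frac_eq_self koopman_def[of \<gamma> \<psi>])
        then show ?thesis using 3 by (simp add: koopman_def[of \<gamma> "koopman \<gamma> \<psi>"])
      next
        case 4
        have g: "\<gamma> / x < 1" "\<gamma> / x \<le> \<gamma>" "0 < \<gamma> / x" using 4 \<gamma> by (auto simp: field_simps)
        have "koopman \<gamma> \<psi> (frac (\<gamma> / x)) = \<psi> (frac x)"
          using g \<gamma> by (simp add: frac_eq_self koopman_def[of \<gamma> \<psi>])
        then show ?thesis using 4 by simp
      qed
    qed
  qed measurable
  also have "\<dots> = (\<integral>x. k x * (koopman \<gamma> (koopman \<gamma> \<psi>) x * indicator {0..<1} x) \<partial>lborel) + (\<integral>x. k x * (\<psi> (frac x) * indicator {1..} x) \<partial>lborel)"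
    by (rule Bochner_Integration.integral_add[OF i2 i3])
  finally show ?thesis using e1 by linarith
qed

text \<open>The test function with value \<psi> (\<gamma> / u) at u undoes the inversion, so on the
  ray the second condition sees \<psi> itself. Hence \<open>k\<close> beyond 1 is determined by its
  restriction to [0, 1).\<close>

lemma critical_solution_tail:
  assumes k: "critical_solution \<gamma> k" and \<gamma>: "0 < \<gamma>" "\<gamma> \<le> 1"
    and \<psi>[measurable]: "\<psi> \<in> borel_measurable borel" and b: "\<And>x. \<bar>\<psi> x\<bar> \<le> B"
  shows "(\<integral>x. k x * (\<psi> x * indicator {1..} x) \<partial>lborel) =
    - (\<integral>x. k x * (koopman \<gamma> (\<lambda>u. if 0 < u \<and> u \<le> \<gamma> then \<psi> (\<gamma> / u) else 0) x * indicator {0..<1} x) \<partial>lborel)"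
proof -
  have ki: "integrable lborel k" and k0: "\<And>x. x \<le> 0 \<Longrightarrow> k x = 0"
    using k by (auto simp: critical_solution_def)
  note [measurable] = borel_measurable_integrable[OF ki]
  define q where "q u = (if 0 < u \<and> u \<le> \<gamma> then \<psi> (\<gamma> / u) else 0)" for u
  have qm[measurable]: "q \<in> borel_measurable borel" unfolding q_def by measurable
  have "B \<ge> 0" using b[of 0] by simp
  have bq: "\<bar>q u\<bar> \<le> B" for u using b \<open>B \<ge> 0\<close> by (simp add: q_def)
  have bK: "\<bar>koopman \<gamma> q x\<bar> \<le> B" for x by (rule abs_koopman_le[OF bq])
  have i1: "integrable lborel (\<lambda>x. k x * (koopman \<gamma> q x * indicator {0..<1} x))"
    by (rule integrable_mult_bounded_real[OF ki, of _ B]) (use bK \<open>B \<ge> 0\<close> in \<open>auto simp: indicator_def\<close>)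
  have i2: "integrable lborel (\<lambda>x. k x * (\<psi> x * indicator {1..} x))"
    by (rule integrable_mult_bounded_real[OF ki, of _ B]) (use b \<open>B \<ge> 0\<close> in \<open>auto simp: indicator_def\<close>)
  have "0 = (\<integral>x. k x * q (frac (\<gamma> / x)) \<partial>lborel)"
    using critical_solution_periodic(2)[OF k \<gamma>(1) qm bq] by simp
  also have "\<dots> = (\<integral>x. k x * (koopman \<gamma> q x * indicator {0..<1} x) + k x * (\<psi> x * indicator {1..} x) \<partial>lborel)"
  proof (rule integral_cong_AE)
    have "AE x in lborel. x \<notin> {1::real}" by (rule AE_notin_countable) simp
    then show "AE x in lborel. k x * q (frac (\<gamma> / x)) =
      k x * (koopman \<gamma> q x * indicator {0..<1} x) + k x * (\<psi> x * indicator {1..} x)"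
    proof eventually_elim
      case (elim x)
      consider "x \<le> 0" | "0 < x" "x \<le> \<gamma>" "x < 1" | "\<gamma> < x" "x < 1" | "x > 1" using elim by fastforce
      then show ?case
      proof cases
        case 1 then show ?thesis by (simp add: k0)
      next
        case 2
        then show ?thesis by (simp add: koopman_def)
      next
        case 3
        have "0 < x" using 3 \<gamma> by simp
        have "\<gamma> / x < 1" "\<gamma> < \<gamma> / x" using 3 \<gamma> \<open>0 < x\<close> by (auto simp: field_simps)
        then have "q (frac (\<gamma> / x)) = 0"
          using \<gamma> \<open>0 < x\<close> by (simp add: frac_eq_self q_def)
        then show ?thesis using 3 by (simp add: koopman_def)
      next
        case 4
        have g: "\<gamma> / x < 1" "\<gamma> / x \<le> \<gamma>" "0 < \<gamma> / x" using 4 \<gamma> by (auto simp: field_simps)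
        have "q (frac (\<gamma> / x)) = \<psi> x"
          using g \<gamma> by (simp add: frac_eq_self q_def)
        then show ?thesis using 4 by simp
      qed
    qed
  qed measurable
  also have "\<dots> = (\<integral>x. k x * (koopman \<gamma> q x * indicator {0..<1} x) \<partial>lborel) + (\<integral>x. k x * (\<psi> x * indicator {1..} x) \<partial>lborel)"
    by (rule Bochner_Integration.integral_add[OF i1 i2])
  finally show ?thesis unfolding q_def by linarith
qed

section \<open>Iterates of the composition operator and escape of mass\<close>

lemma borel_measurable_koopman_funpow:
  fixes \<psi> :: "real \<Rightarrow> real"
  shows "\<psi> \<in> borel_measurable borel \<Longrightarrow> (koopman \<gamma> ^^ n) \<psi> \<in> borel_measurable borel"
  by (induction n) auto

lemma koopman_funpow_1:
  "0 \<le> (koopman \<gamma> ^^ n) (\<lambda>_. 1 :: real) x" "(koopman \<gamma> ^^ n) (\<lambda>_. 1 :: real) x \<le> 1"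
proof -
  have "0 \<le> (koopman \<gamma> ^^ n) (\<lambda>_. 1 :: real) x \<and> (koopman \<gamma> ^^ n) (\<lambda>_. 1 :: real) x \<le> 1"
  proof (induction n arbitrary: x)
    case (Suc n)
    then show ?case by (simp add: koopman_def)
  qed simp
  then show "0 \<le> (koopman \<gamma> ^^ n) (\<lambda>_. 1 :: real) x" "(koopman \<gamma> ^^ n) (\<lambda>_. 1 :: real) x \<le> 1" by auto
qed

text \<open>The iterates of the constant 1 are the indicators of the points whose orbits survive n
  steps; they dominate the iterates of every bounded function.\<close>

lemma abs_koopman_funpow_le:
  assumes b: "\<And>x. \<bar>\<psi> x :: real\<bar> \<le> B"
  shows "\<bar>(koopman \<gamma> ^^ n) \<psi> x\<bar> \<le> B * (koopman \<gamma> ^^ n) (\<lambda>_. 1) x"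
proof (induction n arbitrary: x)
  case (Suc n)
  then show ?case by (simp add: koopman_def)
qed (use b in simp)

text \<open>With respect to the density 1 / (\<gamma> + x) the set surviving n steps has mass at
  most a constant times \<open>l ^ n\<close>; summability of these masses turns convergence in mean
  into convergence almost everywhere.\<close>

lemma koopman_funpow_tendsto_0:
  assumes \<gamma>: "0 < \<gamma>" "\<gamma> < 1"
  shows "AE x in lborel. x \<in> {0..<1} \<longrightarrow> (\<lambda>n. (koopman \<gamma> ^^ n) (\<lambda>_. 1 :: real) x) \<longlonglongrightarrow> 0"
proof -
  define T where "T n = (koopman \<gamma> ^^ n) (\<lambda>_. 1 :: real)" for n
  have [measurable]: "T n \<in> borel_measurable borel" for n
    unfolding T_def by (rule borel_measurable_koopman_funpow) simp
  have T0: "T n x \<ge> 0" for n x unfolding T_def by (rule koopman_funpow_1)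
  \<comment> \<open>The quotient (\<gamma> + x) / (1 + x) increases on [0, 1] and has this value at
    1.\<close>
  define l where "l = (1 + \<gamma>) / 2"
  have l: "0 < l" "l < 1" using \<gamma> by (auto simp: l_def)
  define f where "f n x = 1 / (\<gamma> + x) * T n x * indicator {0..<1} x" for n x
  have [measurable]: "f n \<in> borel_measurable borel" for n unfolding f_def by measurable
  have f0: "f n x \<ge> 0" for n x using T0 \<gamma> by (simp add: f_def indicator_def)
  define a where "a n = (\<integral>\<^sup>+x. ennreal (f n x) \<partial>lborel)" for n
  have step: "a (Suc n) \<le> ennreal l * a n" for n
  proof -
    have "a (Suc n) \<le> (\<integral>\<^sup>+x. ennreal (1 / (\<gamma> + x)) * koopman \<gamma> (\<lambda>x. ennreal (T n x)) x \<partial>lborel)"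
      unfolding a_def
    proof (rule nn_integral_mono)
      fix x
      show "ennreal (f (Suc n) x) \<le> ennreal (1 / (\<gamma> + x)) * koopman \<gamma> (\<lambda>x. ennreal (T n x)) x"
      proof (cases "x \<in> {0..<1}")
        case True
        then show ?thesis using \<gamma> T0
          by (simp add: f_def T_def koopman_ennreal[symmetric] ennreal_mult[symmetric] koopman_def)
      qed (simp add: f_def)
    qed
    also have "\<dots> = (\<integral>\<^sup>+x. ennreal (1 / (1 + x)) * ennreal (T n x) * indicator {0..<1} x \<partial>lborel)"
      by (rule nn_integral_koopman_1) (use \<gamma> in auto)
    also have "\<dots> \<le> (\<integral>\<^sup>+x. ennreal l * ennreal (f n x) \<partial>lborel)"
    proof (rule nn_integral_mono)
      fix x :: real
      show "ennreal (1 / (1 + x)) * ennreal (T n x) * indicator {0..<1} x \<le> ennreal l * ennreal (f n x)"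
      proof (cases "x \<in> {0..<1}")
        case True
        have "1 / (1 + x) \<le> l * (1 / (\<gamma> + x))"
        proof -
          have "(1 - \<gamma>) * x \<le> (1 - \<gamma>) * 1" using True \<gamma> by (intro mult_left_mono) auto
          then show ?thesis using True \<gamma> by (simp add: l_def field_simps)
        qed
        then have "1 / (1 + x) * T n x \<le> l * (1 / (\<gamma> + x)) * T n x"
          by (rule mult_right_mono) (rule T0)
        then have "ennreal (1 / (1 + x) * T n x) \<le> ennreal (l * f n x)"
          using True by (intro ennreal_leI) (simp add: f_def)
        also have "ennreal (l * f n x) = ennreal l * ennreal (f n x)"
          by (rule ennreal_mult) (use l f0 in auto)
        also have "ennreal (1 / (1 + x) * T n x) = ennreal (1 / (1 + x)) * ennreal (T n x)"
          by (rule ennreal_mult) (use True T0 in auto)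
        finally show ?thesis using True by simp
      qed simp
    qed
    also have "\<dots> = ennreal l * a n" unfolding a_def by (rule nn_integral_cmult) simp
    finally show ?thesis .
  qed
  have a0: "a 0 \<le> ennreal (1 / \<gamma>)"
  proof -
    have "a 0 \<le> (\<integral>\<^sup>+x. ennreal (1 / \<gamma>) * indicator {0..<1::real} x \<partial>lborel)"
      unfolding a_def
    proof (rule nn_integral_mono)
      fix x :: real
      show "ennreal (f 0 x) \<le> ennreal (1 / \<gamma>) * indicator {0..<1} x"
      proof (cases "x \<in> {0..<1}")
        case True
        then have "1 / (\<gamma> + x) \<le> 1 / \<gamma>" using \<gamma> by (intro divide_left_mono) auto
        then show ?thesis using True by (simp add: f_def T_def ennreal_leI)
      qed (simp add: f_def)
    qed
    also have "\<dots> = ennreal (1 / \<gamma>)" by (subst nn_integral_cmult) auto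
    finally show ?thesis .
  qed
  have an: "a n \<le> ennreal (l ^ n * (1 / \<gamma>))" for n
  proof (induction n)
    case (Suc n)
    have "a (Suc n) \<le> ennreal l * a n" by (rule step)
    also have "\<dots> \<le> ennreal l * ennreal (l ^ n * (1 / \<gamma>))" by (intro mult_left_mono Suc) auto
    also have "\<dots> = ennreal (l ^ Suc n * (1 / \<gamma>))" using l \<gamma> by (subst ennreal_mult[symmetric]) (auto simp: mult.assoc)
    finally show ?case .
  qed (use a0 in simp)
  have "(\<Sum>n. a n) \<le> (\<Sum>n. ennreal (l ^ n * (1 / \<gamma>)))" by (intro suminf_le an) auto
  also have "\<dots> < top"
  proof -
    have "summable (\<lambda>n. l ^ n * (1 / \<gamma>))" using l by (intro summable_mult2 summable_geometric) auto
    then have "(\<Sum>n. ennreal (l ^ n * (1 / \<gamma>))) = ennreal (\<Sum>n. l ^ n * (1 / \<gamma>))"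
      using l \<gamma> by (intro suminf_ennreal2) auto
    then show ?thesis by simp
  qed
  finally have "(\<integral>\<^sup>+x. (\<Sum>n. ennreal (f n x)) \<partial>lborel) < \<infinity>"
    unfolding a_def by (subst nn_integral_suminf) auto
  then have "AE x in lborel. (\<Sum>n. ennreal (f n x)) \<noteq> \<infinity>"
    by (intro nn_integral_PInf_AE) auto
  then show ?thesis
  proof eventually_elim
    case (elim x)
    show ?case
    proof
      assume x: "x \<in> {0..<1}"
      have "summable (\<lambda>n. f n x)" using elim f0 by (intro summable_suminf_not_top) auto
      then have "(\<lambda>n. f n x) \<longlonglongrightarrow> 0" by (rule summable_LIMSEQ_zero)
      then have "(\<lambda>n. (\<gamma> + x) * f n x) \<longlonglongrightarrow> (\<gamma> + x) * 0" by (intro tendsto_mult tendsto_const)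
      moreover have "(\<gamma> + x) * f n x = T n x" for n using x \<gamma> by (simp add: f_def)
      ultimately show "(\<lambda>n. (koopman \<gamma> ^^ n) (\<lambda>_. 1 :: real) x) \<longlonglongrightarrow> 0" by (simp add: T_def)
    qed
  qed
qed

lemma critical_solution_koopman_funpow:
  assumes k: "critical_solution \<gamma> k" and \<gamma>: "0 < \<gamma>" "\<gamma> \<le> 1"
    and \<psi>[measurable]: "\<psi> \<in> borel_measurable borel" and b: "\<And>x. \<bar>\<psi> x\<bar> \<le> B"
  shows "(\<integral>x. k x * (\<psi> x * indicator {0..<1} x) \<partial>lborel) =
    (\<integral>x. k x * ((koopman \<gamma> ^^ (2 * n)) \<psi> x * indicator {0..<1} x) \<partial>lborel)"
proof (induction n)
  case (Suc n)
  have B: "B \<ge> 0" using b[of 0] by simp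
  have bn: "\<bar>(koopman \<gamma> ^^ (2 * n)) \<psi> x\<bar> \<le> B" for x
    using abs_koopman_funpow_le[of \<psi> B, OF b, where \<gamma> = \<gamma> and n = "2 * n" and x = x] mult_left_mono[OF koopman_funpow_1(2)[where \<gamma> = \<gamma> and n = "2 * n" and x = x] B]
    by simp
  from Suc critical_solution_koopman[OF k \<gamma> borel_measurable_koopman_funpow[OF \<psi>] bn]
  show ?case by simp
qed simp

lemma AE_eq_0_if_integrals_0:
  assumes k: "integrable lborel k"
    and z: "\<And>\<psi> :: real \<Rightarrow> real. \<psi> \<in> borel_measurable borel \<Longrightarrow> (\<And>x. \<bar>\<psi> x\<bar> \<le> 1) \<Longrightarrow> (\<integral>x. k x * \<psi> x \<partial>lborel) = 0"
  shows "AE x in lborel. k x = (0 :: real)"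
proof (rule density_unique_real[OF k integrable_zero])
  fix A assume "A \<in> sets (lborel :: real measure)"
  then have "A \<in> sets borel" by simp
  then have "(\<integral>x. k x * indicator A x \<partial>lborel) = 0"
    by (intro z) (auto simp: indicator_def)
  then show "(\<integral>x\<in>A. k x \<partial>lborel) = (\<integral>x\<in>A. 0 \<partial>lborel)"
    by (simp add: set_lebesgue_integral_def mult.commute)
qed

section \<open>The subcritical case\<close>

text \<open>By invariance the integral over [0, 1) may be computed with iterated test functions,
  which are dominated by the survival indicators and tend to zero; dominated convergence makes it
  vanish. The ray then follows from \<open>critical_solution_tail\<close>.\<close>

proposition critical_solution_subcritical:
  assumes k: "critical_solution \<gamma> k" and \<gamma>: "0 < \<gamma>" "\<gamma> < 1"
  shows "AE x in lborel. k x = 0"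
proof -
  have ki: "integrable lborel k" and k0: "\<And>x. x \<le> 0 \<Longrightarrow> k x = 0"
    using k by (auto simp: critical_solution_def)
  note [measurable] = borel_measurable_integrable[OF ki]
  have left: "(\<integral>x. k x * (\<psi> x * indicator {0..<1} x) \<partial>lborel) = 0"
    if \<psi>[measurable]: "\<psi> \<in> borel_measurable borel" and b: "\<And>x. \<bar>\<psi> x\<bar> \<le> B" for \<psi> B
  proof -
    have B: "B \<ge> 0" using b[of 0] by simp
    let ?T = "\<lambda>n. (koopman \<gamma> ^^ n) (\<lambda>_. 1 :: real)"
    have [measurable]: "(koopman \<gamma> ^^ n) \<psi> \<in> borel_measurable borel" for n
      by (rule borel_measurable_koopman_funpow[OF \<psi>])
    have "(\<lambda>n. \<integral>x. k x * ((koopman \<gamma> ^^ (2 * n)) \<psi> x * indicator {0..<1} x) \<partial>lborel) \<longlonglongrightarrow> (\<integral>x. 0 \<partial>(lborel :: real measure))"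
    proof (rule integral_dominated_convergence[where w = "\<lambda>x. B * \<bar>k x\<bar>"])
      show "AE x in lborel. (\<lambda>n. k x * ((koopman \<gamma> ^^ (2 * n)) \<psi> x * indicator {0..<1} x)) \<longlonglongrightarrow> 0"
        using koopman_funpow_tendsto_0[OF \<gamma>]
      proof eventually_elim
        case (elim x)
        show ?case
        proof (cases "x \<in> {0..<1}")
          case True
          then have "(\<lambda>n. ?T n x) \<longlonglongrightarrow> 0" using elim by simp
          then have "(\<lambda>n. ?T (2 * n) x) \<longlonglongrightarrow> 0"
            by (rule filterlim_compose) (simp add: mult_nat_left_at_top)
          then have "(\<lambda>n. B * ?T (2 * n) x) \<longlonglongrightarrow> B * 0" by (intro tendsto_mult tendsto_const)
          then have lim0: "(\<lambda>n. B * ?T (2 * n) x) \<longlonglongrightarrow> 0" by simp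
          have "(\<lambda>n. (koopman \<gamma> ^^ (2 * n)) \<psi> x) \<longlonglongrightarrow> 0"
          proof (rule Lim_null_comparison[OF always_eventually lim0], rule allI)
            show "norm ((koopman \<gamma> ^^ (2 * n)) \<psi> x) \<le> B * ?T (2 * n) x" for n
              unfolding real_norm_def by (rule abs_koopman_funpow_le[OF b])
          qed
          then have "(\<lambda>n. k x * (koopman \<gamma> ^^ (2 * n)) \<psi> x) \<longlonglongrightarrow> k x * 0" by (intro tendsto_mult tendsto_const)
          then show ?thesis using True by simp
        qed simp
      qed
      show "AE x in lborel. norm (k x * ((koopman \<gamma> ^^ (2 * n)) \<psi> x * indicator {0..<1} x)) \<le> B * \<bar>k x\<bar>" for n
      proof (rule AE_I2)
        fix x
        have "\<bar>(koopman \<gamma> ^^ (2 * n)) \<psi> x\<bar> \<le> B * 1"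
          using abs_koopman_funpow_le[of \<psi> B, OF b, where \<gamma> = \<gamma> and n = "2 * n" and x = x] mult_left_mono[OF koopman_funpow_1(2)[where \<gamma> = \<gamma> and n = "2 * n" and x = x] B]
          by simp
        then have "\<bar>(koopman \<gamma> ^^ (2 * n)) \<psi> x * indicator {0..<1} x\<bar> \<le> B" using B by (simp add: indicator_def)
        from mult_left_mono[OF this, of "\<bar>k x\<bar>"]
        show "norm (k x * ((koopman \<gamma> ^^ (2 * n)) \<psi> x * indicator {0..<1} x)) \<le> B * \<bar>k x\<bar>"
          by (simp add: abs_mult mult.commute)
      qed
    qed (use ki in auto)
    then show ?thesis
      using critical_solution_koopman_funpow[OF k \<gamma>(1) less_imp_le[OF \<gamma>(2)] \<psi> b]
      by (simp add: LIMSEQ_const_iff)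
  qed
  show ?thesis
  proof (rule AE_eq_0_if_integrals_0[OF ki])
    fix \<psi> :: "real \<Rightarrow> real" assume \<psi>[measurable]: "\<psi> \<in> borel_measurable borel" and b: "\<And>x. \<bar>\<psi> x\<bar> \<le> 1"
    have bq: "\<bar>koopman \<gamma> (\<lambda>u. if 0 < u \<and> u \<le> \<gamma> then \<psi> (\<gamma> / u) else 0) x\<bar> \<le> 1" for x
      by (rule abs_koopman_le) (use b in auto)
    have right: "(\<integral>x. k x * (\<psi> x * indicator {1..} x) \<partial>lborel) = 0"
      unfolding critical_solution_tail[OF k \<gamma>(1) less_imp_le[OF \<gamma>(2)] \<psi> b]
      by (subst left[OF _ bq]) auto
    have "(\<integral>x. k x * \<psi> x \<partial>lborel) = (\<integral>x. k x * (\<psi> x * indicator {0..<1} x) + k x * (\<psi> x * indicator {1..} x) \<partial>lborel)"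
    proof (rule Bochner_Integration.integral_cong[OF refl])
      fix x
      show "k x * \<psi> x = k x * (\<psi> x * indicator {0..<1} x) + k x * (\<psi> x * indicator {1..} x)"
        using k0[of x] by (cases "x \<le> 0") (auto simp: indicator_def)
    qed
    also have "\<dots> = (\<integral>x. k x * (\<psi> x * indicator {0..<1} x) \<partial>lborel) + (\<integral>x. k x * (\<psi> x * indicator {1..} x) \<partial>lborel)"
      by (intro Bochner_Integration.integral_add integrable_mult_bounded_real[OF ki, of _ 1])
        (use b in \<open>auto simp: indicator_def\<close>)
    finally show "(\<integral>x. k x * \<psi> x \<partial>lborel) = 0" using left[OF \<psi> b] right by simp
  qed
qed

section \<open>The critical case\<close>

text \<open>Probability weights of the inverse branches of the Gauss map, obtained by conjugating
  its transfer operator with the invariant density 1 / (1 + x).\<close>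

definition gauss_weight :: "nat \<Rightarrow> real \<Rightarrow> real" where
  "gauss_weight n x = (1 + x) * (1 / ((x + real n + 1) * (x + real n + 2)))"

definition gauss_operator :: "(real \<Rightarrow> real) \<Rightarrow> real \<Rightarrow> real" where
  "gauss_operator \<phi> x = (\<Sum>n. gauss_weight n x * \<phi> (1 / (x + real n + 1)))"

lemma gauss_weight_nonneg: "0 \<le> x \<Longrightarrow> gauss_weight n x \<ge> 0"
  by (simp add: gauss_weight_def)

lemma gauss_weight_sums: 
  assumes "0 \<le> x" shows "(\<lambda>n. gauss_weight n x) sums 1"
  using sums_mult[OF sums_telescope_shift[OF assms], of "1 + x"] assms
  by (simp add: gauss_weight_def add.commute)

lemma gauss_point_bounds: "0 \<le> x \<Longrightarrow> 1 / (x + real n + 1) \<in> {0..1}"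
  by simp

lemma gauss_operator_summable:
  assumes x: "0 \<le> x" and b: "\<And>y. y \<in> {0..1} \<Longrightarrow> \<bar>\<phi> y\<bar> \<le> C"
  shows "summable (\<lambda>n. gauss_weight n x * \<phi> (1 / (x + real n + 1)))"
proof (rule summable_comparison_test')
  show "summable (\<lambda>n. gauss_weight n x * C)"
    using gauss_weight_sums[OF x] by (intro summable_mult2) (rule sums_summable)
  show "norm (gauss_weight n x * \<phi> (1 / (x + real n + 1))) \<le> gauss_weight n x * C" for n
    using mult_left_mono[OF b[OF gauss_point_bounds[OF x]] gauss_weight_nonneg[OF x]] gauss_weight_nonneg[OF x]
    by (simp add: abs_mult)
qed

lemma gauss_weight_mono:
  assumes "0 \<le> x" "x \<le> y" "y \<le> 1" "n \<ge> 2"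
  shows "gauss_weight n x \<le> gauss_weight n y"
proof -
  define j where "j = real n + 1"
  have j: "j \<ge> 3" using assms by (simp add: j_def)
  have "x * y \<le> 1" using assms by (intro mult_le_one) auto
  \<comment> \<open>For j \<ge> 3 the value of j * j - j is at least 6 and outweighs 1 + (x + y) + x
    y, which is at most 4; for j = 2 the sign of the difference depends on x and y.\<close>
  have "j * (j - 1) \<ge> 3 * 2" using j by (intro mult_mono) auto
  then have "j * j - j - 1 - (x + y) - x * y \<ge> 0" using assms \<open>x * y \<le> 1\<close> by (simp add: algebra_simps)
  then have "(y - x) * (j * j - j - 1 - (x + y) - x * y) \<ge> 0" using assms by simp
  moreover have "(1 + y) * ((x + j) * (x + j + 1)) - (1 + x) * ((y + j) * (y + j + 1)) = (y - x) * (j * j - j - 1 - (x + y) - x * y)"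
    by (simp add: algebra_simps)
  ultimately have "(1 + x) * ((y + j) * (y + j + 1)) \<le> (1 + y) * ((x + j) * (x + j + 1))" by linarith
  moreover have "(x + j) * (x + j + 1) > 0" "(y + j) * (y + j + 1) > 0" using assms j by simp_all
  ultimately have "(1 + x) / ((x + j) * (x + j + 1)) \<le> (1 + y) / ((y + j) * (y + j + 1))"
    by (simp add: divide_le_eq le_divide_eq)
  then show ?thesis by (simp add: gauss_weight_def j_def add.assoc)
qed

text \<open>The weights for \<open>x\<close> and \<open>y\<close> both sum to 1, so subtracting the constant
  \<open>\<phi> (1 / (y + 2))\<close> is free; that choice makes the term \<open>n = 1\<close> vanish, and the weights with
  \<open>n \<ge> 2\<close> are monotone, so their total variation telescopes.\<close>

lemma gauss_operator_Lipschitz: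
  assumes lip: "\<And>x y. x \<in> {0..1} \<Longrightarrow> y \<in> {0..1} \<Longrightarrow> \<bar>\<phi> x - \<phi> y\<bar> \<le> L * \<bar>x - y\<bar>" and "L \<ge> 0"
    and xy: "x \<in> {0..1}" "y \<in> {0..1}"
  shows "\<bar>gauss_operator \<phi> x - gauss_operator \<phi> y\<bar> \<le> 7 / 8 * L * \<bar>x - y\<bar>"
  using xy
proof (induction x y rule: linorder_wlog)
  case (sym x y)
  then show ?case by (simp add: abs_minus_commute)
next
  case (le x y)
  then have x: "0 \<le> x" "x \<le> 1" and y: "0 \<le> y" "y \<le> 1" by auto
  define d where "d = y - x"
  have d: "d \<ge> 0" using le by (simp add: d_def)
  let ?p = "\<lambda>n. gauss_weight n x" and ?q = "\<lambda>n. gauss_weight n y"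
  let ?a = "\<lambda>n. 1 / (x + real n + 1)" and ?b = "\<lambda>n. 1 / (y + real n + 1)"
  let ?c = "1 / (y + 2)"
  have b: "\<bar>\<phi> z\<bar> \<le> \<bar>\<phi> 0\<bar> + L" if "z \<in> {0..1}" for z
  proof -
    have "\<bar>\<phi> z - \<phi> 0\<bar> \<le> L * \<bar>z - 0\<bar>" by (rule lip) (use that in auto)
    also have "\<dots> \<le> L * 1" using that \<open>L \<ge> 0\<close> by (intro mult_left_mono) auto
    finally show ?thesis by linarith
  qed
  have sp: "?p sums 1" "?q sums 1" using gauss_weight_sums x y by auto
  have sx: "(\<lambda>n. ?p n * \<phi> (?a n)) sums gauss_operator \<phi> x"
    unfolding gauss_operator_def using gauss_operator_summable[OF x(1) b] by (rule summable_sums)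
  have sy: "(\<lambda>n. ?q n * \<phi> (?b n)) sums gauss_operator \<phi> y"
    unfolding gauss_operator_def using gauss_operator_summable[OF y(1) b] by (rule summable_sums)
  have sc: "(\<lambda>n. (?p n - ?q n) * \<phi> ?c) sums ((1 - 1) * \<phi> ?c)"
    by (intro sums_mult2 sums_diff sp)
  let ?t = "\<lambda>n. ?p n * (\<phi> (?a n) - \<phi> (?b n)) + (?p n - ?q n) * (\<phi> (?b n) - \<phi> ?c)"
  have st: "?t sums (gauss_operator \<phi> x - gauss_operator \<phi> y)"
  proof -
    have "?t = (\<lambda>n. ?p n * \<phi> (?a n) - ?q n * \<phi> (?b n) - (?p n - ?q n) * \<phi> ?c)"
      by (auto simp: algebra_simps)
    then show ?thesis using sums_diff[OF sums_diff[OF sx sy] sc] by simp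
  qed
  \<comment> \<open>Upper bounds for the slopes of the inverse branches: 1 for the branch n = 0 and
    1 / 4 for all others.\<close>
  define w where "w n = (if n = 0 then 1 else 1 / 4 :: real)" for n :: nat
  \<comment> \<open>Bounds the change of the weights between x and y; the entry at n = 1 is zero
    because \<open>?b 1\<close> equals \<open>?c\<close>. For all other n the points
    \<open>?b n\<close> and \<open>?c\<close> are at distance at most 1 / 2, whence the factor
    \<open>L / 2\<close> below.\<close>
  define e where "e n = (if n = 0 then d / 4 else if n = 1 then 0 else ?q n - ?p n)" for n :: nat
  let ?B = "\<lambda>n. L * d * (?p n * w n) + L / 2 * e n"
  have tB: "norm (?t n) \<le> ?B n" for n
  proof -
    have pn: "?p n \<ge> 0" using gauss_weight_nonneg x by simp
    have abn: "\<bar>?a n - ?b n\<bar> \<le> d * w n"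
    proof -
      have pos: "x + real n + 1 > 0" "y + real n + 1 > 0" using x y by auto
      have "?a n - ?b n = d / ((x + real n + 1) * (y + real n + 1))"
        using pos by (simp add: d_def field_simps)
      also have "\<dots> \<le> d * w n"
      proof (cases "n = 0")
        case True
        have "1 * 1 \<le> (x + 1) * (y + 1)" using x y by (intro mult_mono) auto
        then have "d / ((x + 1) * (y + 1)) \<le> d / 1" using d by (intro divide_left_mono) auto
        then show ?thesis using True by (simp add: w_def)
      next
        case False
        then have "2 * 2 \<le> (x + real n + 1) * (y + real n + 1)" using x y by (intro mult_mono) auto
        then have "d / ((x + real n + 1) * (y + real n + 1)) \<le> d / 4" using d pos by (intro divide_left_mono) auto
        then show ?thesis using False by (simp add: w_def)
      qed
      finally have "?a n - ?b n \<le> d * w n" .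
      moreover have "?a n - ?b n \<ge> 0" using pos d by (simp add: d_def frac_le)
      ultimately show ?thesis by simp
    qed
    have "\<bar>\<phi> (?a n) - \<phi> (?b n)\<bar> \<le> L * \<bar>?a n - ?b n\<bar>"
      by (rule lip) (use gauss_point_bounds x y in blast)+
    also have "\<dots> \<le> L * (d * w n)" using abn \<open>L \<ge> 0\<close> by (rule mult_left_mono)
    finally have "?p n * \<bar>\<phi> (?a n) - \<phi> (?b n)\<bar> \<le> ?p n * (L * (d * w n))" using pn by (rule mult_left_mono)
    then have t1: "\<bar>?p n * (\<phi> (?a n) - \<phi> (?b n))\<bar> \<le> L * d * (?p n * w n)"
      using pn by (simp add: abs_mult mult_ac)
    have "\<bar>?p n - ?q n\<bar> * \<bar>?b n - ?c\<bar> \<le> 1 / 2 * e n"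
    proof -
      consider "n = 0" | "n = 1" | "n \<ge> 2" by linarith
      then show ?thesis
      proof cases
        case 1
        have "?p 0 = 1 / (x + 2)" "?q 0 = 1 / (y + 2)"
          using x y by (auto simp: gauss_weight_def add.commute)
        moreover have "1 / (x + 2) - 1 / (y + 2) = d / ((x + 2) * (y + 2))" using x y by (simp add: d_def field_simps)
        moreover have "d / ((x + 2) * (y + 2)) \<le> d / (2 * 2)"
          using x y d by (intro divide_left_mono mult_mono) auto
        moreover have "d / ((x + 2) * (y + 2)) \<ge> 0" using x y d by simp
        ultimately have "\<bar>?p 0 - ?q 0\<bar> \<le> d / 4" by linarith
        moreover have "\<bar>?b 0 - ?c\<bar> \<le> 1 / 2"
        proof -
          have "1 / (y + 1) - 1 / (y + 2) = 1 / ((y + 1) * (y + 2))" using y by (simp add: field_simps)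
          moreover have "1 / ((y + 1) * (y + 2)) \<le> 1 / (1 * 2)" using y by (intro divide_left_mono mult_mono) auto
          moreover have "1 / ((y + 1) * (y + 2)) \<ge> 0" using y by simp
          ultimately show ?thesis by simp
        qed
        ultimately have "\<bar>?p 0 - ?q 0\<bar> * \<bar>?b 0 - ?c\<bar> \<le> d / 4 * (1 / 2)" using d by (intro mult_mono) auto
        then show ?thesis using 1 by (simp add: e_def)
      next
        case 2
        then show ?thesis by (simp add: e_def add.commute)
      next
        case 3
        have m: "?p n \<le> ?q n" by (rule gauss_weight_mono) (use x y le 3 in auto)
        have "?b n \<le> ?c" using y 3 by (intro divide_left_mono) auto
        moreover have "?b n \<ge> 0" "?c \<le> 1 / 2" using y by (auto intro: divide_left_mono)
        ultimately have "\<bar>?b n - ?c\<bar> \<le> 1 / 2" by linarith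
        then have "\<bar>?p n - ?q n\<bar> * \<bar>?b n - ?c\<bar> \<le> \<bar>?p n - ?q n\<bar> * (1 / 2)" by (intro mult_left_mono) auto
        then show ?thesis using 3 m by (simp add: e_def)
      qed
    qed
    then have "L * (\<bar>?p n - ?q n\<bar> * \<bar>?b n - ?c\<bar>) \<le> L * (1 / 2 * e n)" using \<open>L \<ge> 0\<close> by (rule mult_left_mono)
    moreover have "\<bar>?p n - ?q n\<bar> * \<bar>\<phi> (?b n) - \<phi> ?c\<bar> \<le> \<bar>?p n - ?q n\<bar> * (L * \<bar>?b n - ?c\<bar>)"
    proof (rule mult_left_mono)
      show "\<bar>\<phi> (?b n) - \<phi> ?c\<bar> \<le> L * \<bar>?b n - ?c\<bar>"
      proof (rule lip)
        show "?c \<in> {0..1}" using y by simp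
      qed (use gauss_point_bounds y in blast)
    qed simp
    ultimately have t2: "\<bar>(?p n - ?q n) * (\<phi> (?b n) - \<phi> ?c)\<bar> \<le> L / 2 * e n"
      by (simp add: abs_mult mult_ac)
    show ?thesis using t1 t2 by simp
  qed
  have sw: "(\<lambda>n. ?p n * w n) sums (1 / 4 + 3 / 4 * ?p 0)"
  proof -
    have "(\<lambda>n. ?p n * (1 / 4) + (if n = 0 then 3 / 4 * ?p n else 0)) sums (1 * (1 / 4) + 3 / 4 * ?p 0)"
      by (intro sums_add sums_mult2 sp sums_single)
    moreover have "(\<lambda>n. ?p n * (1 / 4) + (if n = 0 then 3 / 4 * ?p n else 0)) = (\<lambda>n. ?p n * w n)"
      by (auto simp: w_def)
    ultimately show ?thesis by simp
  qed
  have se: "e sums (d / 4 + (?p 0 + ?p 1) - (?q 0 + ?q 1))"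
  proof -
    have "(\<lambda>n. (?q n - ?p n) + (if n = 0 then d / 4 + ?p n - ?q n else 0) + (if n = 1 then ?p n - ?q n else 0)) sums
      ((1 - 1) + (d / 4 + ?p 0 - ?q 0) + (?p 1 - ?q 1))"
      by (intro sums_add sums_diff sp sums_single)
    moreover have "(\<lambda>n. (?q n - ?p n) + (if n = 0 then d / 4 + ?p n - ?q n else 0) + (if n = 1 then ?p n - ?q n else 0)) = e"
      by (auto simp: e_def)
    ultimately show ?thesis by (simp add: algebra_simps)
  qed
  have sB: "?B sums (L * d * (1 / 4 + 3 / 4 * ?p 0) + L / 2 * (d / 4 + (?p 0 + ?p 1) - (?q 0 + ?q 1)))"
    by (intro sums_add sums_mult sw se)
  have "norm (gauss_operator \<phi> x - gauss_operator \<phi> y) \<le> suminf ?B"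
    unfolding sums_unique[OF st] by (rule norm_suminf_le[OF tB sums_summable[OF sB]])
  also have "suminf ?B = L * d * (1 / 4 + 3 / 4 * ?p 0) + L / 2 * (d / 4 + (?p 0 + ?p 1) - (?q 0 + ?q 1))"
    using sums_unique[OF sB] by simp
  \<comment> \<open>The first weight is at most 1 / 2, which gives 5 / 8. The first two weights add
    up to 2 / (x + 3), whose slope is at most 2 / 9 in size. Altogether 5 / 8 + 17 / 72 = 31 / 36,
    and 7 / 8 is a simpler number above it.\<close>
  also have "\<dots> \<le> L * d * (5 / 8) + L / 2 * (d / 4 + 2 / 9 * d)"
  proof (intro add_mono mult_left_mono)
    have "?p 0 = 1 / (x + 2)" using x by (simp add: gauss_weight_def add.commute)
    also have "\<dots> \<le> 1 / 2" using x by (intro divide_left_mono) auto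
    finally show "1 / 4 + 3 / 4 * ?p 0 \<le> 5 / 8" by simp
    have two: "gauss_weight 0 z + gauss_weight 1 z = 2 / (z + 3)" if "z \<ge> 0" for z
    proof -
      have "(1 + z) * (1 / ((z + 1) * (z + 2))) = 1 / (z + 2)"
      proof -
        have "z + 1 \<noteq> 0" using that by simp
        then show ?thesis by (simp add: add.commute[of 1 z])
      qed
      then have "gauss_weight 0 z + gauss_weight 1 z = 1 / (z + 2) + (1 + z) * (1 / ((z + 2) * (z + 3)))"
        by (simp add: gauss_weight_def add.assoc)
      also have "\<dots> = 2 / (z + 3)" using that by (simp add: divide_simps)
      finally show ?thesis .
    qed
    have "2 / (x + 3) - 2 / (y + 3) = 2 * d / ((x + 3) * (y + 3))" using x y by (simp add: d_def field_simps)
    also have "\<dots> \<le> 2 * d / (3 * 3)" using x y d by (intro divide_left_mono mult_mono) auto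
    finally show "d / 4 + (?p 0 + ?p 1) - (?q 0 + ?q 1) \<le> d / 4 + 2 / 9 * d"
      using two[OF x(1)] two[OF y(1)] by simp
  qed (use \<open>L \<ge> 0\<close> d in auto)
  also have "\<dots> = 31 / 36 * (L * d)" by (simp add: algebra_simps)
  also have "\<dots> \<le> 7 / 8 * (L * d)" using \<open>L \<ge> 0\<close> d by (intro mult_right_mono) auto
  also have "L * d = L * \<bar>x - y\<bar>" using le by (simp add: d_def)
  finally show ?case by (simp add: mult.assoc)
qed

text \<open>An indicator is approximated by that of an open superset of nearly the same measure,
  which is a limit of truncated multiples of the distance to the complement; sums and dominated
  limits then reach every integrable function.\<close>

lemma Lipschitz_dense:
  fixes k :: "real \<Rightarrow> real"
  assumes "integrable lborel k" "e > 0"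
  shows "\<exists>\<phi> L. (\<forall>x y. \<bar>\<phi> x - \<phi> y\<bar> \<le> L * \<bar>x - y\<bar>) \<and> L \<ge> 0 \<and> integrable lborel \<phi> \<and>
    (\<integral>x. \<bar>k x - \<phi> x\<bar> \<partial>lborel) < e"
  using assms
proof (induction k arbitrary: e rule: integrable_induct)
  case (base A c)
  then have A[measurable]: "A \<in> sets borel" by simp
  define e' where "e' = e / (2 * (\<bar>c\<bar> + 1))"
  have e': "e' > 0" "\<bar>c\<bar> * (2 * e') < e"
  proof -
    show "e' > 0" using base by (simp add: e'_def)
    then have "\<bar>c\<bar> * (2 * e') < (\<bar>c\<bar> + 1) * (2 * e')" by simp
    also have "\<dots> = e" by (simp add: e'_def field_simps)
    finally show "\<bar>c\<bar> * (2 * e') < e" .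
  qed
  obtain U where U: "open U" "A \<subseteq> U" "emeasure lborel (U - A) < ennreal e'"
    using outer_regular_lborel[OF A e'(1)] by auto
  have [measurable]: "U \<in> sets borel" using U by auto
  have "emeasure lborel U = emeasure lborel A + emeasure lborel (U - A)"
  proof -
    have "U = A \<union> (U - A)" using U by auto
    then show ?thesis using plus_emeasure[of A lborel "U - A"] by auto
  qed
  then have Ufin: "emeasure lborel U < \<infinity>"
    using base(2) less_trans[OF U(3) ennreal_less_top] by (simp add: ennreal_add_less_top)
  \<comment> \<open>The value of \<open>infdist\<close> for the empty set is 0 by convention, so the
    complement must be nonempty; it is, as \<open>U\<close> has finite measure.\<close>
  have UU: "- U \<noteq> {}"
  proof
    assume "- U = {}"
    then have "U = UNIV" by auto
    then show False using Ufin by simp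
  qed
  have iU: "integrable lborel (indicator U :: real \<Rightarrow> real)" using Ufin by (simp add: integrable_real_indicator)
  have iA: "integrable lborel (indicator A :: real \<Rightarrow> real)" using base(2) by (simp add: integrable_real_indicator)
  let ?f = "\<lambda>n x. min 1 (real n * infdist x (- U))"
  have lipf: "\<bar>?f n x - ?f n y\<bar> \<le> real n * \<bar>x - y\<bar>" for n x y
  proof -
    have "\<bar>infdist x (- U) - infdist y (- U)\<bar> \<le> \<bar>x - y\<bar>"
      using infdist_triangle_abs[of x "- U" y] by (simp add: dist_real_def)
    then have "real n * \<bar>infdist x (- U) - infdist y (- U)\<bar> \<le> real n * \<bar>x - y\<bar>" by (rule mult_left_mono) simp
    then have "\<bar>real n * infdist x (- U) - real n * infdist y (- U)\<bar> \<le> real n * \<bar>x - y\<bar>"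
      unfolding right_diff_distrib[symmetric] abs_mult by simp
    then show ?thesis by (auto simp: min_def abs_if split: if_splits)
  qed
  have fm[measurable]: "?f n \<in> borel_measurable borel" for n
    by (intro borel_measurable_continuous_onI continuous_intros)
  have f_le: "\<bar>?f n x\<bar> \<le> indicator U x" for n x
    using infdist_nonneg[of x "- U"] by (cases "x \<in> U") auto
  have lim: "(\<lambda>n. ?f n x) \<longlonglongrightarrow> indicator U x" for x
  proof (cases "x \<in> U")
    case False then show ?thesis by simp
  next
    case True
    then have "infdist x (- U) > 0"
      using in_closed_iff_infdist_zero[of "- U" x] U(1) UU infdist_nonneg[of x "- U"] by (metis ComplD closed_Compl le_neq_trans)
    then obtain N :: nat where N: "1 < real N * infdist x (- U)" using reals_Archimedean3 by blast
    have "eventually (\<lambda>n. ?f n x = 1) sequentially"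
      using eventually_ge_at_top[of N]
    proof eventually_elim
      case (elim n)
      then have "real N * infdist x (- U) \<le> real n * infdist x (- U)"
        using \<open>infdist x (- U) > 0\<close> by (intro mult_right_mono) auto
      then show ?case using N by simp
    qed
    then show ?thesis using True by (simp add: tendsto_eventually)
  qed
  have "(\<lambda>n. \<integral>x. \<bar>indicator U x - ?f n x\<bar> \<partial>lborel) \<longlonglongrightarrow> (\<integral>x. 0 \<partial>(lborel :: real measure))"
  proof (rule integral_dominated_convergence[where w = "\<lambda>x. indicator U x"])
    have "(\<lambda>n. \<bar>indicator U x - ?f n x\<bar>) \<longlonglongrightarrow> \<bar>indicator U x - indicator U x\<bar>" for x
      by (intro tendsto_intros lim)
    then show "AE x in lborel. (\<lambda>n. \<bar>indicator U x - ?f n x\<bar>) \<longlonglongrightarrow> 0" by simp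
    show "AE x in lborel. norm \<bar>indicator U x - ?f n x\<bar> \<le> indicator U x" for n
      using infdist_nonneg[of _ "- U"] by (intro AE_I2) (auto simp: indicator_def)
  qed (use iU in auto)
  then have "eventually (\<lambda>n. (\<integral>x. \<bar>indicator U x - ?f n x\<bar> \<partial>lborel) < e') sequentially"
    using e'(1) by (intro order_tendstoD(2)) auto
  then obtain n where n: "(\<integral>x. \<bar>indicator U x - ?f n x\<bar> \<partial>lborel) < e'"
    by (auto simp: eventually_at_top_linorder)
  have fi: "integrable lborel (?f n)"
    by (rule Bochner_Integration.integrable_bound[OF iU]) (use f_le in auto)
  have UA: "(\<integral>x. \<bar>indicator A x - indicator U x\<bar> \<partial>lborel) < e'"
  proof -
    have "(\<integral>x. \<bar>indicator A x - indicator U x\<bar> \<partial>lborel) = (\<integral>x. indicat_real (U - A) x \<partial>lborel)"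
      by (intro Bochner_Integration.integral_cong) (use U(2) in \<open>auto simp: indicator_def\<close>)
    also have "\<dots> = measure lborel (U - A)" by simp
    also have "\<dots> < e'"
    proof -
      have "emeasure lborel (U - A) = ennreal (measure lborel (U - A))"
        by (rule emeasure_eq_ennreal_measure) (use U(3) in \<open>auto simp: top_unique\<close>)
      then have "ennreal (measure lborel (U - A)) < ennreal e'" using U(3) by simp
      then show ?thesis by (subst (asm) ennreal_less_iff) auto
    qed
    finally show ?thesis .
  qed
  show ?case
  proof (intro exI[of _ "\<lambda>x. c * ?f n x"] exI[of _ "\<bar>c\<bar> * real n"] conjI allI)
    fix x y
    show "\<bar>c * ?f n x - c * ?f n y\<bar> \<le> \<bar>c\<bar> * real n * \<bar>x - y\<bar>"
      using mult_left_mono[OF lipf[of n x y], of "\<bar>c\<bar>"]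
      unfolding right_diff_distrib[symmetric] abs_mult by (simp add: mult.assoc)
  next
    show "integrable lborel (\<lambda>x. c * ?f n x)" using fi by simp
    have "(\<integral>x. \<bar>indicator A x *\<^sub>R c - c * ?f n x\<bar> \<partial>lborel) \<le>
      (\<integral>x. \<bar>c\<bar> * (\<bar>indicator A x - indicator U x\<bar> + \<bar>indicator U x - ?f n x\<bar>) \<partial>lborel)"
    proof (rule integral_mono)
      fix x
      have "\<bar>indicator A x - ?f n x\<bar> \<le> \<bar>indicator A x - indicator U x\<bar> + \<bar>indicator U x - ?f n x\<bar>" by linarith
      then have "\<bar>c\<bar> * \<bar>indicator A x - ?f n x\<bar> \<le> \<bar>c\<bar> * (\<bar>indicator A x - indicator U x\<bar> + \<bar>indicator U x - ?f n x\<bar>)"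
        by (rule mult_left_mono) simp
      moreover have "indicator A x *\<^sub>R c - c * ?f n x = c * (indicator A x - ?f n x)" by (simp add: algebra_simps)
      ultimately show "\<bar>indicator A x *\<^sub>R c - c * ?f n x\<bar> \<le> \<bar>c\<bar> * (\<bar>indicator A x - indicator U x\<bar> + \<bar>indicator U x - ?f n x\<bar>)"
        by (simp only: abs_mult)
    qed (use iA iU fi in auto)
    also have "\<dots> = \<bar>c\<bar> * ((\<integral>x. \<bar>indicator A x - indicator U x\<bar> \<partial>lborel) + (\<integral>x. \<bar>indicator U x - ?f n x\<bar> \<partial>lborel))"
      using iA iU fi by simp
    also have "\<dots> \<le> \<bar>c\<bar> * (2 * e')" using UA n by (intro mult_left_mono) auto
    finally show "(\<integral>x. \<bar>indicator A x *\<^sub>R c - c * ?f n x\<bar> \<partial>lborel) < e" using e'(2) by linarith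
  qed simp
next
  case (add f g)
  obtain \<phi>1 L1 where 1: "\<forall>x y. \<bar>\<phi>1 x - \<phi>1 y\<bar> \<le> L1 * \<bar>x - y\<bar>" "L1 \<ge> 0" "integrable lborel \<phi>1"
    "(\<integral>x. \<bar>f x - \<phi>1 x\<bar> \<partial>lborel) < e / 2" using add.IH(1)[of "e / 2"] add.prems by auto
  obtain \<phi>2 L2 where 2: "\<forall>x y. \<bar>\<phi>2 x - \<phi>2 y\<bar> \<le> L2 * \<bar>x - y\<bar>" "L2 \<ge> 0" "integrable lborel \<phi>2"
    "(\<integral>x. \<bar>g x - \<phi>2 x\<bar> \<partial>lborel) < e / 2" using add.IH(2)[of "e / 2"] add.prems by auto
  show ?case
  proof (intro exI[of _ "\<lambda>x. \<phi>1 x + \<phi>2 x"] exI[of _ "L1 + L2"] conjI allI)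
    show "\<bar>(\<phi>1 x + \<phi>2 x) - (\<phi>1 y + \<phi>2 y)\<bar> \<le> (L1 + L2) * \<bar>x - y\<bar>" for x y
      using 1(1)[rule_format, of x y] 2(1)[rule_format, of x y] unfolding distrib_right by linarith
    have "(\<integral>x. \<bar>f x + g x - (\<phi>1 x + \<phi>2 x)\<bar> \<partial>lborel) \<le> (\<integral>x. \<bar>f x - \<phi>1 x\<bar> + \<bar>g x - \<phi>2 x\<bar> \<partial>lborel)"
      by (rule integral_mono) (use add.hyps 1 2 in auto)
    also have "\<dots> = (\<integral>x. \<bar>f x - \<phi>1 x\<bar> \<partial>lborel) + (\<integral>x. \<bar>g x - \<phi>2 x\<bar> \<partial>lborel)"
      by (rule Bochner_Integration.integral_add) (use add.hyps 1 2 in auto)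
    finally show "(\<integral>x. \<bar>f x + g x - (\<phi>1 x + \<phi>2 x)\<bar> \<partial>lborel) < e" using 1(4) 2(4) by linarith
  qed (use 1 2 in auto)
next
  case (lim f s)
  have [measurable]: "f \<in> borel_measurable lborel" "s i \<in> borel_measurable lborel" for i
    using lim.hyps by auto
  have "(\<lambda>i. \<integral>x. \<bar>f x - s i x\<bar> \<partial>lborel) \<longlonglongrightarrow> (\<integral>x. 0 \<partial>(lborel :: real measure))"
  \<comment> \<open>The approximating sequence satisfies
    \<open>\<bar>s i x\<bar> \<le> 2 * \<bar>f x\<bar>\<close>, hence the factor 3.\<close>
  proof (rule integral_dominated_convergence[where w = "\<lambda>x. 3 * \<bar>f x\<bar>"])
    have "(\<lambda>i. \<bar>f x - s i x\<bar>) \<longlonglongrightarrow> \<bar>f x - f x\<bar>" for x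
      by (intro tendsto_intros lim.hyps(2)) auto
    then show "AE x in lborel. (\<lambda>i. \<bar>f x - s i x\<bar>) \<longlonglongrightarrow> 0" by simp
    show "AE x in lborel. norm \<bar>f x - s i x\<bar> \<le> 3 * \<bar>f x\<bar>" for i
    proof (rule AE_I2)
      fix x show "norm \<bar>f x - s i x\<bar> \<le> 3 * \<bar>f x\<bar>" using lim.hyps(3)[of x i] by simp
    qed
  qed (use lim.hyps in auto)
  then have "eventually (\<lambda>i. (\<integral>x. \<bar>f x - s i x\<bar> \<partial>lborel) < e / 2) sequentially"
    using lim.prems by (intro order_tendstoD(2)) auto
  then obtain i where i: "(\<integral>x. \<bar>f x - s i x\<bar> \<partial>lborel) < e / 2"
    by (auto simp: eventually_at_top_linorder)
  obtain \<phi> L where \<phi>: "\<forall>x y. \<bar>\<phi> x - \<phi> y\<bar> \<le> L * \<bar>x - y\<bar>" "L \<ge> 0" "integrable lborel \<phi>"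
    "(\<integral>x. \<bar>s i x - \<phi> x\<bar> \<partial>lborel) < e / 2" using lim.IH[of "e / 2" i] lim.prems by auto
  have "(\<integral>x. \<bar>f x - \<phi> x\<bar> \<partial>lborel) \<le> (\<integral>x. \<bar>f x - s i x\<bar> + \<bar>s i x - \<phi> x\<bar> \<partial>lborel)"
    by (rule integral_mono) (use lim.hyps \<phi> in auto)
  also have "\<dots> = (\<integral>x. \<bar>f x - s i x\<bar> \<partial>lborel) + (\<integral>x. \<bar>s i x - \<phi> x\<bar> \<partial>lborel)"
    by (rule Bochner_Integration.integral_add) (use lim.hyps \<phi> in auto)
  finally have "(\<integral>x. \<bar>f x - \<phi> x\<bar> \<partial>lborel) < e" using i \<phi>(4) by linarith
  with \<phi> show ?case by blast
qed

section \<open>Duality between the Gauss map and its normalized transfer operator\<close>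

lemma borel_measurable_gauss_operator[measurable]:
  assumes [measurable]: "\<phi> \<in> borel_measurable borel"
  shows "gauss_operator \<phi> \<in> borel_measurable borel"
  unfolding gauss_operator_def[abs_def] gauss_weight_def by measurable

lemma gauss_operator_nonneg:
  assumes "x \<ge> 0" "\<And>y. y \<in> {0..1} \<Longrightarrow> 0 \<le> \<phi> y" "\<And>y. y \<in> {0..1} \<Longrightarrow> \<phi> y \<le> C"
  shows "gauss_operator \<phi> x \<ge> 0"
  unfolding gauss_operator_def
proof (rule suminf_nonneg)
  show "summable (\<lambda>n. gauss_weight n x * \<phi> (1 / (x + real n + 1)))"
    by (rule gauss_operator_summable[OF assms(1), of _ C]) (use assms in auto)
  show "0 \<le> gauss_weight n x * \<phi> (1 / (x + real n + 1))" for n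
    by (intro mult_nonneg_nonneg gauss_weight_nonneg assms(1,2) gauss_point_bounds)
qed

lemma gauss_operator_1: "x \<ge> 0 \<Longrightarrow> gauss_operator (\<lambda>_. 1) x = 1"
  unfolding gauss_operator_def using sums_unique[OF gauss_weight_sums] by simp

text \<open>Composition with the Gauss map and \<open>gauss_operator\<close> are adjoint with
  respect to dx / (1 + x). The sign condition on \<phi> lets the proof run through nonnegative
  integrals, and the bound makes the operator series converge.\<close>

lemma gauss_duality:
  fixes \<phi> q :: "real \<Rightarrow> real"
  assumes [measurable]: "\<phi> \<in> borel_measurable borel" "q \<in> borel_measurable borel"
    and nn: "\<And>y. y \<in> {0..1} \<Longrightarrow> 0 \<le> \<phi> y" and C: "\<And>y. y \<in> {0..1} \<Longrightarrow> \<phi> y \<le> C"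
  shows "(\<integral>x. \<phi> x / (1 + x) * indicator {0<..1} x * q (frac (1 / x)) \<partial>lborel) =
    (\<integral>x. gauss_operator \<phi> x / (1 + x) * indicator {0..<1} x * q x \<partial>lborel)"
proof (rule integral_transfer)
  show "0 \<le> \<phi> x / (1 + x) * indicator {0<..1} x" for x
    using nn by (auto simp: indicator_def)
  show "0 \<le> gauss_operator \<phi> x / (1 + x) * indicator {0..<1} x" for x
    using gauss_operator_nonneg[of x \<phi> C] nn C by (auto simp: indicator_def)
  fix A :: "real set" assume [measurable]: "A \<in> sets borel"
  have "(\<integral>\<^sup>+x. ennreal (\<phi> x / (1 + x) * indicator {0<..1} x) * indicator A (frac (1 / x)) \<partial>lborel) =
    (\<integral>\<^sup>+x. ennreal (\<phi> x) * ennreal (1 / (1 + x)) * koopman 1 (indicator A) x \<partial>lborel)"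
  proof (rule nn_integral_cong)
    fix x :: real
    show "ennreal (\<phi> x / (1 + x) * indicator {0<..1} x) * indicator A (frac (1 / x)) =
      ennreal (\<phi> x) * ennreal (1 / (1 + x)) * koopman 1 (indicator A) x"
    proof (cases "x \<in> {0<..1}")
      case True
      then have "ennreal (\<phi> x / (1 + x)) = ennreal (\<phi> x) * ennreal (1 / (1 + x))"
        using nn[of x] by (subst ennreal_mult[symmetric]) auto
      then show ?thesis using True by (simp add: koopman_def)
    qed (auto simp: koopman_def)
  qed
  also have "\<dots> = (\<integral>\<^sup>+x. (\<Sum>n. ennreal (\<phi> (1 / (x + real n + 1))) * ennreal (1 / ((x + real n + 1) * (x + real n + 2))))
    * indicator A x * indicator {0..<1} x \<partial>lborel)"
    by (rule nn_integral_koopman) auto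
  also have "\<dots> = (\<integral>\<^sup>+x. ennreal (gauss_operator \<phi> x / (1 + x) * indicator {0..<1} x) * indicator A x \<partial>lborel)"
  proof (rule nn_integral_cong)
    fix x :: real
    show "(\<Sum>n. ennreal (\<phi> (1 / (x + real n + 1))) * ennreal (1 / ((x + real n + 1) * (x + real n + 2))))
        * indicator A x * indicator {0..<1} x =
      ennreal (gauss_operator \<phi> x / (1 + x) * indicator {0..<1} x) * indicator A x"
    proof (cases "x \<in> {0..<1}")
      case True
      then have x: "x \<ge> 0" by simp
      have eq: "ennreal (\<phi> (1 / (x + real n + 1))) * ennreal (1 / ((x + real n + 1) * (x + real n + 2))) =
        ennreal (gauss_weight n x * \<phi> (1 / (x + real n + 1)) / (1 + x))" for n
        using nn[OF gauss_point_bounds[OF x]] x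
        by (subst ennreal_mult[symmetric]) (auto simp: gauss_weight_def)
      have "(\<lambda>n. gauss_weight n x * \<phi> (1 / (x + real n + 1))) sums gauss_operator \<phi> x"
        unfolding gauss_operator_def
        by (rule summable_sums, rule gauss_operator_summable[OF x, of _ C]) (use nn C in auto)
      then have "(\<lambda>n. gauss_weight n x * \<phi> (1 / (x + real n + 1)) / (1 + x)) sums (gauss_operator \<phi> x / (1 + x))"
        by (rule sums_divide)
      then have "(\<Sum>n. ennreal (gauss_weight n x * \<phi> (1 / (x + real n + 1)) / (1 + x))) = ennreal (gauss_operator \<phi> x / (1 + x))"
        by (rule suminf_ennreal_eq[rotated])
          (intro divide_nonneg_nonneg mult_nonneg_nonneg gauss_weight_nonneg nn gauss_point_bounds x, use x in simp)
      then show ?thesis unfolding eq using True by simp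
    qed simp
  qed
  finally show "(\<integral>\<^sup>+x. ennreal (\<phi> x / (1 + x) * indicator {0<..1} x) * indicator A (frac (1 / x)) \<partial>lborel) =
    (\<integral>\<^sup>+x. ennreal (gauss_operator \<phi> x / (1 + x) * indicator {0..<1} x) * indicator A x \<partial>lborel)" .
qed measurable

lemma gauss_invariance:
  fixes q :: "real \<Rightarrow> real"
  assumes [measurable]: "q \<in> borel_measurable borel"
  shows "(\<integral>x. 1 / (1 + x) * indicator {0<..1} x * q (frac (1 / x)) \<partial>lborel) =
    (\<integral>x. 1 / (1 + x) * indicator {0..<1} x * q x \<partial>lborel)"
proof -
  have "(\<integral>x. 1 / (1 + x) * indicator {0<..1} x * q (frac (1 / x)) \<partial>lborel) =
    (\<integral>x. gauss_operator (\<lambda>_. 1) x / (1 + x) * indicator {0..<1} x * q x \<partial>lborel)"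
    by (rule gauss_duality[of "\<lambda>_. 1" q 1]) auto
  also have "\<dots> = (\<integral>x. 1 / (1 + x) * indicator {0..<1} x * q x \<partial>lborel)"
    by (intro Bochner_Integration.integral_cong) (auto simp: gauss_operator_1 indicator_def)
  finally show ?thesis .
qed

text \<open>Recognizes the tail of the critical density as the Gauss density carried to the ray by
  inversion.\<close>

lemma integral_inversion_tail:
  fixes q :: "real \<Rightarrow> real"
  assumes [measurable]: "q \<in> borel_measurable borel"
  shows "(\<integral>x. 1 / (x * (x + 1)) * indicator {1..} x * q (1 / x) \<partial>lborel) =
    (\<integral>x. 1 / (1 + x) * indicator {0<..1} x * q x \<partial>lborel)"
proof (rule integral_transfer)
  fix A :: "real set" assume [measurable]: "A \<in> sets borel"
  let ?F = "\<lambda>u. ennreal (1 / (1 + u) * indicator {0<..1} u) * indicator A u"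
  have "(\<integral>\<^sup>+x. ennreal (1 / (x * (x + 1)) * indicator {1..} x) * indicator A (1 / x) \<partial>lborel) =
    (\<integral>\<^sup>+x. ?F (1 / x) * ennreal (1 / x\<^sup>2) * indicator {0<..} x \<partial>lborel)"
  proof (rule nn_integral_cong)
    fix x :: real
    show "ennreal (1 / (x * (x + 1)) * indicator {1..} x) * indicator A (1 / x) =
      ?F (1 / x) * ennreal (1 / x\<^sup>2) * indicator {0<..} x"
    proof (cases "x \<ge> 1")
      case True
      have "1 / (x * (x + 1)) = 1 / (1 + 1 / x) * (1 / x\<^sup>2)"
        using True by (simp add: field_simps power2_eq_square)
      then have "ennreal (1 / (x * (x + 1))) = ennreal (1 / (1 + 1 / x)) * ennreal (1 / x\<^sup>2)"
        using True by (subst ennreal_mult[symmetric]) auto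
      then show ?thesis using True by (simp add: mult_ac)
    next
      case False
      then have "x \<le> 0 \<or> 1 / x > 1" by (cases "x \<le> 0") (auto simp: less_divide_eq)
      then show ?thesis using False by auto
    qed
  qed
  also have "\<dots> = (\<integral>\<^sup>+y. ?F y * indicator {0<..} y \<partial>lborel)"
    by (rule nn_integral_inversion) auto
  also have "\<dots> = (\<integral>\<^sup>+y. ?F y \<partial>lborel)"
    by (intro nn_integral_cong) (auto simp: indicator_def)
  finally show "(\<integral>\<^sup>+x. ennreal (1 / (x * (x + 1)) * indicator {1..} x) * indicator A (1 / x) \<partial>lborel) = (\<integral>\<^sup>+y. ?F y \<partial>lborel)" .
qed (auto simp: indicator_def)

section \<open>The critical profile and its periodizations\<close>

lemma integral_indicator_Ioc_Ico:
  fixes f :: "real \<Rightarrow> real"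
  assumes [measurable]: "f \<in> borel_measurable borel"
  shows "(\<integral>x. f x * indicator {0<..1} x \<partial>lborel) = (\<integral>x. f x * indicator {0..<1} x \<partial>lborel)"
proof (rule integral_cong_AE)
  have "AE x in lborel. x \<notin> {0, 1::real}" by (rule AE_notin_countable) simp
  then show "AE x in lborel. f x * indicator {0<..1} x = f x * indicator {0..<1} x"
    by eventually_elim (auto simp: indicator_def)
qed auto

text \<open>Four times \<open>critical_density\<close> in the variable \<alpha> t / 2, up to null
  sets: the Gauss density minus its image under inversion. The first interval is open at 0 so that
  the function vanishes on the whole nonpositive half-line.\<close>

definition critical_profile :: "real \<Rightarrow> real" where
  "critical_profile x = 1 / (1 + x) * indicator {0<..<1} x - 1 / (x * (x + 1)) * indicator {1..} x"

lemma borel_measurable_critical_profile[measurable]: "critical_profile \<in> borel_measurable borel"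
  unfolding critical_profile_def[abs_def] by measurable

lemma integrable_critical_profile_parts:
  "integrable lborel (\<lambda>x::real. 1 / (1 + x) * indicator {0..<1} x)"
  "integrable lborel (\<lambda>x::real. 1 / (x * (x + 1)) * indicator {1..} x)"
proof -
  have i: "integrable lborel (\<lambda>x::real. indicator {0..<1} x :: real)"
    by (simp add: integrable_real_indicator)
  show 1: "integrable lborel (\<lambda>x::real. 1 / (1 + x) * indicator {0..<1} x)"
    by (rule Bochner_Integration.integrable_bound[OF i]) (auto simp: indicator_def)
  show "integrable lborel (\<lambda>x::real. 1 / (x * (x + 1)) * indicator {1..} x)"
  proof (rule integrableI_nonneg)
    have "(\<integral>\<^sup>+x. ennreal (1 / (x * (x + 1)) * indicator {1::real..} x) \<partial>lborel) =
      (\<integral>\<^sup>+x. ennreal (1 / (x * (x + 1))) * indicator {1::real..} x \<partial>lborel)"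
      by (intro nn_integral_cong) (auto simp: indicator_def)
    also have "\<dots> = (\<integral>\<^sup>+x. (\<Sum>n. ennreal (1 / ((x + real n + 1) * (x + real n + 1 + 1)))) * indicator {0..<1} x \<partial>lborel)"
      by (rule nn_integral_fold) auto
    also have "\<dots> = (\<integral>\<^sup>+x. ennreal (1 / (1 + x) * indicator {0..<1::real} x) \<partial>lborel)"
    proof (rule nn_integral_cong)
      fix x :: real
      have two: "x + real n + 1 + 1 = x + real n + 2" for n by simp
      show "(\<Sum>n. ennreal (1 / ((x + real n + 1) * (x + real n + 1 + 1)))) * indicator {0..<1} x = ennreal (1 / (1 + x) * indicator {0..<1} x)"
      proof (cases "x \<in> {0..<1}")
        case True
        then have "x \<ge> 0" by simp
        show ?thesis unfolding two suminf_telescope_ennreal[OF \<open>x \<ge> 0\<close>] using True by simp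
      qed simp
    qed
    also have "\<dots> < \<infinity>"
      by (subst nn_integral_eq_integral[OF 1]) (auto simp: indicator_def)
    finally show "(\<integral>\<^sup>+x. ennreal (1 / (x * (x + 1)) * indicator {1::real..} x) \<partial>lborel) < \<infinity>" .
  qed (auto simp: indicator_def)
qed

lemma AE_critical_profile:
  "AE x in lborel. critical_profile x = 1 / (1 + x) * indicator {0..<1} x - 1 / (x * (x + 1)) * indicator {1..} x"
proof -
  have "AE x in lborel. x \<notin> {0::real}" by (rule AE_notin_countable) simp
  then show ?thesis by eventually_elim (auto simp: critical_profile_def indicator_def)
qed

lemma integrable_critical_profile: "integrable lborel critical_profile"
proof -
  have "integrable lborel (\<lambda>x. 1 / (1 + x) * indicator {0..<1} x - 1 / (x * (x + 1)) * indicator {1..} x :: real)"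
    by (intro Bochner_Integration.integrable_diff integrable_critical_profile_parts)
  then show ?thesis
    by (subst integrable_cong_AE[OF _ _ AE_critical_profile]) auto
qed

lemma critical_profile_integral:
  fixes q :: "real \<Rightarrow> real"
  assumes [measurable]: "q \<in> borel_measurable borel" and b: "\<And>x. \<bar>q x\<bar> \<le> B"
  shows "(\<integral>x. critical_profile x * q x \<partial>lborel) =
    (\<integral>x. 1 / (1 + x) * indicator {0..<1} x * q x \<partial>lborel) - (\<integral>x. 1 / (x * (x + 1)) * indicator {1..} x * q x \<partial>lborel)"
proof -
  have "(\<integral>x. critical_profile x * q x \<partial>lborel) =
    (\<integral>x. 1 / (1 + x) * indicator {0..<1} x * q x - 1 / (x * (x + 1)) * indicator {1..} x * q x \<partial>lborel)"
  proof (rule integral_cong_AE)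
    show "AE x in lborel. critical_profile x * q x =
      1 / (1 + x) * indicator {0..<1} x * q x - 1 / (x * (x + 1)) * indicator {1..} x * q x"
      using AE_critical_profile by eventually_elim (simp only: left_diff_distrib)
  qed measurable
  also have "\<dots> = (\<integral>x. 1 / (1 + x) * indicator {0..<1} x * q x \<partial>lborel) - (\<integral>x. 1 / (x * (x + 1)) * indicator {1..} x * q x \<partial>lborel)"
    by (intro Bochner_Integration.integral_diff integrable_mult_bounded_real[OF integrable_critical_profile_parts(1), of _ B]
      integrable_mult_bounded_real[OF integrable_critical_profile_parts(2), of _ B]) (use b in auto)
  finally show ?thesis .
qed

text \<open>Inversion exchanges the two parts of the profile. In the first condition the tail folds
  to the Gauss image of the Gauss density; in the second the part on (0, 1) does, and the tail
  inverts to the Gauss density itself. By invariance both parts give the same density, with opposite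
  signs.\<close>

lemma critical_profile_periodic:
  fixes q :: "real \<Rightarrow> real"
  assumes [measurable]: "q \<in> borel_measurable borel" and b: "\<And>x. \<bar>q x\<bar> \<le> B"
  shows "(\<integral>x. critical_profile x * q (frac x) \<partial>lborel) = 0"
    and "(\<integral>x. critical_profile x * q (frac (1 / x)) \<partial>lborel) = 0"
proof -
  let ?h = "\<lambda>x::real. 1 / (1 + x)"
  have h0: "(\<integral>x. ?h x * indicator {0..<1} x * q (frac x) \<partial>lborel) = (\<integral>x. ?h x * indicator {0..<1} x * q x \<partial>lborel)"
    by (intro Bochner_Integration.integral_cong) (auto simp: indicator_def frac_eq_self)
  have "(\<integral>x. 1 / (x * (x + 1)) * indicator {1..} x * q (frac x) \<partial>lborel) =
    (\<integral>x. 1 / (x * (x + 1)) * indicator {1..} x * q (frac (1 / (1 / x))) \<partial>lborel)" by simp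
  also have "\<dots> = (\<integral>x. ?h x * indicator {0<..1} x * q (frac (1 / x)) \<partial>lborel)"
    by (rule integral_inversion_tail[of "\<lambda>y. q (frac (1 / y))"]) measurable
  also have "\<dots> = (\<integral>x. ?h x * indicator {0..<1} x * q x \<partial>lborel)" by (rule gauss_invariance) measurable
  finally show "(\<integral>x. critical_profile x * q (frac x) \<partial>lborel) = 0"
    using h0 by (subst critical_profile_integral[of _ B]) (use b in auto)
  have "(\<integral>x. 1 / (x * (x + 1)) * indicator {1..} x * q (frac (1 / x)) \<partial>lborel) =
    (\<integral>x. ?h x * indicator {0<..1} x * q (frac x) \<partial>lborel)"
    by (rule integral_inversion_tail[of "\<lambda>y. q (frac y)"]) measurable
  also have "\<dots> = (\<integral>x. (?h x * q (frac x)) * indicator {0<..1} x \<partial>lborel)" by (simp add: mult_ac)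
  also have "\<dots> = (\<integral>x. (?h x * q (frac x)) * indicator {0..<1} x \<partial>lborel)" by (rule integral_indicator_Ioc_Ico) measurable
  also have "\<dots> = (\<integral>x. ?h x * indicator {0..<1} x * q (frac x) \<partial>lborel)" by (simp add: mult_ac)
  also note h0
  finally have e1: "(\<integral>x. 1 / (x * (x + 1)) * indicator {1..} x * q (frac (1 / x)) \<partial>lborel) = (\<integral>x. ?h x * indicator {0..<1} x * q x \<partial>lborel)" .
  have "(\<integral>x. ?h x * indicator {0..<1} x * q (frac (1 / x)) \<partial>lborel) = (\<integral>x. (?h x * q (frac (1 / x))) * indicator {0..<1} x \<partial>lborel)"
    by (simp add: mult_ac)
  also have "\<dots> = (\<integral>x. (?h x * q (frac (1 / x))) * indicator {0<..1} x \<partial>lborel)"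
    by (rule integral_indicator_Ioc_Ico[symmetric]) measurable
  also have "\<dots> = (\<integral>x. ?h x * indicator {0<..1} x * q (frac (1 / x)) \<partial>lborel)" by (simp add: mult_ac)
  also have "\<dots> = (\<integral>x. ?h x * indicator {0..<1} x * q x \<partial>lborel)" by (rule gauss_invariance) measurable
  finally show "(\<integral>x. critical_profile x * q (frac (1 / x)) \<partial>lborel) = 0"
    using e1 by (subst critical_profile_integral[of _ B]) (use b in auto)
qed

lemma cis_frac: "cis (2 * pi * of_int m * frac x) = cis (2 * pi * of_int m * x)"
proof -
  have "m * frac x - m * x = - of_int (m * \<lfloor>x\<rfloor>)" by (simp add: frac_def algebra_simps)
  then have "of_int m * frac x - of_int m * x \<in> \<int>" by simp
  then show ?thesis using cis_2pi_eq_iff[of "of_int m * frac x" "of_int m * x"] by (simp add: mult.assoc)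
qed

proposition critical_solution_critical_profile: "critical_solution 1 critical_profile"
  unfolding critical_solution_def
proof (intro conjI allI impI)
  show "integrable lborel critical_profile" by (rule integrable_critical_profile)
  show "critical_profile x = 0" if "x \<le> 0" for x
    using that by (simp add: critical_profile_def)
  fix m :: int
  have main: "(\<integral>x. critical_profile x *\<^sub>R cis (2 * pi * m * S x) \<partial>lborel) = 0"
    if S[measurable]: "S \<in> borel_measurable borel"
      and z: "\<And>q :: real \<Rightarrow> real. q \<in> borel_measurable borel \<Longrightarrow> (\<And>x. \<bar>q x\<bar> \<le> 1) \<Longrightarrow> (\<integral>x. critical_profile x * q (frac (S x)) \<partial>lborel) = 0"
    for S :: "real \<Rightarrow> real"
  proof -
    have int: "integrable lborel (\<lambda>x. critical_profile x *\<^sub>R cis (2 * pi * m * S x))"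
    proof (rule integrable_mult_bounded[OF integrable_critical_profile, where B = 1])
      have c: "(\<lambda>x. cis (2 * pi * m * x)) \<in> borel_measurable borel"
        by (intro borel_measurable_continuous_onI continuous_intros)
      show "(\<lambda>x. cis (2 * pi * m * S x)) \<in> borel_measurable lborel"
        using measurable_compose[OF S c] by simp
    qed simp
    have "(\<integral>x. critical_profile x * cos (2 * pi * m * frac (S x)) \<partial>lborel) = 0"
      by (rule z) auto
    moreover have "(\<integral>x. critical_profile x * sin (2 * pi * m * frac (S x)) \<partial>lborel) = 0"
      by (rule z) auto
    moreover have "cos (2 * pi * m * frac y) = cos (2 * pi * m * y)" "sin (2 * pi * m * frac y) = sin (2 * pi * m * y)" for y
      using cis_frac[of m y] by (auto simp: complex_eq_iff)
    ultimately show ?thesis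
      using integral_Re[OF int] integral_Im[OF int] by (intro complex_eqI) simp_all
  qed
  show "(\<integral>x. critical_profile x *\<^sub>R cis (2 * pi * m * x) \<partial>lborel) = 0"
    using main[of "\<lambda>x. x"] critical_profile_periodic(1)[of _ 1] by simp
  show "(\<integral>x. critical_profile x *\<^sub>R cis (2 * pi * m * (1 / x)) \<partial>lborel) = 0"
    using main[of "\<lambda>x. 1 / x"] critical_profile_periodic(2)[of _ 1] by simp
qed

text \<open>Exponential decay of correlations. By duality each application of
  \<open>koopman 1\<close> becomes one of \<open>gauss_operator\<close> to \<phi>, which gains a
  factor 7 / 8 in the Lipschitz constant. At the end the mean zero condition removes the constant
  \<open>\<phi> 0\<close>, leaving an oscillation of at most L.\<close>

lemma gauss_koopman_decay:
  fixes \<phi> \<psi> :: "real \<Rightarrow> real"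
  assumes \<phi>[measurable]: "\<phi> \<in> borel_measurable borel" and nn: "\<And>y. y \<in> {0..1} \<Longrightarrow> 0 \<le> \<phi> y"
    and lip: "\<And>x y. x \<in> {0..1} \<Longrightarrow> y \<in> {0..1} \<Longrightarrow> \<bar>\<phi> x - \<phi> y\<bar> \<le> L * \<bar>x - y\<bar>" and "L \<ge> 0"
    and \<psi>[measurable]: "\<psi> \<in> borel_measurable borel" and b: "\<And>x. \<bar>\<psi> x\<bar> \<le> B"
    and mean0: "(\<integral>x. 1 / (1 + x) * indicator {0..<1} x * \<psi> x \<partial>lborel) = 0"
  shows "\<bar>\<integral>x. \<phi> x / (1 + x) * indicator {0..<1} x * (koopman 1 ^^ n) \<psi> x \<partial>lborel\<bar> \<le> L * B * (7 / 8) ^ n"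
  using \<phi> nn lip \<open>L \<ge> 0\<close>
proof (induction n arbitrary: \<phi> L)
  case 0
  note [measurable] = 0(1)
  have "B \<ge> 0" using b[of 0] by simp
  have b0: "\<bar>\<phi> x - \<phi> 0\<bar> \<le> L" if "x \<in> {0..1}" for x
  proof -
    have "\<bar>\<phi> x - \<phi> 0\<bar> \<le> L * \<bar>x - 0\<bar>" by (rule 0) (use that in auto)
    also have "\<dots> \<le> L * 1" using that 0 by (intro mult_left_mono) auto
    finally show ?thesis by simp
  qed
  have i1: "integrable lborel (\<lambda>x::real. indicator {0..<1} x :: real)" by (simp add: integrable_real_indicator)
  have iL: "integrable lborel (\<lambda>x::real. L * B * indicator {0..<1} x :: real)" using i1 by simp
  have bnd: "\<bar>(\<phi> x - \<phi> 0) / (1 + x) * indicator {0..<1} x * \<psi> x\<bar> \<le> L * B * indicator {0..<1} x" for x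
  proof (cases "x \<in> {0..<1}")
    case True
    have "\<bar>(\<phi> x - \<phi> 0) / (1 + x)\<bar> \<le> L"
    proof -
      have "\<bar>\<phi> x - \<phi> 0\<bar> / (1 + x) \<le> L / 1" using b0[of x] True 0 by (intro frac_le) auto
      then show ?thesis using True by simp
    qed
    then have "\<bar>(\<phi> x - \<phi> 0) / (1 + x)\<bar> * \<bar>\<psi> x\<bar> \<le> L * B"
      using b[of x] 0 by (intro mult_mono) auto
    then show ?thesis using True by (simp add: abs_mult)
  qed simp
  have ib: "integrable lborel (\<lambda>x. (\<phi> x - \<phi> 0) / (1 + x) * indicator {0..<1} x * \<psi> x)"
  proof (rule Bochner_Integration.integrable_bound[OF iL])
    show "AE x in lborel. norm ((\<phi> x - \<phi> 0) / (1 + x) * indicator {0..<1} x * \<psi> x) \<le> norm (L * B * indicator {0..<1} x)"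
      unfolding real_norm_def by (intro AE_I2 order_trans[OF bnd abs_ge_self])
  qed measurable
  have ic: "integrable lborel (\<lambda>x. 1 / (1 + x) * indicator {0..<1} x * \<psi> x)"
    by (rule integrable_mult_bounded_real[OF integrable_critical_profile_parts(1), of _ B]) (use b in auto)
  have "(\<integral>x. \<phi> x / (1 + x) * indicator {0..<1} x * \<psi> x \<partial>lborel) =
    (\<integral>x. (\<phi> x - \<phi> 0) / (1 + x) * indicator {0..<1} x * \<psi> x + \<phi> 0 * (1 / (1 + x) * indicator {0..<1} x * \<psi> x) \<partial>lborel)"
    by (intro Bochner_Integration.integral_cong) (auto simp: diff_divide_distrib algebra_simps)
  also have "\<dots> = (\<integral>x. (\<phi> x - \<phi> 0) / (1 + x) * indicator {0..<1} x * \<psi> x \<partial>lborel)"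
    unfolding Bochner_Integration.integral_add[OF ib integrable_mult_right[OF ic]] integral_mult_right_zero mean0
    by simp
  finally have eq: "(\<integral>x. \<phi> x / (1 + x) * indicator {0..<1} x * \<psi> x \<partial>lborel) =
    (\<integral>x. (\<phi> x - \<phi> 0) / (1 + x) * indicator {0..<1} x * \<psi> x \<partial>lborel)" .
  have "\<bar>\<integral>x. (\<phi> x - \<phi> 0) / (1 + x) * indicator {0..<1} x * \<psi> x \<partial>lborel\<bar> \<le> (\<integral>x. \<bar>(\<phi> x - \<phi> 0) / (1 + x) * indicator {0..<1} x * \<psi> x\<bar> \<partial>lborel)"
    using integral_norm_bound[of lborel "\<lambda>x. (\<phi> x - \<phi> 0) / (1 + x) * indicator {0..<1} x * \<psi> x"]
    unfolding real_norm_def .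
  also have "\<dots> \<le> (\<integral>x. L * B * indicator {0..<1::real} x \<partial>lborel)"
  proof (rule integral_mono)
    show "integrable lborel (\<lambda>x. \<bar>(\<phi> x - \<phi> 0) / (1 + x) * indicator {0..<1} x * \<psi> x\<bar>)"
      by (rule integrable_abs[OF ib])
    show "integrable lborel (\<lambda>x::real. L * B * indicator {0..<1::real} x)" by (rule iL)
    show "\<bar>(\<phi> x - \<phi> 0) / (1 + x) * indicator {0..<1} x * \<psi> x\<bar> \<le> L * B * indicator {0..<1::real} x" for x
      by (rule bnd)
  qed
  also have "\<dots> = L * B" by simp
  finally show ?case using eq by simp
next
  case (Suc n)
  note [measurable] = Suc.prems(1)
  have km[measurable]: "(koopman 1 ^^ n) \<psi> \<in> borel_measurable borel" by (rule borel_measurable_koopman_funpow[OF \<psi>])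
  have C: "\<phi> y \<le> \<bar>\<phi> 0\<bar> + L" if "y \<in> {0..1}" for y
  proof -
    have "\<bar>\<phi> y - \<phi> 0\<bar> \<le> L * \<bar>y - 0\<bar>" by (rule Suc) (use that in auto)
    also have "\<dots> \<le> L * 1" using that Suc.prems by (intro mult_left_mono) auto
    finally show ?thesis by linarith
  qed
  let ?g = "(koopman 1 ^^ n) \<psi>"
  have "(\<integral>x. \<phi> x / (1 + x) * indicator {0..<1} x * (koopman 1 ^^ Suc n) \<psi> x \<partial>lborel) =
    (\<integral>x. (\<phi> x / (1 + x) * koopman 1 ?g x) * indicator {0..<1} x \<partial>lborel)" by (simp add: mult_ac)
  also have "\<dots> = (\<integral>x. (\<phi> x / (1 + x) * koopman 1 ?g x) * indicator {0<..1} x \<partial>lborel)"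
    by (rule integral_indicator_Ioc_Ico[symmetric]) measurable
  also have "\<dots> = (\<integral>x. \<phi> x / (1 + x) * indicator {0<..1} x * ?g (frac (1 / x)) \<partial>lborel)"
    by (intro Bochner_Integration.integral_cong) (auto simp: koopman_def indicator_def)
  also have "\<dots> = (\<integral>x. gauss_operator \<phi> x / (1 + x) * indicator {0..<1} x * ?g x \<partial>lborel)"
    by (rule gauss_duality[OF Suc.prems(1) km Suc.prems(2) C])
  finally have eq: "(\<integral>x. \<phi> x / (1 + x) * indicator {0..<1} x * (koopman 1 ^^ Suc n) \<psi> x \<partial>lborel) =
    (\<integral>x. gauss_operator \<phi> x / (1 + x) * indicator {0..<1} x * ?g x \<partial>lborel)" .
  have "\<bar>\<integral>x. gauss_operator \<phi> x / (1 + x) * indicator {0..<1} x * ?g x \<partial>lborel\<bar> \<le> (7 / 8 * L) * B * (7 / 8) ^ n"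
  proof (rule Suc.IH)
    show "gauss_operator \<phi> \<in> borel_measurable borel" by measurable
    show "0 \<le> gauss_operator \<phi> y" if "y \<in> {0..1}" for y
      by (rule gauss_operator_nonneg[OF _ Suc.prems(2) C]) (use that in auto)
    show "\<bar>gauss_operator \<phi> x - gauss_operator \<phi> y\<bar> \<le> 7 / 8 * L * \<bar>x - y\<bar>" if "x \<in> {0..1}" "y \<in> {0..1}" for x y
      by (rule gauss_operator_Lipschitz[OF Suc.prems(3,4) that])
  qed (use Suc.prems in auto)
  also have "\<dots> = L * B * (7 / 8) ^ Suc n" by simp
  finally show ?case unfolding eq .
qed

text \<open>The integral equals its value after 2 n applications of \<open>koopman 1\<close>. With
  respect to dx / (1 + x) the density is \<open>g\<close>, which is only integrable; a Lipschitz
  approximation makes the decay of correlations applicable at a small cost in the mean.\<close>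

lemma critical_solution_mean_zero:
  assumes k: "critical_solution 1 k"
    and \<psi>[measurable]: "\<psi> \<in> borel_measurable borel" and b: "\<And>x. \<bar>\<psi> x\<bar> \<le> B"
    and mean0: "(\<integral>x. 1 / (1 + x) * indicator {0..<1} x * \<psi> x \<partial>lborel) = 0"
  shows "(\<integral>x. k x * (\<psi> x * indicator {0..<1} x) \<partial>lborel) = 0"
proof -
  let ?I = "\<integral>x. k x * (\<psi> x * indicator {0..<1} x) \<partial>lborel"
  have ki: "integrable lborel k" using k by (auto simp: critical_solution_def)
  note [measurable] = borel_measurable_integrable[OF ki]
  have B: "B \<ge> 0" using b[of 0] by simp
  define g where "g x = k x * ((1 + x) * indicator {0..<1} x)" for x
  have gi: "integrable lborel g"
    unfolding g_def by (rule integrable_mult_bounded_real[OF ki, of _ 2]) (auto simp: indicator_def)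
  note [measurable] = borel_measurable_integrable[OF gi]
  have "\<bar>?I\<bar> \<le> 0 + e" if "e > 0" for e :: real
  proof -
    define e' where "e' = e / (2 * (B + 1))"
    have e': "e' > 0" "B * e' < e / 2"
    proof -
      show "e' > 0" using that B by (simp add: e'_def)
      then have "B * e' < (B + 1) * e'" by simp
      also have "\<dots> = e / 2" using B by (simp add: e'_def field_simps)
      finally show "B * e' < e / 2" .
    qed
    obtain \<phi> L where lip: "\<And>x y. \<bar>\<phi> x - \<phi> y\<bar> \<le> L * \<bar>x - y\<bar>" and L: "L \<ge> 0" and \<phi>i: "integrable lborel \<phi>"
      and approx: "(\<integral>x. \<bar>g x - \<phi> x\<bar> \<partial>lborel) < e'"
      using Lipschitz_dense[OF gi e'(1)] by auto
    note [measurable] = borel_measurable_integrable[OF \<phi>i]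
    \<comment> \<open>Shifts \<phi> to be nonnegative on [0, 1], as the decay estimate demands. The
      shift contributes nothing: for a constant the estimate holds with Lipschitz constant
      0.\<close>
    define C where "C = \<bar>\<phi> 0\<bar> + L"
    have \<phi>C: "\<phi> x + C \<ge> 0" if "x \<in> {0..1}" for x
    proof -
      have "\<bar>\<phi> x - \<phi> 0\<bar> \<le> L * \<bar>x - 0\<bar>" by (rule lip)
      also have "\<dots> \<le> L * 1" using that L by (intro mult_left_mono) auto
      finally show ?thesis by (simp add: C_def)
    qed
    have "C \<ge> 0" using L by (simp add: C_def)
    obtain n where n: "L * B * (7 / 8) ^ (2 * n) < e / 2"
    proof -
      \<comment> \<open>Invariance holds for even powers, hence the ratio (7 / 8)^2 = 49 /
        64.\<close>
      have "(\<lambda>n. L * B * (49 / 64) ^ n) \<longlonglongrightarrow> L * B * 0"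
        by (intro tendsto_mult tendsto_const LIMSEQ_power_zero) auto
      then have "eventually (\<lambda>n. L * B * (49 / 64) ^ n < e / 2) sequentially"
        using \<open>e > 0\<close> by (intro order_tendstoD(2)) auto
      then obtain n where "L * B * (49 / 64) ^ n < e / 2" by (auto simp: eventually_at_top_linorder)
      then show ?thesis by (intro that[of n]) (simp add: power_mult power2_eq_square)
    qed
    let ?K = "(koopman 1 ^^ (2 * n)) \<psi>"
    have [measurable]: "?K \<in> borel_measurable borel" by (rule borel_measurable_koopman_funpow[OF \<psi>])
    have bK: "\<bar>?K x\<bar> \<le> B" for x
      using abs_koopman_funpow_le[of \<psi> B, OF b, where \<gamma> = 1 and n = "2 * n" and x = x]
        mult_left_mono[OF koopman_funpow_1(2)[where \<gamma> = 1 and n = "2 * n" and x = x] B] by simp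
    let ?h = "\<lambda>x::real. 1 / (1 + x) * indicator {0..<1} x"
    have hK: "integrable lborel (\<lambda>x. ?h x * ?K x)"
      by (rule integrable_mult_bounded_real[OF integrable_critical_profile_parts(1) _ bK]) measurable
    have ig: "integrable lborel (\<lambda>x. (g x - \<phi> x) * (?h x * ?K x))"
    proof (rule integrable_mult_bounded_real[of _ _ _ B])
      show "integrable lborel (\<lambda>x. g x - \<phi> x)" using gi \<phi>i by simp
      show "\<bar>?h x * ?K x\<bar> \<le> B" for x
      proof (cases "x \<in> {0..<1}")
        case True
        have "1 / (1 + x) * \<bar>?K x\<bar> \<le> 1 * B" using True bK[of x] by (intro mult_mono) auto
        then show ?thesis using True by (simp add: abs_mult)
      qed (use B in simp)
    qed measurable
    have ip: "integrable lborel (\<lambda>x. (\<phi> x + C) / (1 + x) * indicator {0..<1} x * ?K x)"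
    proof (rule Bochner_Integration.integrable_bound)
      show "integrable lborel (\<lambda>x. (\<bar>\<phi> x\<bar> + C * indicator {0..<1} x) * B)"
        using \<phi>i by (intro integrable_mult_left Bochner_Integration.integrable_add integrable_mult_right integrable_abs) (auto simp: integrable_real_indicator)
      show "AE x in lborel. norm ((\<phi> x + C) / (1 + x) * indicator {0..<1} x * ?K x) \<le> norm ((\<bar>\<phi> x\<bar> + C * indicator {0..<1} x) * B)"
      proof (rule AE_I2)
        fix x :: real
        show "norm ((\<phi> x + C) / (1 + x) * indicator {0..<1} x * ?K x) \<le> norm ((\<bar>\<phi> x\<bar> + C * indicator {0..<1} x) * B)"
        proof (cases "x \<in> {0..<1}")
          case True
          have "\<bar>\<phi> x + C\<bar> / (1 + x) \<le> (\<bar>\<phi> x\<bar> + C) / 1"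
            using True \<open>C \<ge> 0\<close> by (intro frac_le) auto
          then have "\<bar>\<phi> x + C\<bar> / (1 + x) * \<bar>?K x\<bar> \<le> (\<bar>\<phi> x\<bar> + C) * B"
            using bK[of x] \<open>C \<ge> 0\<close> by (intro mult_mono) auto
          then show ?thesis using True \<open>C \<ge> 0\<close> B by (simp add: abs_mult)
        qed simp
      qed
    qed measurable
    have "?I = (\<integral>x. k x * (?K x * indicator {0..<1} x) \<partial>lborel)"
      by (rule critical_solution_koopman_funpow[OF k _ _ \<psi> b]) auto
    also have "\<dots> = (\<integral>x. (g x - \<phi> x) * (?h x * ?K x) + ((\<phi> x + C) / (1 + x) * indicator {0..<1} x * ?K x - C * (?h x * ?K x)) \<partial>lborel)"
    proof (rule Bochner_Integration.integral_cong[OF refl])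
      fix x :: real
      show "k x * (?K x * indicator {0..<1} x) =
        (g x - \<phi> x) * (?h x * ?K x) + ((\<phi> x + C) / (1 + x) * indicator {0..<1} x * ?K x - C * (?h x * ?K x))"
      proof (cases "x \<in> {0..<1}")
        case True
        then have "1 + x \<noteq> 0" by simp
        then have k_eq: "k x = g x * (1 / (1 + x))" using True by (simp add: g_def)
        define a where "a = 1 / (1 + x)"
        have "(\<phi> x + C) / (1 + x) = (\<phi> x + C) * a" by (simp add: a_def)
        moreover have "g x * a * ?K x = (g x - \<phi> x) * (a * ?K x) + ((\<phi> x + C) * a * ?K x - C * (a * ?K x))"
          by (simp add: algebra_simps)
        moreover have "indicator {0..<1} x = (1::real)" using True by simp
        ultimately show ?thesis unfolding k_eq a_def[symmetric] by (simp only: mult_1_right)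
      qed simp
    qed
    also have "\<dots> = (\<integral>x. (g x - \<phi> x) * (?h x * ?K x) \<partial>lborel) +
      ((\<integral>x. (\<phi> x + C) / (1 + x) * indicator {0..<1} x * ?K x \<partial>lborel) - C * (\<integral>x. ?h x * ?K x \<partial>lborel))"
      using ig ip hK by (simp only: Bochner_Integration.integral_add Bochner_Integration.integral_diff
        integrable_mult_right Bochner_Integration.integrable_diff integral_mult_right_zero)
    finally have I_eq: "?I = (\<integral>x. (g x - \<phi> x) * (?h x * ?K x) \<partial>lborel) +
      ((\<integral>x. (\<phi> x + C) / (1 + x) * indicator {0..<1} x * ?K x \<partial>lborel) - C * (\<integral>x. ?h x * ?K x \<partial>lborel))" .
    have "\<bar>\<integral>x. ?h x * ?K x \<partial>lborel\<bar> \<le> 0 * B * (7 / 8) ^ (2 * n)"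
      by (rule gauss_koopman_decay[of "\<lambda>_. 1", OF _ _ _ _ \<psi> b mean0]) auto
    then have 1: "(\<integral>x. ?h x * ?K x \<partial>lborel) = 0" by simp
    have 2: "\<bar>\<integral>x. (\<phi> x + C) / (1 + x) * indicator {0..<1} x * ?K x \<partial>lborel\<bar> \<le> L * B * (7 / 8) ^ (2 * n)"
      by (rule gauss_koopman_decay[OF _ _ _ L \<psi> b mean0]) (use \<phi>C lip in auto)
    have 3: "\<bar>\<integral>x. (g x - \<phi> x) * (?h x * ?K x) \<partial>lborel\<bar> \<le> B * e'"
    proof -
      have "\<bar>\<integral>x. (g x - \<phi> x) * (?h x * ?K x) \<partial>lborel\<bar> \<le> (\<integral>x. B * \<bar>g x - \<phi> x\<bar> \<partial>lborel)"
      proof -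
        have iB: "integrable lborel (\<lambda>x. B * \<bar>g x - \<phi> x\<bar>)" using gi \<phi>i by simp
        have "(\<integral>x. norm ((g x - \<phi> x) * (?h x * ?K x)) \<partial>lborel) \<le> (\<integral>x. B * \<bar>g x - \<phi> x\<bar> \<partial>lborel)"
        proof (rule integral_mono[OF integrable_norm[OF ig] iB])
          fix x :: real
          have "\<bar>?h x * ?K x\<bar> \<le> B"
          proof (cases "x \<in> {0..<1}")
            case True
            have "1 / (1 + x) * \<bar>?K x\<bar> \<le> 1 * B" using True bK[of x] by (intro mult_mono) auto
            then show ?thesis using True by (simp add: abs_mult)
          qed (use B in simp)
          from mult_left_mono[OF this, of "\<bar>g x - \<phi> x\<bar>"]
          show "norm ((g x - \<phi> x) * (?h x * ?K x)) \<le> B * \<bar>g x - \<phi> x\<bar>"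
            unfolding real_norm_def abs_mult[of "g x - \<phi> x"] by (simp only: mult.commute)
        qed
        then show ?thesis
          using integral_norm_bound[of lborel "\<lambda>x. (g x - \<phi> x) * (?h x * ?K x)"] by simp
      qed
      also have "\<dots> = B * (\<integral>x. \<bar>g x - \<phi> x\<bar> \<partial>lborel)" by simp
      also have "\<dots> \<le> B * e'" using approx B by (intro mult_left_mono) auto
      finally show ?thesis .
    qed
    show "\<bar>?I\<bar> \<le> 0 + e" using I_eq 1 2 3 n e'(2) by simp
  qed
  then have "\<bar>?I\<bar> \<le> 0" by (rule field_le_epsilon)
  then show ?thesis by simp
qed

text \<open>Every test function on [0, 1) is a constant plus one of mean zero, so the restriction of
  \<open>k\<close> to [0, 1) is a multiple of the Gauss density. Its mass fixes \<open>c\<close>,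
  and \<open>critical_solution_tail\<close> transports the same multiple to the ray.\<close>

proposition critical_solution_critical:
  assumes k: "critical_solution 1 k"
  shows "\<exists>c. AE x in lborel. k x = c * critical_profile x"
proof -
  have ki: "integrable lborel k" and k0: "\<And>x. x \<le> 0 \<Longrightarrow> k x = 0"
    using k by (auto simp: critical_solution_def)
  note [measurable] = borel_measurable_integrable[OF ki]
  let ?h = "\<lambda>x::real. 1 / (1 + x) * indicator {0..<1} x"
  let ?I = "\<lambda>\<psi>. \<integral>x. k x * (\<psi> x * indicator {0..<1} x) \<partial>lborel"
  define H where "H = (\<integral>x. ?h x \<partial>lborel)"
  define c where "c = ?I (\<lambda>_. 1) / H"
  have hi: "integrable lborel ?h" by (rule integrable_critical_profile_parts)
  have "(\<integral>x. 1 / 2 * indicator {0..<1::real} x \<partial>lborel) \<le> H"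
    unfolding H_def
  proof (rule integral_mono)
    show "integrable lborel (\<lambda>x::real. 1 / 2 * indicator {0..<1} x :: real)" by (simp add: integrable_real_indicator)
    show "1 / 2 * indicator {0..<1} x \<le> ?h x" for x :: real
      by (cases "x \<in> {0..<1}") (auto simp: field_simps)
  qed (rule hi)
  then have H: "H > 0" by simp
  have left: "?I \<psi> = c * (\<integral>x. ?h x * \<psi> x \<partial>lborel)"
    if \<psi>[measurable]: "\<psi> \<in> borel_measurable borel" and b: "\<And>x. \<bar>\<psi> x\<bar> \<le> B" for \<psi> B
  proof -
    \<comment> \<open>The mean of \<psi> in the Gauss probability measure, whose normalizing
      constant \<open>H\<close> is ln 2.\<close>
    define m where "m = (\<integral>x. ?h x * \<psi> x \<partial>lborel) / H"
    have i1: "integrable lborel (\<lambda>x. ?h x * \<psi> x)"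
      by (rule integrable_mult_bounded_real[OF hi _ b]) measurable
    have k1: "integrable lborel (\<lambda>x. k x * (\<psi> x * indicator {0..<1} x))"
      by (rule integrable_mult_bounded_real[OF ki, of _ B])
        (use b order_trans[OF abs_ge_zero b] in \<open>auto simp: indicator_def\<close>)
    have k2: "integrable lborel (\<lambda>x. k x * (1 * indicator {0..<1} x))"
      by (rule integrable_mult_bounded_real[OF ki, of _ 1]) (auto simp: indicator_def)
    have "?I (\<lambda>x. \<psi> x - m) = 0"
    proof (rule critical_solution_mean_zero[OF k])
      show "\<bar>\<psi> x - m\<bar> \<le> B + \<bar>m\<bar>" for x using b[of x] by linarith
      have "(\<integral>x. ?h x * (\<psi> x - m) \<partial>lborel) = (\<integral>x. ?h x * \<psi> x - m * ?h x \<partial>lborel)"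
        by (intro Bochner_Integration.integral_cong) (auto simp: algebra_simps diff_divide_distrib)
      also have "\<dots> = (\<integral>x. ?h x * \<psi> x \<partial>lborel) - m * H"
        unfolding Bochner_Integration.integral_diff[OF i1 integrable_mult_right[OF hi]] integral_mult_right_zero H_def ..
      also have "\<dots> = 0" using H by (simp add: m_def)
      finally show "(\<integral>x. ?h x * (\<psi> x - m) \<partial>lborel) = 0" .
    qed measurable
    moreover have "?I (\<lambda>x. \<psi> x - m) = (\<integral>x. k x * (\<psi> x * indicator {0..<1} x) - m * (k x * (1 * indicator {0..<1} x)) \<partial>lborel)"
      by (intro Bochner_Integration.integral_cong) (auto simp: algebra_simps)
    moreover have "\<dots> = ?I \<psi> - m * ?I (\<lambda>_. 1)"
      unfolding Bochner_Integration.integral_diff[OF k1 integrable_mult_right[OF k2]] integral_mult_right_zero ..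
    ultimately have "?I \<psi> = m * ?I (\<lambda>_. 1)" by simp
    then show ?thesis using H by (simp add: m_def c_def)
  qed
  have right: "(\<integral>x. k x * (\<psi> x * indicator {1..} x) \<partial>lborel) = - c * (\<integral>x. 1 / (x * (x + 1)) * indicator {1..} x * \<psi> x \<partial>lborel)"
    if \<psi>[measurable]: "\<psi> \<in> borel_measurable borel" and b: "\<And>x. \<bar>\<psi> x\<bar> \<le> 1" for \<psi>
  proof -
    define q where "q u = (if 0 < u \<and> u \<le> 1 then \<psi> (1 / u) else 0)" for u
    have qm[measurable]: "q \<in> borel_measurable borel" unfolding q_def by measurable
    have bq: "\<bar>koopman 1 q x\<bar> \<le> 1" for x by (rule abs_koopman_le) (use b in \<open>auto simp: q_def\<close>)
    have "(\<integral>x. k x * (\<psi> x * indicator {1..} x) \<partial>lborel) = - ?I (koopman 1 q)"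
      unfolding q_def by (rule critical_solution_tail[OF k _ _ \<psi> b]) auto
    also have "?I (koopman 1 q) = c * (\<integral>x. ?h x * koopman 1 q x \<partial>lborel)"
      by (rule left[OF borel_measurable_koopman[OF qm] bq])
    also have "(\<integral>x. ?h x * koopman 1 q x \<partial>lborel) = (\<integral>x. (1 / (1 + x) * koopman 1 q x) * indicator {0..<1} x \<partial>lborel)"
      by (simp add: mult_ac)
    also have "\<dots> = (\<integral>x. (1 / (1 + x) * koopman 1 q x) * indicator {0<..1} x \<partial>lborel)"
      by (rule integral_indicator_Ioc_Ico[symmetric]) measurable
    also have "\<dots> = (\<integral>x. 1 / (1 + x) * indicator {0<..1} x * q (frac (1 / x)) \<partial>lborel)"
      by (intro Bochner_Integration.integral_cong) (auto simp: koopman_def indicator_def)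
    also have "\<dots> = (\<integral>x. ?h x * q x \<partial>lborel)" by (rule gauss_invariance[OF qm])
    also have "\<dots> = (\<integral>x. (1 / (1 + x) * q x) * indicator {0..<1} x \<partial>lborel)" by (simp add: mult_ac)
    also have "\<dots> = (\<integral>x. (1 / (1 + x) * q x) * indicator {0<..1} x \<partial>lborel)"
      by (rule integral_indicator_Ioc_Ico[symmetric]) measurable
    also have "\<dots> = (\<integral>x. 1 / (1 + x) * indicator {0<..1} x * q x \<partial>lborel)" by (simp add: mult_ac)
    also have "\<dots> = (\<integral>x. 1 / (x * (x + 1)) * indicator {1..} x * q (1 / x) \<partial>lborel)"
      by (rule integral_inversion_tail[OF qm, symmetric])
    also have "\<dots> = (\<integral>x. 1 / (x * (x + 1)) * indicator {1..} x * \<psi> x \<partial>lborel)"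
      by (intro Bochner_Integration.integral_cong) (auto simp: q_def indicator_def)
    finally show ?thesis by simp
  qed
  have "AE x in lborel. k x - c * critical_profile x = 0"
  proof (rule AE_eq_0_if_integrals_0)
    have cpi: "integrable lborel (\<lambda>x. c * critical_profile x)" using integrable_critical_profile by simp
    show "integrable lborel (\<lambda>x. k x - c * critical_profile x)" using ki cpi by simp
    fix \<psi> :: "real \<Rightarrow> real" assume \<psi>[measurable]: "\<psi> \<in> borel_measurable borel" and b: "\<And>x. \<bar>\<psi> x\<bar> \<le> 1"
    have cp: "(\<integral>x. critical_profile x * \<psi> x \<partial>lborel) =
      (\<integral>x. ?h x * \<psi> x \<partial>lborel) - (\<integral>x. 1 / (x * (x + 1)) * indicator {1..} x * \<psi> x \<partial>lborel)"
      by (rule critical_profile_integral[OF \<psi> b])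
    have "(\<integral>x. k x * \<psi> x \<partial>lborel) = (\<integral>x. k x * (\<psi> x * indicator {0..<1} x) + k x * (\<psi> x * indicator {1..} x) \<partial>lborel)"
    proof (rule Bochner_Integration.integral_cong[OF refl])
      fix x
      show "k x * \<psi> x = k x * (\<psi> x * indicator {0..<1} x) + k x * (\<psi> x * indicator {1..} x)"
        using k0[of x] by (cases "x \<le> 0") (auto simp: indicator_def)
    qed
    also have "\<dots> = ?I \<psi> + (\<integral>x. k x * (\<psi> x * indicator {1..} x) \<partial>lborel)"
      by (intro Bochner_Integration.integral_add integrable_mult_bounded_real[OF ki, of _ 1])
        (use b in \<open>auto simp: indicator_def\<close>)
    also have "\<dots> = c * (\<integral>x. critical_profile x * \<psi> x \<partial>lborel)"
      unfolding left[OF \<psi> b] right[OF \<psi> b] cp by (simp add: right_diff_distrib)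
    finally have e: "(\<integral>x. k x * \<psi> x \<partial>lborel) = c * (\<integral>x. critical_profile x * \<psi> x \<partial>lborel)" .
    have "(\<integral>x. (k x - c * critical_profile x) * \<psi> x \<partial>lborel) = (\<integral>x. k x * \<psi> x - c * (critical_profile x * \<psi> x) \<partial>lborel)"
      by (simp add: left_diff_distrib mult.assoc)
    also have "\<dots> = (\<integral>x. k x * \<psi> x \<partial>lborel) - c * (\<integral>x. critical_profile x * \<psi> x \<partial>lborel)"
      using integrable_mult_bounded_real[OF ki, of \<psi> 1] integrable_mult_bounded_real[OF integrable_critical_profile, of \<psi> 1] b
      by (subst Bochner_Integration.integral_diff) auto
    finally show "(\<integral>x. (k x - c * critical_profile x) * \<psi> x \<partial>lborel) = 0" using e by simp
  qed
  then show ?thesis by (intro exI[of _ c]) simp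
qed

section \<open>The supercritical case\<close>

lemma DERIV_positive_part_square:
  "((\<lambda>x. (max 0 x)\<^sup>2) has_real_derivative 2 * max 0 x) (at (x::real))"
proof -
  consider "x > 0" | "x < 0" | "x = 0" by linarith
  then show ?thesis
  proof cases
    case 1
    show ?thesis
    proof (rule has_field_derivative_transform_within_open[where S = "{0<..}"])
      show "((\<lambda>x. x\<^sup>2) has_real_derivative 2 * max 0 x) (at x)"
        using 1 by (auto intro!: derivative_eq_intros)
    qed (use 1 in auto)
  next
    case 2
    show ?thesis
    proof (rule has_field_derivative_transform_within_open[where S = "{..<0}"])
      show "((\<lambda>x. 0) has_real_derivative 2 * max 0 x) (at x)" using 2 by simp
    qed (use 2 in auto)
  next
    case 3
    have "(\<lambda>h. (max 0 h)\<^sup>2 / h) \<midarrow>0\<rightarrow> (0::real)"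
    proof (rule Lim_null_comparison[where g = "\<lambda>h. \<bar>h\<bar>"])
      show "\<forall>\<^sub>F h in at 0. norm ((max 0 h)\<^sup>2 / h) \<le> \<bar>h :: real\<bar>"
      proof (rule always_eventually, rule allI)
        fix h :: real
        show "norm ((max 0 h)\<^sup>2 / h) \<le> \<bar>h\<bar>"
          by (cases "h \<le> 0") (auto simp: max_def power2_eq_square)
      qed
      show "((\<lambda>h::real. \<bar>h\<bar>) \<longlongrightarrow> 0) (at 0)" by (rule tendsto_rabs_zero) (rule tendsto_ident_at)
    qed
    then show ?thesis using 3 by (simp add: DERIV_def)
  qed
qed

text \<open>A quadratic spline with knots 0, 1 / 2 and 1. Its derivative is a tent of height 2,
  hence of area 1, so it climbs from 0 to 1.\<close>

definition smooth_step :: "real \<Rightarrow> real" where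
  "smooth_step x = 2 * ((max 0 x)\<^sup>2 - 2 * (max 0 (x - 1 / 2))\<^sup>2 + (max 0 (x - 1))\<^sup>2)"

definition smooth_step' :: "real \<Rightarrow> real" where
  "smooth_step' x = 4 * (max 0 x - 2 * max 0 (x - 1 / 2) + max 0 (x - 1))"

lemma DERIV_smooth_step: "(smooth_step has_real_derivative smooth_step' x) (at x)"
proof -
  have shift: "((\<lambda>x. (max 0 (x - c))\<^sup>2) has_real_derivative 2 * max 0 (x - c)) (at x)" for c
  proof -
    have "((\<lambda>x. x - c) has_real_derivative 1) (at x)" by (auto intro!: derivative_eq_intros)
    from DERIV_chain2[OF DERIV_positive_part_square this] show ?thesis by simp
  qed
  have "((\<lambda>x. 2 * ((max 0 x)\<^sup>2 - 2 * (max 0 (x - 1 / 2))\<^sup>2 + (max 0 (x - 1))\<^sup>2)) has_real_derivative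
      2 * (2 * max 0 x - 2 * (2 * max 0 (x - 1 / 2)) + 2 * max 0 (x - 1))) (at x)"
    by (intro DERIV_cmult DERIV_add DERIV_diff DERIV_positive_part_square shift)
  moreover have "2 * (2 * max 0 x - 2 * (2 * max 0 (x - 1 / 2)) + 2 * max 0 (x - 1)) = smooth_step' x"
    by (simp add: smooth_step'_def)
  ultimately show ?thesis unfolding smooth_step_def[abs_def] by (simp only:)
qed

lemma smooth_step_le_0: "x \<le> 0 \<Longrightarrow> smooth_step x = 0"
  by (simp add: smooth_step_def)

lemma smooth_step_ge_1: "x \<ge> 1 \<Longrightarrow> smooth_step x = 1"
  by (simp add: smooth_step_def power2_eq_square algebra_simps)

lemma mono_smooth_step:
  assumes "x \<le> y" shows "smooth_step x \<le> smooth_step y"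
  using assms
proof (rule DERIV_nonneg_imp_nondecreasing)
  fix z :: real
  show "\<exists>d. (smooth_step has_real_derivative d) (at z) \<and> 0 \<le> d"
    by (intro exI[of _ "smooth_step' z"] conjI DERIV_smooth_step) (auto simp: smooth_step'_def max_def)
qed

text \<open>The cutoff divides each point of the circle between its lifts x and x + 1. The condition
  (1 + b)^2 < \<gamma> makes inversion expanding where x \<le> 1 + b and places the inverted support
  to the right of the support. The bound a > 0 keeps away from the singularity, so that finitely
  many branches occur.\<close>

locale smooth_cutoff =
  fixes \<gamma> a b :: real and \<eta> \<eta>' :: "real \<Rightarrow> real"
  assumes a: "0 < a" and ab: "a < b" and b: "b < 1" and \<gamma>: "(1 + b)\<^sup>2 < \<gamma>"
    and \<eta>_deriv: "\<And>x. (\<eta> has_real_derivative \<eta>' x) (at x)"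
    and \<eta>'_cont: "continuous_on UNIV \<eta>'"
    and \<eta>_nonneg: "\<And>x. 0 \<le> \<eta> x"
    and \<eta>_zero: "\<And>x. x \<le> a \<or> 1 + b \<le> x \<Longrightarrow> \<eta> x = 0"
    and \<eta>_partition: "\<And>x. x \<in> {0..1} \<Longrightarrow> \<eta> x + \<eta> (x + 1) = 1"

lemma smooth_cutoff_exists:
  assumes "\<gamma> > 1"
  shows "\<exists>a b \<eta> \<eta>'. smooth_cutoff \<gamma> a b \<eta> \<eta>'"
proof -
  \<comment> \<open>Half of the available room, so that 1 + b stays below the square root of
    \<gamma>; the cap 1 / 2 keeps b below 1.\<close>
  define b where "b = min (1 / 2) ((sqrt \<gamma> - 1) / 2)"
  define a where "a = b / 2"
  have "sqrt \<gamma> > 1" using assms by simp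
  then have "0 < b" by (simp add: b_def)
  moreover have "b \<le> 1 / 2" unfolding b_def by (rule min.cobounded1)
  moreover have "b \<le> (sqrt \<gamma> - 1) / 2" unfolding b_def by (rule min.cobounded2)
  moreover from this have "1 + b < sqrt \<gamma>" using \<open>sqrt \<gamma> > 1\<close> by argo
  ultimately have b: "0 < b" "b < 1" "1 + b < sqrt \<gamma>" by auto
  then have ab: "0 < a" "a < b" by (auto simp: a_def)
  have "(1 + b)\<^sup>2 < (sqrt \<gamma>)\<^sup>2" using b by (intro power_strict_mono) auto
  then have g: "(1 + b)\<^sup>2 < \<gamma>" using assms by simp
  let ?T = "\<lambda>x. smooth_step ((x - a) / (b - a))"
  let ?T' = "\<lambda>x. smooth_step' ((x - a) / (b - a)) / (b - a)"
  have dT: "(?T has_real_derivative ?T' x) (at x)" for x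
  proof -
    have "((\<lambda>x. (x - a) / (b - a)) has_real_derivative 1 / (b - a)) (at x)"
      using ab by (auto intro!: derivative_eq_intros)
    from DERIV_chain2[OF DERIV_smooth_step this] show ?thesis by simp
  qed
  have T0: "?T x = 0" if "x \<le> a" for x
    using that ab by (intro smooth_step_le_0) (simp add: divide_le_0_iff)
  have T1: "?T x = 1" if "b \<le> x" for x
    using that ab by (intro smooth_step_ge_1) simp
  have Tm: "?T x \<le> ?T y" if "x \<le> y" for x y
    using that ab by (intro mono_smooth_step divide_right_mono) auto
  \<comment> \<open>With a step \<open>?T\<close> rising from 0 to 1 between a and b, the difference
    of two unit translates telescopes in the partition identity.\<close>
  have "smooth_cutoff \<gamma> a b (\<lambda>x. ?T x - ?T (x - 1)) (\<lambda>x. ?T' x - ?T' (x - 1))"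
  proof
    show "((\<lambda>x. ?T x - ?T (x - 1)) has_real_derivative ?T' x - ?T' (x - 1)) (at x)" for x
    proof (rule DERIV_diff[OF dT])
      show "((\<lambda>x. ?T (x - 1)) has_real_derivative ?T' (x - 1)) (at x)"
      proof -
        have "((\<lambda>x. x - 1) has_real_derivative 1) (at x)" by (auto intro!: derivative_eq_intros)
        from DERIV_chain2[OF dT this] show ?thesis by simp
      qed
    qed
    show "continuous_on UNIV (\<lambda>x. ?T' x - ?T' (x - 1))"
      unfolding smooth_step'_def using ab by (intro continuous_intros) auto
    show "0 \<le> ?T x - ?T (x - 1)" for x using Tm[of "x - 1" x] by simp
    show "?T x - ?T (x - 1) = 0" if "x \<le> a \<or> 1 + b \<le> x" for x
      using that
    proof
      assume "x \<le> a"
      then show ?thesis using T0[of x] T0[of "x - 1"] by simp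
    next
      assume "1 + b \<le> x"
      then show ?thesis using T1[of x] T1[of "x - 1"] by simp
    qed
    show "?T x - ?T (x - 1) + (?T (x + 1) - ?T (x + 1 - 1)) = 1" if "x \<in> {0..1}" for x
    proof -
      have "?T (x + 1) = 1" "?T (x - 1) = 0" using that b ab by (auto intro!: T1 T0)
      then show ?thesis by simp
    qed
  qed (use ab b g in auto)
  then show ?thesis by blast
qed

section \<open>Inversion of densities supported in the cutoff\<close>

context smooth_cutoff
begin

lemma \<gamma>_pos: "\<gamma> > 1"
proof -
  have "1\<^sup>2 < (1 + b)\<^sup>2" using a ab by (intro power_strict_mono) auto
  then show ?thesis using \<gamma> by simp
qed

text \<open>A nonnegative differentiable function has a minimum, hence zero derivative, wherever it
  vanishes; this includes the endpoints of the support.\<close>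

lemma \<eta>'_zero:
  assumes "x \<le> a \<or> 1 + b \<le> x" shows "\<eta>' x = 0"
  by (rule DERIV_local_min[OF \<eta>_deriv[of x], of 1]) (use \<eta>_zero[OF assms] \<eta>_nonneg in auto)

lemma \<eta>_cont: "continuous_on A \<eta>"
  by (rule DERIV_continuous_on) (rule has_field_derivative_at_within[OF \<eta>_deriv])

text \<open>Inversion carries a density of the form \<open>\<eta> t * u t\<close> to the density
  \<open>weight y * u (\<gamma> / y)\<close>.\<close>

definition weight :: "real \<Rightarrow> real" where
  "weight y = \<gamma> / y\<^sup>2 * \<eta> (\<gamma> / y)"

definition weight' :: "real \<Rightarrow> real" where
  "weight' y = - 2 * \<gamma> / y ^ 3 * \<eta> (\<gamma> / y) - \<gamma>\<^sup>2 / y ^ 4 * \<eta>' (\<gamma> / y)"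

lemma outside_support:
  assumes "y \<le> \<gamma> / (1 + b) \<or> \<gamma> / a \<le> y"
  shows "\<gamma> / y \<le> a \<or> 1 + b \<le> \<gamma> / y"
proof (cases "y > 0")
  case True
  then show ?thesis using assms a ab by (auto simp: field_simps)
next
  case False
  \<comment> \<open>This includes y = 0, where the quotient is 0 by convention.\<close>
  then have "\<gamma> / y \<le> 0" using \<gamma>_pos by (simp add: divide_le_0_iff)
  then show ?thesis using a by simp
qed

lemma weight_zero: "y \<le> \<gamma> / (1 + b) \<or> \<gamma> / a \<le> y \<Longrightarrow> weight y = 0"
  using \<eta>_zero[OF outside_support] by (simp add: weight_def)

lemma weight'_zero: "y \<le> \<gamma> / (1 + b) \<or> \<gamma> / a \<le> y \<Longrightarrow> weight' y = 0"
  using \<eta>_zero[OF outside_support] \<eta>'_zero[OF outside_support] by (simp add: weight'_def)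

lemma weight_nonneg: "0 \<le> weight y"
  using \<eta>_nonneg \<gamma>_pos by (simp add: weight_def)

lemma support_gt: "1 + b < \<gamma> / (1 + b)" "0 < \<gamma> / (1 + b)"
  using \<gamma> a ab \<gamma>_pos by (auto simp: power2_eq_square field_simps)

lemma support_point:
  assumes "weight y \<noteq> 0 \<or> weight' y \<noteq> 0"
  shows "0 < y" "\<gamma> / (1 + b) \<le> y" "\<gamma> / y \<in> {0..2}"
proof -
  have y: "\<gamma> / (1 + b) < y" "y < \<gamma> / a" using assms weight_zero[of y] weight'_zero[of y] by fastforce+
  then show "0 < y" "\<gamma> / (1 + b) \<le> y" using support_gt by auto
  then have "\<gamma> / y \<le> 1 + b" using y a ab by (simp add: field_simps)
  then show "\<gamma> / y \<in> {0..2}" using b \<open>0 < y\<close> \<gamma>_pos by simp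
qed

text \<open>The singularity of \<gamma> / y at 0 lies in the region where \<open>v\<close> vanishes,
  so continuity is glued from two overlapping open sets.\<close>

lemma continuous_compose_inversion:
  assumes v: "continuous_on UNIV v" "\<And>y. y \<le> \<gamma> / (1 + b) \<Longrightarrow> v y = 0" and u: "continuous_on UNIV u"
  shows "continuous_on UNIV (\<lambda>y. v y * u (\<gamma> / y) :: real)"
proof -
  have "continuous_on ({..<\<gamma> / (1 + b)} \<union> {0<..}) (\<lambda>y. v y * u (\<gamma> / y))"
  proof (rule continuous_on_open_Un)
    have "continuous_on {..<\<gamma> / (1 + b)} (\<lambda>y. 0 :: real)" by simp
    then show "continuous_on {..<\<gamma> / (1 + b)} (\<lambda>y. v y * u (\<gamma> / y))"
      by (rule continuous_on_eq) (use v(2) in simp)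
    show "continuous_on {0<..} (\<lambda>y. v y * u (\<gamma> / y))"
      by (intro continuous_intros continuous_on_subset[OF v(1)] continuous_on_compose2[OF u]) auto
  qed auto
  moreover have "{..<\<gamma> / (1 + b)} \<union> {0<..} = UNIV" using support_gt(2) by force
  ultimately show ?thesis by simp
qed

lemma weight'_cont: "continuous_on UNIV weight'"
proof -
  have "continuous_on ({..<\<gamma> / (1 + b)} \<union> {0<..}) weight'"
  proof (rule continuous_on_open_Un)
    have "continuous_on {..<\<gamma> / (1 + b)} (\<lambda>y. 0 :: real)" by simp
    then show "continuous_on {..<\<gamma> / (1 + b)} weight'"
      by (rule continuous_on_eq) (use weight'_zero in simp)
    show "continuous_on {0<..} weight'"
      unfolding weight'_def
      by (intro continuous_intros continuous_on_compose2[OF \<eta>_cont[of UNIV]] continuous_on_compose2[OF \<eta>'_cont]) auto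
  qed auto
  moreover have "{..<\<gamma> / (1 + b)} \<union> {0<..} = UNIV" using support_gt(2) by force
  ultimately show ?thesis by simp
qed

lemma weight_inversion_deriv:
  assumes u: "\<And>x. (u has_real_derivative v x) (at x)"
  shows "((\<lambda>y. weight y * u (\<gamma> / y)) has_real_derivative
    weight' y * u (\<gamma> / y) - weight y * v (\<gamma> / y) * (\<gamma> / y\<^sup>2)) (at y)"
proof (cases "y < \<gamma> / (1 + b)")
  case True
  have "((\<lambda>y. 0) has_real_derivative weight' y * u (\<gamma> / y) - weight y * v (\<gamma> / y) * (\<gamma> / y\<^sup>2)) (at y)"
    using True weight_zero[of y] weight'_zero[of y] by simp
  then show ?thesis
    by (rule has_field_derivative_transform_within_open[where S = "{..<\<gamma> / (1 + b)}"])
      (use True weight_zero in auto)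
next
  case False
  then have y: "y > 0" using support_gt by simp
  have inv: "((\<lambda>y. \<gamma> / y) has_real_derivative - \<gamma> / y\<^sup>2) (at y)"
    using y by (auto intro!: derivative_eq_intros simp: power2_eq_square)
  have d1: "((\<lambda>y. \<eta> (\<gamma> / y)) has_real_derivative \<eta>' (\<gamma> / y) * (- \<gamma> / y\<^sup>2)) (at y)"
    by (rule DERIV_chain2[OF \<eta>_deriv inv])
  have d2: "((\<lambda>y. u (\<gamma> / y)) has_real_derivative v (\<gamma> / y) * (- \<gamma> / y\<^sup>2)) (at y)"
    by (rule DERIV_chain2[OF u inv])
  have d3: "((\<lambda>y. \<gamma> / y\<^sup>2) has_real_derivative - 2 * \<gamma> / y ^ 3) (at y)"
    using y by (auto intro!: derivative_eq_intros simp: power2_eq_square power3_eq_cube mult_ac)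
  have dw: "(weight has_real_derivative weight' y) (at y)"
  proof -
    have "((\<lambda>y. \<gamma> / y\<^sup>2 * \<eta> (\<gamma> / y)) has_real_derivative
      (- 2 * \<gamma> / y ^ 3) * \<eta> (\<gamma> / y) + (\<eta>' (\<gamma> / y) * (- \<gamma> / y\<^sup>2)) * (\<gamma> / y\<^sup>2)) (at y)"
      by (rule DERIV_mult[OF d3 d1])
    also have "(- 2 * \<gamma> / y ^ 3) * \<eta> (\<gamma> / y) + (\<eta>' (\<gamma> / y) * (- \<gamma> / y\<^sup>2)) * (\<gamma> / y\<^sup>2) = weight' y"
      by (simp add: weight'_def power2_eq_square power4_eq_xxxx mult_ac)
    finally show ?thesis unfolding weight_def[abs_def] .
  qed
  show ?thesis
    using DERIV_mult[OF dw d2] by (simp add: mult_ac)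
qed

lemma weight_cont: "continuous_on UNIV weight"
  using DERIV_continuous_on[OF has_field_derivative_at_within[OF weight_inversion_deriv[of "\<lambda>_. 1" "\<lambda>_. 0"]]]
  by simp

text \<open>For x \<ge> 0, translates x + j with j at least this number lie beyond \<gamma> / a,
  outside the support of \<open>weight\<close>.\<close>

definition branches :: nat where "branches = nat \<lceil>\<gamma> / a\<rceil>"

lemma branches: "\<gamma> / a \<le> real branches" unfolding branches_def by linarith

lemma integral_fold:
  fixes g :: "real \<Rightarrow> real"
  assumes g: "continuous_on UNIV g"
  shows "integral {0..1} (\<lambda>x. \<Sum>j\<le>n. g (x + real j)) = integral {0..real n + 1} g"
proof (induction n)
  case (Suc n)
  have ig: "g integrable_on {c..d}" for c d
    by (rule integrable_continuous_interval[OF continuous_on_subset[OF g]]) simp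
  have cj: "continuous_on A (\<lambda>x. g (x + c))" for A c
    by (intro continuous_on_compose2[OF g] continuous_intros) auto
  have "integral {0..1} (\<lambda>x. \<Sum>j\<le>Suc n. g (x + real j)) =
    integral {0..1} (\<lambda>x. (\<Sum>j\<le>n. g (x + real j)) + g (x + real (Suc n)))" by simp
  also have "\<dots> = integral {0..1} (\<lambda>x. \<Sum>j\<le>n. g (x + real j)) + integral {0..1} (\<lambda>x. g (x + real (Suc n)))"
    by (rule Henstock_Kurzweil_Integration.integral_add)
      (intro integrable_continuous_interval continuous_intros cj)+
  also have "integral {0..1} (\<lambda>x. g (x + real (Suc n))) = integral {real (Suc n)..real (Suc n) + 1} g"
    using integral_shift_real_ivl[of "real (Suc n)" "real (Suc n)" "real (Suc n) + 1" g] by simp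
  also have "integral {0..1} (\<lambda>x. \<Sum>j\<le>n. g (x + real j)) + \<dots> = integral {0..real (Suc n) + 1} g"
    unfolding Suc using Henstock_Kurzweil_Integration.integral_combine[of 0 "real n + 1" "real (Suc n) + 1" g] ig
    by (simp add: add.commute)
  finally show ?case .
qed simp

text \<open>Both sides see only the support of \<open>g\<close>: it lies between \<gamma> / (1 + b)
  and \<gamma> / a, and \<gamma> / 2 is below the former because b < 1.\<close>

lemma integral_inversion:
  fixes g :: "real \<Rightarrow> real"
  assumes g: "continuous_on UNIV g"
    and z: "\<And>y. y \<le> \<gamma> / (1 + b) \<or> \<gamma> / a \<le> y \<Longrightarrow> g y = 0"
  shows "integral {0..real branches + 1} g = integral {a..2} (\<lambda>t. g (\<gamma> / t) * (\<gamma> / t\<^sup>2))"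
proof -
  have ig: "g integrable_on {c..d}" for c d
    by (rule integrable_continuous_interval[OF continuous_on_subset[OF g]]) simp
  have le1: "0 \<le> \<gamma> / 2" "\<gamma> / a \<le> real branches + 1" using \<gamma>_pos branches by simp_all
  have le2: "\<gamma> / 2 \<le> \<gamma> / a" using \<gamma>_pos a ab b by (intro divide_left_mono) auto
  have le3: "\<gamma> / 2 \<le> \<gamma> / (1 + b)" using \<gamma>_pos a ab b by (intro divide_left_mono) auto
  have le4: "\<gamma> / 2 \<le> real branches + 1" using le1 le2 by linarith
  note le = le1 le2 le3 le4
  have z0: "integral {c..d} g = 0" if "\<And>y. y \<in> {c..d} \<Longrightarrow> g y = 0" for c d
    using that by (subst integral_cong[of _ _ "\<lambda>_. 0"]) auto
  have "integral {0..real branches + 1} g = integral {0..\<gamma> / 2} g + integral {\<gamma> / 2..real branches + 1} g"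
    using le by (intro Henstock_Kurzweil_Integration.integral_combine[symmetric] ig) auto
  also have "integral {\<gamma> / 2..real branches + 1} g = integral {\<gamma> / 2..\<gamma> / a} g + integral {\<gamma> / a..real branches + 1} g"
    using le by (intro Henstock_Kurzweil_Integration.integral_combine[symmetric] ig) auto
  also have "integral {0..\<gamma> / 2} g = 0"
  proof (rule z0)
    fix y assume "y \<in> {0..\<gamma> / 2}"
    then have "y \<le> \<gamma> / (1 + b)" using le3 by (meson atLeastAtMost_iff order_trans)
    then show "g y = 0" using z by blast
  qed
  also have "integral {\<gamma> / a..real branches + 1} g = 0" by (rule z0) (use z in auto)
  finally have e: "integral {0..real branches + 1} g = integral {\<gamma> / 2..\<gamma> / a} g" by simp
  have "((\<lambda>t. (- \<gamma> / t\<^sup>2) *\<^sub>R g (\<gamma> / t)) has_integral (integral {\<gamma> / a..\<gamma> / 2} g - integral {\<gamma> / 2..\<gamma> / a} g)) {a..2}"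
  proof (rule has_integral_substitution_general[of "{}"])
    show "a \<le> 2" using ab b by simp
    show "(\<lambda>t. \<gamma> / t) ` {a..2} \<subseteq> {\<gamma> / 2..\<gamma> / a}"
    proof clarify
      fix t assume t: "t \<in> {a..2}"
      have "\<gamma> / 2 \<le> \<gamma> / t" "\<gamma> / t \<le> \<gamma> / a" using t a \<gamma>_pos by (intro divide_left_mono; auto)+
      then show "\<gamma> / t \<in> {\<gamma> / 2..\<gamma> / a}" unfolding atLeastAtMost_iff by (rule conjI)
    qed
    show "continuous_on {\<gamma> / 2..\<gamma> / a} g" by (rule continuous_on_subset[OF g]) simp
    show "continuous_on {a..2} (\<lambda>t. \<gamma> / t)" using a by (intro continuous_intros) auto
    show "((\<lambda>t. \<gamma> / t) has_real_derivative - \<gamma> / t\<^sup>2) (at t within {a..2})" if "t \<in> {a..2} - {}" for t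
      using that a by (auto intro!: derivative_eq_intros simp: power2_eq_square)
  qed simp
  \<comment> \<open>The substitution is decreasing, so the rule yields a difference of two oriented
    integrals, one of which runs over an empty interval.\<close>
  moreover have "integral {\<gamma> / a..\<gamma> / 2} g = 0"
  proof -
    have "\<gamma> / 2 < \<gamma> / a" using a ab b \<gamma>_pos by (intro divide_strict_left_mono) auto
    then show ?thesis by simp
  qed
  ultimately have "((\<lambda>t. (- \<gamma> / t\<^sup>2) *\<^sub>R g (\<gamma> / t)) has_integral (- integral {\<gamma> / 2..\<gamma> / a} g)) {a..2}" by simp
  from has_integral_neg[OF this]
  have "((\<lambda>t. g (\<gamma> / t) * (\<gamma> / t\<^sup>2)) has_integral integral {\<gamma> / 2..\<gamma> / a} g) {a..2}"
    by (simp add: mult.commute)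
  then show ?thesis using e by (simp add: integral_unique)
qed

text \<open>Periodicity folds [1, 2] onto [0, 1], where \<eta> x + \<eta> (x + 1) = 1. The second
  claim enlarges [a, 2] to two full periods; its alternative sets aside functions with a negative
  value, whose integral need not grow with the interval.\<close>

lemma integral_cutoff:
  fixes u :: "real \<Rightarrow> real"
  assumes u: "continuous_on {0..2} u" and per: "\<And>x. x \<in> {0..1} \<Longrightarrow> u (x + 1) = u x"
  shows "integral {a..2} (\<lambda>t. \<eta> t * u t) = integral {0..1} u"
    and "integral {a..2} u \<le> 2 * integral {0..1} u \<or> (\<exists>x\<in>{0..2}. u x < 0)"
proof -
  have cu: "continuous_on A u" if "A \<subseteq> {0..2}" for A by (rule continuous_on_subset[OF u that])
  have iu: "u integrable_on {c..d}" if "{c..d} \<subseteq> {0..2}" for c d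
    by (rule integrable_continuous_interval[OF cu[OF that]])
  have i\<eta>: "(\<lambda>t. \<eta> t * u t) integrable_on {c..d}" if "{c..d} \<subseteq> {0..2}" for c d
    by (intro integrable_continuous_interval continuous_intros \<eta>_cont cu that)
  have shift: "integral {1..2} v = integral {0..1} (\<lambda>x. v (x + 1))" for v :: "real \<Rightarrow> real"
    using integral_shift_real_ivl[of 1 1 2 v] by simp
  have "integral {0..a} (\<lambda>t. \<eta> t * u t) = integral {0..a} (\<lambda>_. 0)"
    by (rule Henstock_Kurzweil_Integration.integral_cong) (use \<eta>_zero in auto)
  then have "integral {a..2} (\<lambda>t. \<eta> t * u t) = integral {0..a} (\<lambda>t. \<eta> t * u t) + integral {a..2} (\<lambda>t. \<eta> t * u t)" by simp
  also have "\<dots> = integral {0..2} (\<lambda>t. \<eta> t * u t)"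
    by (rule Henstock_Kurzweil_Integration.integral_combine) (use a ab b i\<eta> in auto)
  also have "\<dots> = integral {0..1} (\<lambda>t. \<eta> t * u t) + integral {1..2} (\<lambda>t. \<eta> t * u t)"
    by (rule Henstock_Kurzweil_Integration.integral_combine[symmetric]) (use i\<eta> in auto)
  also have "integral {1..2} (\<lambda>t. \<eta> t * u t) = integral {0..1} (\<lambda>t. \<eta> (t + 1) * u t)"
    unfolding shift by (rule Henstock_Kurzweil_Integration.integral_cong) (use per in simp)
  also have "integral {0..1} (\<lambda>t. \<eta> t * u t) + \<dots> = integral {0..1} (\<lambda>t. \<eta> t * u t + \<eta> (t + 1) * u t)"
    by (rule Henstock_Kurzweil_Integration.integral_add[symmetric])
      (intro integrable_continuous_interval continuous_intros \<eta>_cont cu continuous_on_compose2[OF \<eta>_cont[of UNIV]]; auto)+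
  also have "\<dots> = integral {0..1} u"
  proof (rule Henstock_Kurzweil_Integration.integral_cong)
    fix x :: real assume "x \<in> {0..1}"
    then have "(\<eta> x + \<eta> (x + 1)) * u x = u x" using \<eta>_partition by simp
    then show "\<eta> x * u x + \<eta> (x + 1) * u x = u x" by (simp only: distrib_right)
  qed
  finally show "integral {a..2} (\<lambda>t. \<eta> t * u t) = integral {0..1} u" .
  show "integral {a..2} u \<le> 2 * integral {0..1} u \<or> (\<exists>x\<in>{0..2}. u x < 0)"
  proof (rule disjCI)
    assume "\<not> (\<exists>x\<in>{0..2}. u x < 0)"
    then have nn: "0 \<le> u x" if "x \<in> {0..2}" for x using that by (meson linorder_not_less)
    have "0 \<le> integral {0..a} u"
      by (rule integral_nonneg) (use iu nn ab b in auto)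
    then have "integral {a..2} u \<le> integral {0..a} u + integral {a..2} u" by simp
    also have "\<dots> = integral {0..2} u"
      by (rule Henstock_Kurzweil_Integration.integral_combine) (use a ab b iu in auto)
    also have "\<dots> = integral {0..1} u + integral {1..2} u"
      by (rule Henstock_Kurzweil_Integration.integral_combine[symmetric]) (use iu in auto)
    also have "integral {1..2} u = integral {0..1} u"
      unfolding shift by (rule Henstock_Kurzweil_Integration.integral_cong) (use per in simp)
    finally show "integral {a..2} u \<le> 2 * integral {0..1} u" by simp
  qed
qed

text \<open>Density operator of the random map that moves a point of the circle to one of its lifts
  t in [0, 2], chosen with probability \<open>\<eta> t\<close>, and then to \<gamma> / t modulo
  1.\<close>

definition transfer :: "(real \<Rightarrow> real) \<Rightarrow> real \<Rightarrow> real" where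
  "transfer u x = (\<Sum>j\<le>branches. weight (x + real j) * u (\<gamma> / (x + real j)))"

text \<open>The derivative of \<open>transfer u\<close> for u with derivative v. With v as a
  separate argument, the derivatives of the iterates obey a primitive recursion.\<close>

definition transfer' :: "(real \<Rightarrow> real) \<Rightarrow> (real \<Rightarrow> real) \<Rightarrow> real \<Rightarrow> real" where
  "transfer' u v x = (\<Sum>j\<le>branches. weight' (x + real j) * u (\<gamma> / (x + real j))
     - weight (x + real j) * v (\<gamma> / (x + real j)) * (\<gamma> / (x + real j)\<^sup>2))"

section \<open>Iterated densities and conservation of mass\<close>

primrec iterate :: "nat \<Rightarrow> real \<Rightarrow> real" where
  "iterate 0 = (\<lambda>_. 1)" | "iterate (Suc n) = transfer (iterate n)"

primrec iterate' :: "nat \<Rightarrow> real \<Rightarrow> real" where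
  "iterate' 0 = (\<lambda>_. 0)" | "iterate' (Suc n) = transfer' (iterate n) (iterate' n)"

lemma iterate_has_derivative: "(iterate n has_real_derivative iterate' n x) (at x)"
proof (induction n arbitrary: x)
  case (Suc n)
  have "((\<lambda>x. weight (x + real j) * iterate n (\<gamma> / (x + real j))) has_real_derivative
    weight' (x + real j) * iterate n (\<gamma> / (x + real j)) - weight (x + real j) * iterate' n (\<gamma> / (x + real j)) * (\<gamma> / (x + real j)\<^sup>2)) (at x)" for j
  proof -
    have "((\<lambda>x. x + real j) has_real_derivative 1) (at x)" by (auto intro!: derivative_eq_intros)
    from DERIV_chain2[OF weight_inversion_deriv[OF Suc.IH] this] show ?thesis by simp
  qed
  then show ?case
    unfolding iterate.simps iterate'.simps transfer_def[abs_def] transfer'_def by (intro DERIV_sum)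
qed simp

lemma iterate_cont: "continuous_on A (iterate n)"
  by (rule DERIV_continuous_on) (rule has_field_derivative_at_within[OF iterate_has_derivative])

lemma continuous_inversion_weight:
  assumes "continuous_on UNIV u"
  shows "continuous_on UNIV (\<lambda>y. weight y * u (\<gamma> / y))" "continuous_on UNIV (\<lambda>y. weight' y * u (\<gamma> / y))"
    "continuous_on UNIV (\<lambda>y. \<bar>weight' y\<bar> * u (\<gamma> / y))"
    "continuous_on UNIV (\<lambda>y. weight y * u (\<gamma> / y) * (\<gamma> / y\<^sup>2))"
proof -
  show "continuous_on UNIV (\<lambda>y. weight y * u (\<gamma> / y))"
    by (rule continuous_compose_inversion[OF weight_cont _ assms]) (simp add: weight_zero)
  show "continuous_on UNIV (\<lambda>y. weight' y * u (\<gamma> / y))"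
    by (rule continuous_compose_inversion[OF weight'_cont _ assms]) (simp add: weight'_zero)
  show "continuous_on UNIV (\<lambda>y. \<bar>weight' y\<bar> * u (\<gamma> / y))"
    by (rule continuous_compose_inversion[OF _ _ assms]) (auto intro!: continuous_intros weight'_cont simp: weight'_zero)
  \<comment> \<open>Since \<gamma> / y^2 equals (\<gamma> / y)^2 / \<gamma>, this factor is a
    continuous function of the inverted point as well.\<close>
  have cont: "continuous_on UNIV (\<lambda>y. weight y * (u (\<gamma> / y) * ((\<gamma> / y)\<^sup>2 / \<gamma>)))"
    by (rule continuous_compose_inversion[OF weight_cont, of "\<lambda>t. u t * (t\<^sup>2 / \<gamma>)"])
      (use weight_zero assms \<gamma>_pos in \<open>auto intro!: continuous_intros\<close>)
  have eq: "(\<lambda>y. weight y * (u (\<gamma> / y) * ((\<gamma> / y)\<^sup>2 / \<gamma>))) = (\<lambda>y. weight y * u (\<gamma> / y) * (\<gamma> / y\<^sup>2))"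
    using \<gamma>_pos by (auto simp: power2_eq_square)
  show "continuous_on UNIV (\<lambda>y. weight y * u (\<gamma> / y) * (\<gamma> / y\<^sup>2))"
    using cont unfolding eq .
qed

lemma continuous_sum_shift:
  assumes "continuous_on UNIV g"
  shows "continuous_on A (\<lambda>x. \<Sum>j\<le>n. g (x + real j) :: real)"
  by (intro continuous_on_sum continuous_on_compose2[OF assms] continuous_intros) auto

lemma transfer_cont:
  assumes "continuous_on UNIV u" shows "continuous_on A (transfer u)"
  unfolding transfer_def[abs_def] by (rule continuous_sum_shift[OF continuous_inversion_weight(1)[OF assms]])

lemma iterate'_cont: "continuous_on A (iterate' n)"
proof -
  have "continuous_on UNIV (iterate' n)"
  proof (induction n)
    case (Suc n)
    show ?case
      unfolding iterate'.simps transfer'_def[abs_def]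
      by (rule continuous_sum_shift[OF continuous_on_diff[OF continuous_inversion_weight(2)[OF iterate_cont]
        continuous_inversion_weight(4)[OF Suc]]])
  qed simp
  then show ?thesis by (rule continuous_on_subset) simp
qed

lemma iterate_nonneg: "0 \<le> iterate n x"
  by (induction n arbitrary: x) (auto simp: transfer_def intro!: sum_nonneg mult_nonneg_nonneg weight_nonneg)

text \<open>Moving x by 1 drops the term at x and adds one at x + branches + 1. For x in [0, 1] the
  former point lies below the support and the latter beyond it.\<close>

lemma sum_shift_periodic:
  fixes g :: "real \<Rightarrow> real"
  assumes z: "\<And>y. y \<le> \<gamma> / (1 + b) \<or> \<gamma> / a \<le> y \<Longrightarrow> g y = 0" and x: "x \<in> {0..1}"
  shows "(\<Sum>j\<le>branches. g (x + 1 + real j)) = (\<Sum>j\<le>branches. g (x + real j))"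
proof -
  have "g (x + real 0) + (\<Sum>j\<le>branches. g (x + real (Suc j))) = (\<Sum>j\<le>Suc branches. g (x + real j))"
    by (rule sum.atMost_Suc_shift[symmetric])
  also have "\<dots> = (\<Sum>j\<le>branches. g (x + real j)) + g (x + real (Suc branches))" by simp
  also have "g (x + real (Suc branches)) = 0" using branches x by (intro z) auto
  also have "g (x + real 0) = 0" using support_gt(1) a ab x by (intro z) auto
  finally show ?thesis by (simp add: add_ac)
qed

lemma transfer_periodic: "x \<in> {0..1} \<Longrightarrow> transfer u (x + 1) = transfer u x"
  unfolding transfer_def by (rule sum_shift_periodic) (simp add: weight_zero)

lemma iterate_periodic: "x \<in> {0..1} \<Longrightarrow> iterate n (x + 1) = iterate n x"
  by (cases n) (simp_all add: transfer_periodic)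

lemma iterate'_periodic: "x \<in> {0..1} \<Longrightarrow> iterate' n (x + 1) = iterate' n x"
proof (cases n)
  case (Suc m)
  assume "x \<in> {0..1}"
  then show ?thesis
    unfolding Suc iterate'.simps transfer'_def
    by (intro sum_shift_periodic[of "\<lambda>y. weight' y * iterate m (\<gamma> / y) - weight y * iterate' m (\<gamma> / y) * (\<gamma> / y\<^sup>2)"])
      (simp_all add: weight_zero weight'_zero)
qed simp

lemma weight_inversion:
  assumes "t > 0" shows "weight (\<gamma> / t) * (\<gamma> / t\<^sup>2) = \<eta> t"
  using assms \<gamma>_pos by (simp add: weight_def power2_eq_square)

text \<open>Conservation of mass: unfold the sum over branches, invert, and apply the partition of
  unity.\<close>

lemma transfer_integral:
  assumes u: "continuous_on UNIV u" and per: "\<And>x. x \<in> {0..1} \<Longrightarrow> u (x + 1) = u x"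
  shows "integral {0..1} (transfer u) = integral {0..1} u"
proof -
  have "integral {0..1} (transfer u) = integral {0..real branches + 1} (\<lambda>y. weight y * u (\<gamma> / y))"
    unfolding transfer_def[abs_def] by (rule integral_fold[OF continuous_inversion_weight(1)[OF u]])
  also have "\<dots> = integral {a..2} (\<lambda>t. weight (\<gamma> / t) * u (\<gamma> / (\<gamma> / t)) * (\<gamma> / t\<^sup>2))"
    by (rule integral_inversion[OF continuous_inversion_weight(1)[OF u]]) (simp add: weight_zero)
  also have "\<dots> = integral {a..2} (\<lambda>t. \<eta> t * u t)"
  proof (rule Henstock_Kurzweil_Integration.integral_cong)
    fix t assume "t \<in> {a..2}"
    then have t: "t > 0" using a by simp
    have "\<gamma> / (\<gamma> / t) = t" using \<gamma>_pos by simp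
    then show "weight (\<gamma> / t) * u (\<gamma> / (\<gamma> / t)) * (\<gamma> / t\<^sup>2) = \<eta> t * u t"
      unfolding weight_inversion[OF t, symmetric] by simp
  qed
  also have "\<dots> = integral {0..1} u"
    by (rule integral_cutoff(1)) (use per continuous_on_subset[OF u] in auto)
  finally show ?thesis .
qed

lemma iterate_integral: "integral {0..1} (iterate n) = 1"
proof (induction n)
  case (Suc n)
  then show ?case using transfer_integral[OF iterate_cont iterate_periodic] by simp
qed simp

section \<open>Uniform bounds for the iterated densities and their derivatives\<close>

lemma weight'_bounded: "\<exists>C\<ge>0. \<forall>y. \<bar>weight' y\<bar> \<le> C"
proof -
  have "compact (weight' ` {0..\<gamma> / a})"
    by (intro compact_continuous_image continuous_on_subset[OF weight'_cont]) auto
  then obtain C where C: "\<And>y. y \<in> {0..\<gamma> / a} \<Longrightarrow> \<bar>weight' y\<bar> \<le> C"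
    using compact_imp_bounded bounded_iff real_norm_def by (metis imageI)
  have "\<bar>weight' y\<bar> \<le> \<bar>C\<bar>" for y
  proof (cases "y \<in> {0..\<gamma> / a}")
    case True then show ?thesis using C[of y] by simp
  next
    case False
    then have "weight' y = 0" using support_gt(2) by (intro weight'_zero) auto
    then show ?thesis by simp
  qed
  then show ?thesis by (intro exI[of _ "\<bar>C\<bar>"]) auto
qed

text \<open>Bounds the slopes of the inverse branches on the support: \<gamma> / y^2 is t^2 /
  \<gamma> with t = \<gamma> / y \<le> 1 + b.\<close>

definition rate :: real where "rate = (1 + b)\<^sup>2 / \<gamma>"

lemma rate: "0 \<le> rate" "rate < 1"
  using \<gamma> \<gamma>_pos by (auto simp: rate_def)

lemma weight_contraction: "weight y * (\<gamma> / y\<^sup>2) \<le> rate * weight y"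
proof (cases "weight y = 0")
  case False
  note y = support_point(1,2)[OF disjI1[OF False]]
  have "\<gamma> / y \<le> 1 + b" using y a ab by (simp add: field_simps)
  then have "(\<gamma> / y)\<^sup>2 \<le> (1 + b)\<^sup>2" using y \<gamma>_pos by (intro power_mono) auto
  then have "(\<gamma> / y)\<^sup>2 / \<gamma> \<le> rate" unfolding rate_def using \<gamma>_pos by (intro divide_right_mono) auto
  moreover have "(\<gamma> / y)\<^sup>2 / \<gamma> = \<gamma> / y\<^sup>2" using \<gamma>_pos by (simp add: power2_eq_square)
  ultimately have "\<gamma> / y\<^sup>2 \<le> rate" by simp
  from mult_left_mono[OF this weight_nonneg] show ?thesis by (simp add: mult.commute)
qed simp

text \<open>An inequality of Lasota-Yorke type: differentiating the inverse branch contributes the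
  factor \<open>rate\<close>, while differentiating the weight leaves only the previous density, not
  its derivative.\<close>

lemma abs_iterate'_Suc_le:
  "\<bar>iterate' (Suc n) x\<bar> \<le> (\<Sum>j\<le>branches. \<bar>weight' (x + real j)\<bar> * iterate n (\<gamma> / (x + real j))) + rate * transfer (\<lambda>t. \<bar>iterate' n t\<bar>) x"
proof -
  have "\<bar>iterate' (Suc n) x\<bar> \<le> (\<Sum>j\<le>branches. \<bar>weight' (x + real j) * iterate n (\<gamma> / (x + real j))
     - weight (x + real j) * iterate' n (\<gamma> / (x + real j)) * (\<gamma> / (x + real j)\<^sup>2)\<bar>)"
    unfolding iterate'.simps transfer'_def by (rule sum_abs)
  also have "\<dots> \<le> (\<Sum>j\<le>branches. \<bar>weight' (x + real j)\<bar> * iterate n (\<gamma> / (x + real j)) + rate * (weight (x + real j) * \<bar>iterate' n (\<gamma> / (x + real j))\<bar>))"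
  proof (rule sum_mono)
    fix j
    let ?y = "x + real j"
    have "\<bar>weight' ?y * iterate n (\<gamma> / ?y) - weight ?y * iterate' n (\<gamma> / ?y) * (\<gamma> / ?y\<^sup>2)\<bar> \<le> \<bar>weight' ?y * iterate n (\<gamma> / ?y)\<bar> + \<bar>weight ?y * iterate' n (\<gamma> / ?y) * (\<gamma> / ?y\<^sup>2)\<bar>"
      by (rule abs_triangle_ineq4)
    also have "\<bar>weight' ?y * iterate n (\<gamma> / ?y)\<bar> = \<bar>weight' ?y\<bar> * iterate n (\<gamma> / ?y)" using iterate_nonneg by (simp add: abs_mult)
    also have "\<bar>weight ?y * iterate' n (\<gamma> / ?y) * (\<gamma> / ?y\<^sup>2)\<bar> = weight ?y * (\<gamma> / ?y\<^sup>2) * \<bar>iterate' n (\<gamma> / ?y)\<bar>"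
      using weight_nonneg[of ?y] \<gamma>_pos by (simp add: abs_mult)
    also have "\<dots> \<le> rate * weight ?y * \<bar>iterate' n (\<gamma> / ?y)\<bar>" by (rule mult_right_mono[OF weight_contraction]) simp
    finally show "\<bar>weight' ?y * iterate n (\<gamma> / ?y) - weight ?y * iterate' n (\<gamma> / ?y) * (\<gamma> / ?y\<^sup>2)\<bar> \<le> \<bar>weight' ?y\<bar> * iterate n (\<gamma> / ?y) + rate * (weight ?y * \<bar>iterate' n (\<gamma> / ?y)\<bar>)"
      by (simp add: mult.assoc)
  qed
  also have "\<dots> = (\<Sum>j\<le>branches. \<bar>weight' (x + real j)\<bar> * iterate n (\<gamma> / (x + real j))) + rate * transfer (\<lambda>t. \<bar>iterate' n t\<bar>) x"
    by (simp add: sum.distrib transfer_def sum_distrib_left)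
  finally show ?thesis .
qed

text \<open>After integration, conservation of mass turns the second term of
  \<open>abs_iterate'_Suc_le\<close> into \<open>rate\<close> times the old variation, and total
  mass 1 bounds the first by \<open>E\<close>. The variations therefore stay below the fixed point
  of the map v to E + rate * v.\<close>

lemma variation_bound: "\<exists>V\<ge>0. \<forall>n. integral {0..1} (\<lambda>x. \<bar>iterate' n x\<bar>) \<le> V"
proof -
  obtain C where C: "C \<ge> 0" "\<And>y. \<bar>weight' y\<bar> \<le> C" using weight'_bounded by auto
  \<comment> \<open>\<open>C\<close> bounds the derivative of the weight, \<gamma> / a^2 the
    Jacobian on [a, 2], and 2 the mass of a periodic density of mean 1 over [a, 2].\<close>
  define E where "E = C * (\<gamma> / a\<^sup>2) * 2"
  have E: "E \<ge> 0" using C \<gamma>_pos by (simp add: E_def)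
  define V where "V = E / (1 - rate)"
  have V: "V \<ge> 0" "E + rate * V = V" using E rate by (auto simp: V_def field_simps)
  have cD: "continuous_on A (\<lambda>t. \<bar>iterate' n t\<bar>)" for A n by (intro continuous_intros iterate'_cont)
  have "integral {0..1} (\<lambda>x. \<bar>iterate' n x\<bar>) \<le> V" for n
  proof (induction n)
    case (Suc n)
    let ?g = "\<lambda>y. \<bar>weight' y\<bar> * iterate n (\<gamma> / y)"
    have g: "continuous_on UNIV ?g" by (rule continuous_inversion_weight(3)[OF iterate_cont])
    have "integral {0..1} (\<lambda>x. \<bar>iterate' (Suc n) x\<bar>) \<le> integral {0..1} (\<lambda>x. (\<Sum>j\<le>branches. ?g (x + real j)) + rate * transfer (\<lambda>t. \<bar>iterate' n t\<bar>) x)"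
      by (rule integral_le)
        (use abs_iterate'_Suc_le in \<open>auto intro!: integrable_continuous_interval continuous_intros continuous_sum_shift[OF g] transfer_cont cD iterate'_cont simp del: iterate'.simps\<close>)
    also have "\<dots> = integral {0..1} (\<lambda>x. \<Sum>j\<le>branches. ?g (x + real j)) + rate * integral {0..1} (transfer (\<lambda>t. \<bar>iterate' n t\<bar>))"
    proof -
      have "integral {0..1} (\<lambda>x. (\<Sum>j\<le>branches. ?g (x + real j)) + rate * transfer (\<lambda>t. \<bar>iterate' n t\<bar>) x) =
        integral {0..1} (\<lambda>x. \<Sum>j\<le>branches. ?g (x + real j)) + integral {0..1} (\<lambda>x. rate * transfer (\<lambda>t. \<bar>iterate' n t\<bar>) x)"
        by (rule Henstock_Kurzweil_Integration.integral_add)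
          (intro integrable_continuous_interval continuous_intros continuous_sum_shift[OF g] transfer_cont cD)+
      then show ?thesis by simp
    qed
    also have "integral {0..1} (transfer (\<lambda>t. \<bar>iterate' n t\<bar>)) = integral {0..1} (\<lambda>t. \<bar>iterate' n t\<bar>)"
      by (rule transfer_integral[OF cD]) (simp add: iterate'_periodic)
    also have "integral {0..1} (\<lambda>x. \<Sum>j\<le>branches. ?g (x + real j)) \<le> E"
    proof -
      have "integral {0..1} (\<lambda>x. \<Sum>j\<le>branches. ?g (x + real j)) = integral {a..2} (\<lambda>t. \<bar>weight' (\<gamma> / t)\<bar> * iterate n (\<gamma> / (\<gamma> / t)) * (\<gamma> / t\<^sup>2))"
        unfolding integral_fold[OF g] by (rule integral_inversion[OF g]) (simp add: weight'_zero)
      also have "\<dots> = integral {a..2} (\<lambda>t. \<bar>weight' (\<gamma> / t)\<bar> * iterate n t * (\<gamma> / t\<^sup>2))"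
        using \<gamma>_pos by simp
      also have "\<dots> \<le> integral {a..2} (\<lambda>t. C * (\<gamma> / a\<^sup>2) * iterate n t)"
      proof (rule integral_le)
        show "(\<lambda>t. \<bar>weight' (\<gamma> / t)\<bar> * iterate n t * (\<gamma> / t\<^sup>2)) integrable_on {a..2}"
          using a by (intro integrable_continuous_interval continuous_intros iterate_cont continuous_on_compose2[OF weight'_cont]) auto
        show "(\<lambda>t. C * (\<gamma> / a\<^sup>2) * iterate n t) integrable_on {a..2}"
          by (intro integrable_continuous_interval continuous_intros iterate_cont)
        fix t assume t: "t \<in> {a..2}"
        then have "\<gamma> / t\<^sup>2 \<le> \<gamma> / a\<^sup>2" using a \<gamma>_pos by (intro divide_left_mono power_mono) auto
        then have "\<bar>weight' (\<gamma> / t)\<bar> * (\<gamma> / t\<^sup>2) \<le> C * (\<gamma> / a\<^sup>2)"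
          using C \<gamma>_pos by (intro mult_mono) auto
        from mult_right_mono[OF this iterate_nonneg[of n t]]
        show "\<bar>weight' (\<gamma> / t)\<bar> * iterate n t * (\<gamma> / t\<^sup>2) \<le> C * (\<gamma> / a\<^sup>2) * iterate n t" by (simp add: mult_ac)
      qed
      also have "\<dots> = C * (\<gamma> / a\<^sup>2) * integral {a..2} (iterate n)" by simp
      also have "\<dots> \<le> C * (\<gamma> / a\<^sup>2) * 2"
      proof (rule mult_left_mono)
        have "integral {a..2} (iterate n) \<le> 2 * integral {0..1} (iterate n) \<or> (\<exists>x\<in>{0..2}. iterate n x < 0)"
          by (rule integral_cutoff(2)[OF iterate_cont iterate_periodic])
        then show "integral {a..2} (iterate n) \<le> 2"
          using iterate_nonneg[of n] by (auto simp: iterate_integral not_less[symmetric])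
      qed (use C \<gamma>_pos in auto)
      finally show ?thesis by (simp add: E_def)
    qed
    also have "E + rate * integral {0..1} (\<lambda>t. \<bar>iterate' n t\<bar>) \<le> E + rate * V"
      using Suc rate by (intro add_left_mono mult_left_mono) auto
    finally show ?case using V by simp
  qed (use V in simp)
  then show ?thesis using V by blast
qed

text \<open>A function of mean 1 and variation at most V on [0, 1] is at most 1 + V there;
  periodicity covers [1, 2].\<close>

lemma iterate_bounded: "\<exists>S\<ge>1. \<forall>n. \<forall>x\<in>{0..2}. iterate n x \<le> S"
proof -
  obtain V where V: "V \<ge> 0" "\<And>n. integral {0..1} (\<lambda>x. \<bar>iterate' n x\<bar>) \<le> V" using variation_bound by auto
  have le1: "iterate n x \<le> 1 + V" if x: "x \<in> {0..1}" for n x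
  proof -
    have iD: "iterate' n integrable_on {c..d}" "(\<lambda>x. \<bar>iterate' n x\<bar>) integrable_on {c..d}" for c d
      by (intro integrable_continuous_interval continuous_intros iterate'_cont)+
    have main: "\<bar>iterate n d - iterate n c\<bar> \<le> V" if cd: "0 \<le> c" "c \<le> d" "d \<le> 1" for c d
    proof -
      have "(iterate' n has_integral (iterate n d - iterate n c)) {c..d}"
        using cd by (intro fundamental_theorem_of_calculus)
          (auto simp: has_real_derivative_iff_has_vector_derivative[symmetric] intro: has_field_derivative_at_within[OF iterate_has_derivative])
      then have "iterate n d - iterate n c = integral {c..d} (iterate' n)" by (simp add: integral_unique)
      also have "\<bar>\<dots>\<bar> \<le> integral {c..d} (\<lambda>x. \<bar>iterate' n x\<bar>)"
        using Henstock_Kurzweil_Integration.integral_norm_bound_integral[OF iD, of c d] by simp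
      also have "\<dots> \<le> integral {0..1} (\<lambda>x. \<bar>iterate' n x\<bar>)"
        by (rule integral_subset_le) (use cd iD in auto)
      also note V(2)
      finally show ?thesis .
    qed
    have "iterate n x - iterate n y \<le> V" if "y \<in> {0..1}" for y
      using main[of x y] main[of y x] x that by (cases "x \<le> y") auto
    then have "integral {0..1} (\<lambda>y. iterate n x - iterate n y) \<le> integral {0..1} (\<lambda>y::real. V)"
      by (intro integral_le integrable_continuous_interval continuous_intros iterate_cont)
    moreover have "integral {0..1} (\<lambda>y. iterate n x - iterate n y) = iterate n x - 1"
      by (subst Henstock_Kurzweil_Integration.integral_diff)
        (auto intro!: integrable_continuous_interval iterate_cont simp: iterate_integral)
    ultimately show ?thesis by simp
  qed
  have "iterate n x \<le> 1 + V" if x: "x \<in> {0..2}" for n x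
  proof (cases "x \<le> 1")
    case True then show ?thesis using le1 x by simp
  next
    case False
    then have "x - 1 \<in> {0..1}" using x by auto
    from le1[OF this] iterate_periodic[OF this] show ?thesis by simp
  qed
  then show ?thesis using V by (intro exI[of _ "1 + V"]) auto
qed

text \<open>A bound on the variation gives no equicontinuity, so the derivative is bounded
  pointwise. On iterating \<open>abs_iterate'_Suc_le\<close>, a geometric series in
  \<open>rate\<close> remains, whose coefficients are controlled by the sup bound S.\<close>

lemma iterate'_bounded: "\<exists>L\<ge>0. \<forall>n. \<forall>x\<in>{0..2}. \<bar>iterate' n x\<bar> \<le> L"
proof -
  obtain C where C: "C \<ge> 0" "\<And>y. \<bar>weight' y\<bar> \<le> C" using weight'_bounded by auto
  obtain S where S: "S \<ge> 1" "\<And>n x. x \<in> {0..2} \<Longrightarrow> iterate n x \<le> S" using iterate_bounded by auto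
  \<comment> \<open>Bounds the first term of \<open>abs_iterate'_Suc_le\<close>: each of its
    \<open>branches + 1\<close> summands is at most C S.\<close>
  define K where "K = (real branches + 1) * (C * S)"
  have K: "K \<ge> 0" using C S by (simp add: K_def)
  \<comment> \<open>The invariant keeps the iterates themselves, because \<open>transfer\<close>
    sends iterate k exactly to iterate k + 1; replacing them by S at every step would lose a factor
    S each time.\<close>
  have main: "\<bar>iterate' n x\<bar> \<le> K * (\<Sum>k<n. rate ^ k * iterate k x)" if "x \<in> {0..2}" for n x
    using that
  proof (induction n arbitrary: x)
    case (Suc n)
    have "(\<Sum>j\<le>branches. \<bar>weight' (x + real j)\<bar> * iterate n (\<gamma> / (x + real j))) \<le> (\<Sum>j\<le>branches. C * S)"
    proof (rule sum_mono)
      fix j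
      show "\<bar>weight' (x + real j)\<bar> * iterate n (\<gamma> / (x + real j)) \<le> C * S"
      proof (cases "weight' (x + real j) = 0")
        case True then show ?thesis using C S by simp
      next
        case False
        then show ?thesis using C S support_point(3)[of "x + real j"] iterate_nonneg by (intro mult_mono) auto
      qed
    qed
    also have "\<dots> = K" by (simp add: K_def)
    finally have 1: "(\<Sum>j\<le>branches. \<bar>weight' (x + real j)\<bar> * iterate n (\<gamma> / (x + real j))) \<le> K" .
    have "transfer (\<lambda>t. \<bar>iterate' n t\<bar>) x \<le> (\<Sum>j\<le>branches. weight (x + real j) * (K * (\<Sum>k<n. rate ^ k * iterate k (\<gamma> / (x + real j)))))"
      unfolding transfer_def
    proof (rule sum_mono)
      fix j
      show "weight (x + real j) * \<bar>iterate' n (\<gamma> / (x + real j))\<bar> \<le> weight (x + real j) * (K * (\<Sum>k<n. rate ^ k * iterate k (\<gamma> / (x + real j))))"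
      proof (cases "weight (x + real j) = 0")
        case False
        then show ?thesis using support_point(3)[of "x + real j"] by (intro mult_left_mono Suc.IH weight_nonneg) auto
      qed simp
    qed
    also have "\<dots> = K * (\<Sum>k<n. rate ^ k * iterate (Suc k) x)"
      unfolding iterate.simps transfer_def sum_distrib_left
      by (subst sum.swap) (simp add: mult_ac)
    finally have "rate * transfer (\<lambda>t. \<bar>iterate' n t\<bar>) x \<le> rate * (K * (\<Sum>k<n. rate ^ k * iterate (Suc k) x))"
      using rate by (intro mult_left_mono) auto
    also have "\<dots> = K * (\<Sum>k<n. rate ^ Suc k * iterate (Suc k) x)"
      by (simp add: sum_distrib_left mult_ac del: iterate.simps)
    finally have "\<bar>iterate' (Suc n) x\<bar> \<le> K + K * (\<Sum>k<n. rate ^ Suc k * iterate (Suc k) x)"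
      using abs_iterate'_Suc_le[of n x] 1 by linarith
    also have "\<dots> = K * (\<Sum>k<Suc n. rate ^ k * iterate k x)"
      unfolding sum.lessThan_Suc_shift by (simp add: distrib_left del: iterate.simps(2))
    finally show ?case .
  qed simp
  have "\<bar>iterate' n x\<bar> \<le> K * (S * (1 / (1 - rate)))" if x: "x \<in> {0..2}" for n x
  proof -
    have "(\<Sum>k<n. rate ^ k * iterate k x) \<le> (\<Sum>k<n. rate ^ k * S)"
      using S(2)[OF x] rate by (intro sum_mono mult_left_mono) auto
    also have "\<dots> = S * (\<Sum>k<n. rate ^ k)" by (simp add: sum_distrib_left mult.commute)
    also have "(\<Sum>k<n. rate ^ k) \<le> 1 / (1 - rate)"
      using rate sum_le_suminf[of "\<lambda>k. rate ^ k" "{..<n}"] by (simp add: suminf_geometric summable_geometric)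
    then have "S * (\<Sum>k<n. rate ^ k) \<le> S * (1 / (1 - rate))" using S by (intro mult_left_mono) auto
    finally have "K * (\<Sum>k<n. rate ^ k * iterate k x) \<le> K * (S * (1 / (1 - rate)))" using K by (intro mult_left_mono)
    then show ?thesis using main[OF x, of n] by linarith
  qed
  moreover have "K * (S * (1 / (1 - rate))) \<ge> 0" using K S rate by simp
  ultimately show ?thesis by blast
qed

section \<open>The stationary density\<close>

lemma transfer_sum: "transfer (\<lambda>t. \<Sum>n<N. iterate n t) x = (\<Sum>n<N. iterate (Suc n) x)"
  unfolding iterate.simps transfer_def sum_distrib_left by (rule sum.swap)

lemma transfer_cong:
  assumes "\<And>t. t \<in> {0..2} \<Longrightarrow> u t = v t" shows "transfer u x = transfer v x"
  unfolding transfer_def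
proof (rule sum.cong[OF refl])
  fix j
  show "weight (x + real j) * u (\<gamma> / (x + real j)) = weight (x + real j) * v (\<gamma> / (x + real j))"
    using assms[of "\<gamma> / (x + real j)"] support_point(3)[of "x + real j"]
    by (cases "weight (x + real j) = 0") auto
qed

text \<open>A Krylov-Bogolyubov argument: the Cesaro means of the iterates are bounded and
  equi-Lipschitz on [0, 2], so Arzela-Ascoli gives a uniform limit along a subsequence. It is
  stationary because a mean and its image differ by a telescoped remainder of order 1 / N.\<close>

proposition transfer_fixed_point:
  "\<exists>h. continuous_on UNIV h \<and> (\<forall>x\<in>{0..1}. h (x + 1) = h x) \<and>
     (\<forall>x\<in>{0..1}. transfer h x = h x) \<and> integral {0..1} h = 1"
proof -
  obtain S where S: "S \<ge> 1" "\<And>n x. x \<in> {0..2} \<Longrightarrow> iterate n x \<le> S" using iterate_bounded by auto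
  obtain L where L: "L \<ge> 0" "\<And>n x. x \<in> {0..2} \<Longrightarrow> \<bar>iterate' n x\<bar> \<le> L" using iterate'_bounded by auto
  \<comment> \<open>Index N averages N + 1 iterates, so the denominator is never zero.\<close>
  define A where "A N x = (\<Sum>n<Suc N. iterate n x) / real (Suc N)" for N x
  have A_le: "norm (A N x) \<le> S" if x: "x \<in> {0..2}" for N x
  proof -
    have "(\<Sum>n<Suc N. iterate n x) \<le> (\<Sum>n<Suc N. S)" using S(2)[OF x] by (rule sum_mono)
    then have "A N x \<le> S" unfolding A_def by (simp add: divide_le_eq mult.commute del: sum.lessThan_Suc)
    moreover have "A N x \<ge> 0" unfolding A_def by (intro divide_nonneg_nonneg sum_nonneg iterate_nonneg) auto
    ultimately show ?thesis by simp
  qed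
  have iterate_lip: "\<bar>iterate n x - iterate n y\<bar> \<le> L * \<bar>x - y\<bar>" if "x \<in> {0..2}" "y \<in> {0..2}" for n x y
    using field_differentiable_bound[of "{0..2}" "iterate n" "iterate' n" L x y] that L(2)
    by (simp add: has_field_derivative_at_within[OF iterate_has_derivative])
  have A_lip: "\<bar>A N x - A N y\<bar> \<le> L * \<bar>x - y\<bar>" if "x \<in> {0..2}" "y \<in> {0..2}" for N x y
  proof -
    have "\<bar>(\<Sum>n<Suc N. iterate n x) - (\<Sum>n<Suc N. iterate n y)\<bar> = \<bar>\<Sum>n<Suc N. iterate n x - iterate n y\<bar>"
      by (simp only: sum_subtractf)
    also have "\<dots> \<le> (\<Sum>n<Suc N. \<bar>iterate n x - iterate n y\<bar>)" by (rule sum_abs)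
    also have "\<dots> \<le> (\<Sum>n<Suc N. L * \<bar>x - y\<bar>)" by (rule sum_mono[OF iterate_lip[OF that]])
    also have "\<dots> = real (Suc N) * (L * \<bar>x - y\<bar>)" by (simp only: sum_constant card_lessThan)
    finally have "\<bar>(\<Sum>n<Suc N. iterate n x) - (\<Sum>n<Suc N. iterate n y)\<bar> / real (Suc N) \<le> L * \<bar>x - y\<bar>"
      by (simp only: divide_le_eq of_nat_0_less_iff zero_less_Suc if_True mult.commute)
    then show ?thesis unfolding A_def diff_divide_distrib[symmetric] by (simp only: abs_divide abs_of_nat)
  qed
  have eq: "\<exists>d>0. \<forall>N y. y \<in> {0..2} \<and> norm (x - y) < d \<longrightarrow> norm (A N x - A N y) < e"
    if "x \<in> {0..2}" "e > 0" for x e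
  proof (intro exI[of _ "e / (L + 1)"] conjI allI impI)
    show "0 < e / (L + 1)" using that L by simp
    fix N y assume y: "y \<in> {0..2} \<and> norm (x - y) < e / (L + 1)"
    have "\<bar>A N x - A N y\<bar> \<le> L * \<bar>x - y\<bar>" using A_lip that y by blast
    also have "\<dots> \<le> (L + 1) * \<bar>x - y\<bar>" by (intro mult_right_mono) auto
    also have "\<dots> < e" using y L by (simp add: less_divide_eq mult.commute)
    finally show "norm (A N x - A N y) < e" by simp
  qed
  obtain g k where g: "continuous_on {0..2} g" and k: "strict_mono (k :: nat \<Rightarrow> nat)"
    and lim: "\<And>e. 0 < e \<Longrightarrow> \<exists>N. \<forall>n x. n \<ge> N \<and> x \<in> {0..2} \<longrightarrow> norm (A (k n) x - g x) < e"
    by (rule Arzela_Ascoli[of "{0..2}" A S, OF _ A_le eq]) auto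
  have ptw: "(\<lambda>n. A (k n) x) \<longlonglongrightarrow> g x" if "x \<in> {0..2}" for x
    using lim that unfolding LIMSEQ_iff by blast
  have A_periodic: "A N (x + 1) = A N x" if "x \<in> {0..1}" for N x
    unfolding A_def using iterate_periodic[OF that] by simp
  have g_periodic: "g (x + 1) = g x" if x: "x \<in> {0..1}" for x
  proof (rule LIMSEQ_unique)
    show "(\<lambda>n. A (k n) (x + 1)) \<longlonglongrightarrow> g (x + 1)" by (rule ptw) (use x in auto)
    show "(\<lambda>n. A (k n) (x + 1)) \<longlonglongrightarrow> g x" unfolding A_periodic[OF x] by (rule ptw) (use x in auto)
  qed
  have fixed: "transfer g x = g x" if x: "x \<in> {0..1}" for x
  proof (rule LIMSEQ_unique)
    show "(\<lambda>n. transfer (A (k n)) x) \<longlonglongrightarrow> transfer g x"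
      unfolding transfer_def
    proof (rule tendsto_sum)
      fix j
      show "(\<lambda>n. weight (x + real j) * A (k n) (\<gamma> / (x + real j))) \<longlonglongrightarrow> weight (x + real j) * g (\<gamma> / (x + real j))"
        using ptw[of "\<gamma> / (x + real j)"] support_point(3)[of "x + real j"]
        by (cases "weight (x + real j) = 0") (auto intro: tendsto_mult_left)
    qed
    have x2: "x \<in> {0..2}" using x by simp
    have tA: "transfer (A N) x = A N x + (iterate (Suc N) x - 1) / real (Suc N)" for N
    proof -
      have "transfer (A N) x = (\<Sum>n<Suc N. iterate (Suc n) x) / real (Suc N)"
        unfolding transfer_sum[symmetric] A_def transfer_def by (simp only: sum_divide_distrib[symmetric] times_divide_eq_right)
      also have "(\<Sum>n<Suc N. iterate (Suc n) x) = (\<Sum>n<Suc N. iterate n x) + (iterate (Suc N) x - iterate 0 x)"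
        using sum_lessThan_telescope[of "\<lambda>n. iterate n x" "Suc N"] by (simp only: sum_subtractf)
      finally show ?thesis by (simp only: A_def[abs_def] add_divide_distrib iterate.simps(1))
    qed
    have "(\<lambda>N. (iterate (Suc N) x - 1) / real (Suc N)) \<longlonglongrightarrow> 0"
    proof (rule Lim_null_comparison[where g = "\<lambda>N. S / real (Suc N)"])
      have "\<bar>iterate (Suc N) x - 1\<bar> \<le> S" for N using S(2)[OF x2, of "Suc N"] iterate_nonneg[of "Suc N" x] S(1) by linarith
      then show "\<forall>\<^sub>F N in sequentially. norm ((iterate (Suc N) x - 1) / real (Suc N)) \<le> S / real (Suc N)"
        by (intro always_eventually allI) (simp add: divide_right_mono del: iterate.simps)
      show "(\<lambda>N. S / real (Suc N)) \<longlonglongrightarrow> 0"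
        using LIMSEQ_Suc[OF lim_const_over_n[of S]] by simp
    qed
    then have "(\<lambda>n. (iterate (Suc (k n)) x - 1) / real (Suc (k n))) \<longlonglongrightarrow> 0"
      using LIMSEQ_subseq_LIMSEQ[OF _ k] by (simp only: o_def)
    then have "(\<lambda>n. A (k n) x + (iterate (Suc (k n)) x - 1) / real (Suc (k n))) \<longlonglongrightarrow> g x + 0"
      by (rule tendsto_add[OF ptw[OF x2]])
    then show "(\<lambda>n. transfer (A (k n)) x) \<longlonglongrightarrow> g x" unfolding tA by simp
  qed
  have g01: "g integrable_on {0..1}"
    by (rule integrable_continuous_interval) (rule continuous_on_subset[OF g], auto)
  have A01: "A N integrable_on {0..1}" for N
    unfolding A_def[abs_def] by (intro integrable_continuous_interval continuous_intros iterate_cont) auto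
  have int_A: "integral {0..1} (A N) = 1" for N
  proof -
    have "integral {0..1} (A N) = integral {0..1} (\<lambda>x. \<Sum>n<Suc N. iterate n x) / real (Suc N)"
      unfolding A_def[abs_def] by (simp only: integral_divide)
    also have "integral {0..1} (\<lambda>x. \<Sum>n<Suc N. iterate n x) = (\<Sum>n<Suc N. integral {0..1} (iterate n))"
      by (rule integral_sum) (auto intro!: integrable_continuous_interval iterate_cont)
    also have "\<dots> = real (Suc N)" unfolding iterate_integral by simp
    finally show ?thesis by simp
  qed
  have int_g: "integral {0..1} g = 1"
  proof -
    have "\<bar>integral {0..1} g - 1\<bar> \<le> 0 + e" if e: "e > 0" for e
    proof -
      obtain N where N: "\<And>n x. n \<ge> N \<Longrightarrow> x \<in> {0..2} \<Longrightarrow> norm (A (k n) x - g x) < e" using lim[OF e] by blast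
      have "integral {0..1} g - 1 = integral {0..1} (\<lambda>x. g x - A (k N) x)"
        unfolding Henstock_Kurzweil_Integration.integral_diff[OF g01 A01] int_A ..
      also have "norm \<dots> \<le> integral {0..1} (\<lambda>x::real. e)"
      proof (rule Henstock_Kurzweil_Integration.integral_norm_bound_integral)
        show "(\<lambda>x. g x - A (k N) x) integrable_on {0..1}" using g01 A01 by (rule integrable_diff)
        show "norm (g x - A (k N) x) \<le> e" if "x \<in> {0..1}" for x
          using N[of N x] that by (simp add: norm_minus_commute)
      qed auto
      finally show ?thesis by simp
    qed
    then have "\<bar>integral {0..1} g - 1\<bar> \<le> 0" by (rule field_le_epsilon)
    then show ?thesis by simp
  qed
  \<comment> \<open>Clamping the argument to [0, 2] extends the limit continuously to the line; on
    [0, 1] periodicity and \<open>transfer\<close> only look at values from [0, 2].\<close>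
  define h where "h x = g (max 0 (min 2 x))" for x
  have hg: "h x = g x" if "x \<in> {0..2}" for x using that by (simp add: h_def)
  show ?thesis
  proof (intro exI[of _ h] conjI ballI)
    show "continuous_on UNIV h"
      unfolding h_def by (rule continuous_on_compose2[OF g]) (auto intro!: continuous_intros)
    show "h (x + 1) = h x" if "x \<in> {0..1}" for x using hg[of x] hg[of "x + 1"] g_periodic[OF that] that by simp
    show "transfer h x = h x" if "x \<in> {0..1}" for x
      using transfer_cong[of h g x] hg fixed[OF that] hg[of x] that by simp
    have "integral {0..1} h = integral {0..1} g"
      by (rule Henstock_Kurzweil_Integration.integral_cong) (use hg in auto)
    then show "integral {0..1} h = 1" using int_g by simp
  qed
qed

section \<open>The solution built from the stationary density\<close>

lemma branches_ge_1: "1 \<le> real branches"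
proof -
  have "1 \<le> \<gamma> / a" using \<gamma>_pos a ab b by (simp add: le_divide_eq)
  then show ?thesis using branches by linarith
qed

lemma integral_\<eta>:
  assumes v: "continuous_on {a..2} v"
  shows "integral {0..real branches + 1} (\<lambda>t. \<eta> t * v t) = integral {a..2} (\<lambda>t. \<eta> t * v t)"
    and "(\<lambda>t. \<eta> t * v t) integrable_on {0..real branches + 1}"
proof -
  have "((\<lambda>t. \<eta> t * v t) has_integral integral {a..2} (\<lambda>t. \<eta> t * v t)) {a..2}"
    by (intro integrable_integral integrable_continuous_interval continuous_intros \<eta>_cont v)
  then have "((\<lambda>t. if t \<in> {a..2} then \<eta> t * v t else 0) has_integral integral {a..2} (\<lambda>t. \<eta> t * v t)) {0..real branches + 1}"
    by (subst has_integral_restrict) (use a branches_ge_1 in auto)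
  moreover have "(if t \<in> {a..2} then \<eta> t * v t else 0) = \<eta> t * v t" for t
    using \<eta>_zero[of t] b by auto
  ultimately have "((\<lambda>t. \<eta> t * v t) has_integral integral {a..2} (\<lambda>t. \<eta> t * v t)) {0..real branches + 1}"
    by simp
  then show "integral {0..real branches + 1} (\<lambda>t. \<eta> t * v t) = integral {a..2} (\<lambda>t. \<eta> t * v t)"
    "(\<lambda>t. \<eta> t * v t) integrable_on {0..real branches + 1}"
    by (auto simp: integral_unique)
qed

text \<open>The two pieces of \<open>f\<close> are the images of one another under inversion, so
  inversion only changes the sign of \<open>f\<close>. Both pieces have periodization
  \<open>h\<close>, the first by the partition of unity and the second by stationarity; hence both
  conditions hold.\<close>

proposition supercritical_solution: "\<exists>k. critical_solution \<gamma> k \<and> \<not> (AE x in lborel. k x = 0)"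
proof -
  obtain h where h: "continuous_on UNIV h" and per: "\<And>x. x \<in> {0..1} \<Longrightarrow> h (x + 1) = h x"
    and fixed: "\<And>x. x \<in> {0..1} \<Longrightarrow> transfer h x = h x" and int_h: "integral {0..1} h = 1"
    using transfer_fixed_point by auto
  let ?R = "real branches + 1"
  define f where "f t = \<eta> t * h t - weight t * h (\<gamma> / t)" for t
  have wh: "continuous_on UNIV (\<lambda>y. weight y * h (\<gamma> / y))" by (rule continuous_inversion_weight(1)[OF h])
  have f_cont: "continuous_on UNIV f"
    unfolding f_def by (intro continuous_on_diff continuous_on_mult \<eta>_cont h wh)
  have f_zero: "f t = 0" if "t \<le> a \<or> ?R \<le> t" for t
  proof -
    have "\<eta> t = 0" using that branches_ge_1 b by (intro \<eta>_zero) auto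
    moreover have "t \<le> \<gamma> / (1 + b) \<or> \<gamma> / a \<le> t" using that branches support_gt(1) ab b by auto
    then have "weight t = 0" by (rule weight_zero)
    ultimately show ?thesis by (simp add: f_def)
  qed
  have f_int: "integrable lborel f"
  proof -
    have "set_integrable lborel {0..?R} f"
      by (rule borel_integrable_atLeastAtMost') (rule continuous_on_subset[OF f_cont], simp)
    moreover have "(\<lambda>x. indicator {0..?R} x *\<^sub>R f x) = f"
    proof
      fix x
      show "indicator {0..?R} x *\<^sub>R f x = f x"
        using f_zero[of x] a by (cases "x \<in> {0..?R}") auto
    qed
    ultimately show ?thesis by (simp add: set_integrable_def)
  qed
  have cis_0: "(\<integral>x. f x *\<^sub>R cis (2 * pi * m * S x) \<partial>lborel) = 0"
    if S[measurable]: "S \<in> borel_measurable borel"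
      and z: "\<And>q. continuous_on UNIV q \<Longrightarrow> (\<And>x. q (x + 1) = q x) \<Longrightarrow> integral {0..?R} (\<lambda>x. f x * q (S x)) = 0"
    for S :: "real \<Rightarrow> real" and m :: int
  proof -
    have c: "(\<lambda>x. cis (2 * pi * m * x)) \<in> borel_measurable borel"
      by (intro borel_measurable_continuous_onI continuous_intros)
    have int: "integrable lborel (\<lambda>x. f x *\<^sub>R cis (2 * pi * m * S x))"
    proof (rule integrable_mult_bounded[OF f_int, where B = 1])
      show "(\<lambda>x. cis (2 * pi * m * S x)) \<in> borel_measurable lborel"
        using measurable_compose[OF S c] by simp
    qed simp
    have HK: "(\<integral>x. f x * q (S x) \<partial>lborel) = integral {0..?R} (\<lambda>x. f x * q (S x))"
      if q: "continuous_on UNIV q" "\<And>x. \<bar>q x\<bar> \<le> 1" for q :: "real \<Rightarrow> real"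
    proof -
      have [measurable]: "q \<in> borel_measurable borel" by (rule borel_measurable_continuous_onI[OF q(1)])
      have "integrable lborel (\<lambda>x. f x * q (S x))"
        by (rule integrable_mult_bounded_real[OF f_int _ q(2)]) measurable
      then have "(\<integral>x. f x * q (S x) \<partial>lborel) = integral UNIV (\<lambda>x. f x * q (S x))"
        by (rule integral_lborel[symmetric])
      moreover have eqf: "(\<lambda>x. if x \<in> {0..?R} then f x * q (S x) else 0) = (\<lambda>x. f x * q (S x))"
      proof
        fix x
        show "(if x \<in> {0..?R} then f x * q (S x) else 0) = f x * q (S x)"
          using f_zero[of x] a by (cases "x \<in> {0..?R}") auto
      qed
      ultimately show ?thesis
        using integral_restrict_UNIV[of "{0..?R}" "\<lambda>x. f x * q (S x)"] unfolding eqf by simp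
    qed
    have p: "cos (2 * pi * m * (x + 1)) = cos (2 * pi * m * x)" "sin (2 * pi * m * (x + 1)) = sin (2 * pi * m * x)" for x :: real
      using cis_2pi_eq_iff[of "m * (x + 1)" "m * x"] by (auto simp: complex_eq_iff algebra_simps)
    have "(\<integral>x. f x * cos (2 * pi * m * S x) \<partial>lborel) = 0"
      using HK[of "\<lambda>x. cos (2 * pi * m * x)"] z[of "\<lambda>x. cos (2 * pi * m * x)"] p by (simp add: continuous_intros)
    moreover have "(\<integral>x. f x * sin (2 * pi * m * S x) \<partial>lborel) = 0"
      using HK[of "\<lambda>x. sin (2 * pi * m * x)"] z[of "\<lambda>x. sin (2 * pi * m * x)"] p by (simp add: continuous_intros)
    ultimately show ?thesis
      using integral_Re[OF int] integral_Im[OF int] by (intro complex_eqI) simp_all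
  qed
  have eta: "integral {a..2} (\<lambda>t. \<eta> t * (h t * q t)) = integral {0..1} (\<lambda>x. h x * q x)"
    if q: "continuous_on UNIV q" "\<And>x. q (x + 1) = q x" for q
    by (rule integral_cutoff(1)) (use per q continuous_on_subset[OF h] continuous_on_subset[OF q(1)] in \<open>auto intro!: continuous_intros\<close>)
  have whq: "continuous_on UNIV (\<lambda>y. weight y * h (\<gamma> / y) * q y)" if "continuous_on UNIV q" for q
    by (intro continuous_on_mult wh that)
  have trans: "integral {0..?R} (\<lambda>y. weight y * h (\<gamma> / y) * q y) = integral {0..1} (\<lambda>x. h x * q x)"
    if q: "continuous_on UNIV q" "\<And>x. q (x + 1) = q x" for q
  proof -
    have qj: "q (x + real j) = q x" for x j
    proof (induction j)
      case (Suc j)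
      have "x + real (Suc j) = x + real j + 1" by simp
      then show ?case using q(2)[of "x + real j"] Suc by metis
    qed simp
    have "integral {0..?R} (\<lambda>y. weight y * h (\<gamma> / y) * q y) =
      integral {0..1} (\<lambda>x. \<Sum>j\<le>branches. weight (x + real j) * h (\<gamma> / (x + real j)) * q (x + real j))"
      by (rule integral_fold[OF whq[OF q(1)], symmetric])
    also have "\<dots> = integral {0..1} (\<lambda>x. h x * q x)"
    proof (rule Henstock_Kurzweil_Integration.integral_cong)
      fix x :: real assume x: "x \<in> {0..1}"
      have "(\<Sum>j\<le>branches. weight (x + real j) * h (\<gamma> / (x + real j)) * q (x + real j)) = transfer h x * q x"
        unfolding qj transfer_def sum_distrib_right ..
      then show "(\<Sum>j\<le>branches. weight (x + real j) * h (\<gamma> / (x + real j)) * q (x + real j)) = h x * q x"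
        using fixed[OF x] by simp
    qed
    finally show ?thesis .
  qed
  have inv: "weight (\<gamma> / t) * u (\<gamma> / (\<gamma> / t)) * v * (\<gamma> / t\<^sup>2) = \<eta> t * (u t * v)" if "t > 0" for t v and u :: "real \<Rightarrow> real"
  proof -
    have "\<gamma> / (\<gamma> / t) = t" using \<gamma>_pos by simp
    then show ?thesis unfolding weight_inversion[OF that, symmetric] by simp
  qed
  have "critical_solution \<gamma> f"
    unfolding critical_solution_def
  proof (intro conjI allI impI)
    show "integrable lborel f" by (rule f_int)
    show "f x = 0" if "x \<le> 0" for x using that a by (intro f_zero) auto
    fix m :: int
    show "(\<integral>x. f x *\<^sub>R cis (2 * pi * m * x) \<partial>lborel) = 0"
    proof (rule cis_0[of "\<lambda>x. x"])
      fix q :: "real \<Rightarrow> real" assume q: "continuous_on UNIV q" "\<And>x. q (x + 1) = q x"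
      have hq: "continuous_on {a..2} (\<lambda>t. h t * q t)"
        by (rule continuous_on_subset[OF continuous_on_mult[OF h q(1)]]) simp
      have "integral {0..?R} (\<lambda>x. f x * q x) = integral {0..?R} (\<lambda>t. \<eta> t * (h t * q t) - weight t * h (\<gamma> / t) * q t)"
        by (simp add: f_def left_diff_distrib mult.assoc)
      also have "\<dots> = integral {0..?R} (\<lambda>t. \<eta> t * (h t * q t)) - integral {0..?R} (\<lambda>t. weight t * h (\<gamma> / t) * q t)"
        by (rule Henstock_Kurzweil_Integration.integral_diff[OF integral_\<eta>(2)[OF hq]])
          (rule integrable_continuous_interval, rule continuous_on_subset[OF whq[OF q(1)]], simp)
      also have "\<dots> = 0" unfolding integral_\<eta>(1)[OF hq] eta[OF q] trans[OF q] by simp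
      finally show "integral {0..?R} (\<lambda>x. f x * q x) = 0" .
    qed simp
    show "(\<integral>x. f x *\<^sub>R cis (2 * pi * m * (\<gamma> / x)) \<partial>lborel) = 0"
    proof (rule cis_0[of "\<lambda>x. \<gamma> / x"])
      fix q :: "real \<Rightarrow> real" assume q: "continuous_on UNIV q" "\<And>x. q (x + 1) = q x"
      have hq: "continuous_on {a..2} (\<lambda>t. h t * q (\<gamma> / t))"
        by (intro continuous_on_mult continuous_on_subset[OF h] continuous_on_compose2[OF q(1)] continuous_intros) (use a in auto)
      have whq2: "continuous_on UNIV (\<lambda>y. weight y * (h (\<gamma> / y) * q (\<gamma> / y)))"
        by (rule continuous_inversion_weight(1)[OF continuous_on_mult[OF h q(1)]])
      have "integral {0..?R} (\<lambda>x. f x * q (\<gamma> / x)) =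
        integral {0..?R} (\<lambda>t. \<eta> t * (h t * q (\<gamma> / t)) - weight t * (h (\<gamma> / t) * q (\<gamma> / t)))"
        by (simp add: f_def left_diff_distrib mult.assoc)
      also have "\<dots> = integral {0..?R} (\<lambda>t. \<eta> t * (h t * q (\<gamma> / t))) - integral {0..?R} (\<lambda>t. weight t * (h (\<gamma> / t) * q (\<gamma> / t)))"
        by (rule Henstock_Kurzweil_Integration.integral_diff[OF integral_\<eta>(2)[OF hq]])
          (rule integrable_continuous_interval, rule continuous_on_subset[OF whq2], simp)
      also have "integral {0..?R} (\<lambda>t. weight t * (h (\<gamma> / t) * q (\<gamma> / t))) = integral {0..1} (\<lambda>x. h x * q x)"
      proof -
        have "integral {0..?R} (\<lambda>t. weight t * (h (\<gamma> / t) * q (\<gamma> / t))) =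
          integral {a..2} (\<lambda>t. weight (\<gamma> / t) * (h (\<gamma> / (\<gamma> / t)) * q (\<gamma> / (\<gamma> / t))) * (\<gamma> / t\<^sup>2))"
          by (rule integral_inversion[OF whq2]) (simp add: weight_zero)
        also have "\<dots> = integral {a..2} (\<lambda>t. \<eta> t * (h t * q t))"
        proof (rule Henstock_Kurzweil_Integration.integral_cong)
          fix t assume "t \<in> {a..2}"
          then have t: "t > 0" using a by simp
          show "weight (\<gamma> / t) * (h (\<gamma> / (\<gamma> / t)) * q (\<gamma> / (\<gamma> / t))) * (\<gamma> / t\<^sup>2) = \<eta> t * (h t * q t)"
            using inv[OF t, of "\<lambda>t. h t * q t" 1] by simp
        qed
        finally show ?thesis unfolding eta[OF q] .
      qed
      \<comment> \<open>Here the roles are exchanged: inversion turns the cutoff piece into the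
        weighted one, which folds to \<open>h\<close> by stationarity.\<close>
      also have "integral {0..?R} (\<lambda>t. \<eta> t * (h t * q (\<gamma> / t))) = integral {0..1} (\<lambda>x. h x * q x)"
      proof -
        have "integral {0..?R} (\<lambda>y. weight y * h (\<gamma> / y) * q y) =
          integral {a..2} (\<lambda>t. weight (\<gamma> / t) * h (\<gamma> / (\<gamma> / t)) * q (\<gamma> / t) * (\<gamma> / t\<^sup>2))"
          by (rule integral_inversion[OF whq[OF q(1)]]) (simp add: weight_zero)
        also have "\<dots> = integral {a..2} (\<lambda>t. \<eta> t * (h t * q (\<gamma> / t)))"
          by (rule Henstock_Kurzweil_Integration.integral_cong) (rule inv, use a in auto)
        finally show ?thesis unfolding integral_\<eta>(1)[OF hq] trans[OF q] by simp
      qed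
      finally show "integral {0..?R} (\<lambda>x. f x * q (\<gamma> / x)) = 0" by simp
    qed simp
  qed
  moreover have "\<not> (AE x in lborel. f x = 0)"
  proof
    assume AE: "AE x in lborel. f x = 0"
    have fi: "set_integrable lborel {0..1 + b} f"
      by (rule borel_integrable_atLeastAtMost') (rule continuous_on_subset[OF f_cont], simp)
    have "(LINT x:{0..1 + b}|lborel. f x) = (\<integral>x. 0 \<partial>(lborel :: real measure))"
      unfolding set_lebesgue_integral_def
    proof (rule integral_cong_AE)
      show "(\<lambda>x. indicator {0..1 + b} x *\<^sub>R f x) \<in> borel_measurable lborel"
        using borel_measurable_integrable[OF f_int] by measurable
      show "AE x in lborel. indicator {0..1 + b} x *\<^sub>R f x = 0" using AE by eventually_elim simp
    qed simp
    then have 0: "integral {0..1 + b} f = 0" using set_borel_integral_eq_integral(2)[OF fi] by simp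
    \<comment> \<open>To the left of 1 + b only the cutoff piece of \<open>f\<close> is present,
      since the inverted support starts later. Its integral is the mass 1 of \<open>h\<close>, so
      \<open>f\<close> is not null.\<close>
    have "integral {0..1 + b} f = integral {0..1 + b} (\<lambda>t. if t \<in> {a..2} then \<eta> t * (h t * 1) else 0)"
    proof (rule Henstock_Kurzweil_Integration.integral_cong)
      fix t assume t: "t \<in> {0..1 + b}"
      then have "weight t = 0" using support_gt(1) by (intro weight_zero) auto
      then show "f t = (if t \<in> {a..2} then \<eta> t * (h t * 1) else 0)"
        using t b \<eta>_zero[of t] by (auto simp: f_def)
    qed
    also have "\<dots> = integral {a..2} (\<lambda>t. if t \<in> {0..1 + b} then \<eta> t * (h t * 1) else 0)"
      by (simp only: integral_restrict_Int Int_commute)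
    also have "\<dots> = integral {a..2} (\<lambda>t. \<eta> t * (h t * 1))"
      by (rule Henstock_Kurzweil_Integration.integral_cong) (use a \<eta>_zero in auto)
    also have "\<dots> = integral {0..1} (\<lambda>x. h x * 1)" by (rule eta) auto
    finally show False using 0 int_h by simp
  qed
  ultimately show ?thesis by blast
qed

end

proposition critical_solution_supercritical:
  assumes "\<gamma> > 1"
  shows "\<exists>k. critical_solution \<gamma> k \<and> \<not> (AE x in lborel. k x = 0)"
proof -
  obtain a b \<eta> \<eta>' where "smooth_cutoff \<gamma> a b \<eta> \<eta>'" using smooth_cutoff_exists[OF assms] by blast
  then interpret smooth_cutoff \<gamma> a b \<eta> \<eta>' .
  show ?thesis by (rule supercritical_solution)
qed

section \<open>Heisenberg uniqueness pairs\<close>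

text \<open>The coefficients at m and - m of a real function are conjugate, so vanishing at both
  frequencies separates the real from the imaginary part.\<close>

lemma fourier_zero_Re_Im_iff:
  fixes K :: "real \<Rightarrow> complex" and S :: "real \<Rightarrow> real"
  assumes K: "integrable lborel K" and S[measurable]: "S \<in> borel_measurable borel"
  shows "(\<forall>m::int. (\<integral>x. cis (2 * pi * m * S x) * K x \<partial>lborel) = 0) \<longleftrightarrow>
    (\<forall>m::int. (\<integral>x. Re (K x) *\<^sub>R cis (2 * pi * m * S x) \<partial>lborel) = 0) \<and>
    (\<forall>m::int. (\<integral>x. Im (K x) *\<^sub>R cis (2 * pi * m * S x) \<partial>lborel) = 0)"
proof -
  define A where "A m = (\<integral>x. Re (K x) *\<^sub>R cis (2 * pi * of_int m * S x) \<partial>lborel)" for m :: int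
  define B where "B m = (\<integral>x. Im (K x) *\<^sub>R cis (2 * pi * of_int m * S x) \<partial>lborel)" for m :: int
  have cm: "(\<lambda>x. cis (2 * pi * of_int m * S x)) \<in> borel_measurable lborel" for m :: int
  proof -
    have c: "(\<lambda>x. cis (2 * pi * of_int m * x)) \<in> borel_measurable borel"
      by (intro borel_measurable_continuous_onI continuous_intros)
    show ?thesis using measurable_compose[OF S c] by simp
  qed
  have iA: "integrable lborel (\<lambda>x. Re (K x) *\<^sub>R cis (2 * pi * of_int m * S x))" for m :: int
    by (rule integrable_mult_bounded[OF integrable_Re[OF K] cm, of _ 1]) simp
  have iB: "integrable lborel (\<lambda>x. Im (K x) *\<^sub>R cis (2 * pi * of_int m * S x))" for m :: int
    by (rule integrable_mult_bounded[OF integrable_Im[OF K] cm, of _ 1]) simp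
  have AB: "(\<integral>x. cis (2 * pi * m * S x) * K x \<partial>lborel) = A m + \<i> * B m" for m :: int
  proof -
    have "(\<integral>x. cis (2 * pi * m * S x) * K x \<partial>lborel) =
      (\<integral>x. Re (K x) *\<^sub>R cis (2 * pi * m * S x) + \<i> * (Im (K x) *\<^sub>R cis (2 * pi * m * S x)) \<partial>lborel)"
      by (intro Bochner_Integration.integral_cong) (auto simp: complex_eq_iff)
    also have "\<dots> = A m + \<i> * B m"
      unfolding A_def B_def
        Bochner_Integration.integral_add[OF iA integrable_mult_right[OF iB]] integral_mult_right_zero ..
    finally show ?thesis .
  qed
  have cnj: "cnj (\<integral>x. p x *\<^sub>R cis (2 * pi * of_int (- m) * S x) \<partial>lborel) = (\<integral>x. p x *\<^sub>R cis (2 * pi * of_int m * S x) \<partial>lborel)"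
    for m :: int and p :: "real \<Rightarrow> real"
  proof -
    have "cnj (\<integral>x. p x *\<^sub>R cis (2 * pi * of_int (- m) * S x) \<partial>lborel) =
      (\<integral>x. cnj (p x *\<^sub>R cis (2 * pi * of_int (- m) * S x)) \<partial>lborel)"
      by (rule integral_bounded_linear'[OF bounded_linear_cnj bounded_linear_cnj, symmetric]) simp
    also have "\<dots> = (\<integral>x. p x *\<^sub>R cis (2 * pi * of_int m * S x) \<partial>lborel)"
      by (rule Bochner_Integration.integral_cong[OF refl]) (simp add: complex_eq_iff)
    finally show ?thesis .
  qed
  have AB0: "A m = 0 \<and> B m = 0" if z: "\<And>m. A m + \<i> * B m = 0" for m
  proof -
    have "cnj (A (- m) + \<i> * B (- m)) = 0" unfolding z by simp
    then have "A m - \<i> * B m = 0" using cnj[of "\<lambda>x. Re (K x)" m] cnj[of "\<lambda>x. Im (K x)" m] by (simp add: A_def B_def)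
    with z[of m] have "A m + A m = 0" by (simp add: add_eq_0_iff)
    then have "A m = 0" by simp
    then show ?thesis using z[of m] by simp
  qed
  show ?thesis
    unfolding AB A_def[symmetric] B_def[symmetric]
  proof
    assume "\<forall>m. A m + \<i> * B m = 0"
    then have "A m = 0 \<and> B m = 0" for m by (intro AB0) (erule spec)
    then show "(\<forall>m. A m = 0) \<and> (\<forall>m. B m = 0)" by simp
  qed simp
qed

text \<open>The origin of \<gamma>: with t = 2 x / \<alpha> the phase pi \<alpha> m t becomes 2 pi m
  x, and pi \<beta> m c / t becomes 2 pi m \<gamma> / x because c \<alpha> \<beta> = 4
  \<gamma>.\<close>

lemma curve_measure_vanishing_iff:
  assumes pos: "\<alpha> > 0" "\<beta> > 0" "M > 0" and k: "integrable lborel k" "\<And>x. x \<le> 0 \<Longrightarrow> k x = 0"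
    and \<gamma>: "\<gamma> = \<alpha> * \<beta> * M\<^sup>2 / (16 * pi\<^sup>2)"
  shows "curve_measure (M\<^sup>2 / (4 * pi\<^sup>2)) k \<in> AC_vanishing (hyperbola_branch M) (lattice_cross \<alpha> \<beta>) \<longleftrightarrow>
    critical_solution \<gamma> (\<lambda>x. Re (k (2 / \<alpha> * x))) \<and> critical_solution \<gamma> (\<lambda>x. Im (k (2 / \<alpha> * x)))"
proof -
  define c where "c = M\<^sup>2 / (4 * pi\<^sup>2)"
  define K where "K x = k (2 / \<alpha> * x)" for x
  have r: "2 / \<alpha> \<noteq> 0" using pos by simp
  have K: "integrable lborel K"
    unfolding K_def using lborel_integrable_real_affine[OF k(1) r, of 0] by simp
  have K0: "K x = 0" if "x \<le> 0" for x
    unfolding K_def using that pos by (intro k(2) mult_nonneg_nonpos) auto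
  have scale: "(\<integral>x. F x * k x \<partial>lborel) = 0 \<longleftrightarrow> (\<integral>x. F (2 / \<alpha> * x) * K x \<partial>lborel) = 0" for F :: "real \<Rightarrow> complex"
    using lborel_integral_real_affine[OF r, of "\<lambda>x. F x * k x" 0] pos by (simp add: K_def)
  have e1: "exp (\<i> * complex_of_real (pi * ((2 / \<alpha> * x, c / (2 / \<alpha> * x)) \<bullet> (\<alpha> * of_int m, 0)))) = cis (2 * pi * of_int m * x)" for x and m :: int
    unfolding cis_conv_exp using pos by (intro arg_cong[where f = exp]) (simp add: inner_prod_def mult_ac)
  have e2: "exp (\<i> * complex_of_real (pi * ((2 / \<alpha> * x, c / (2 / \<alpha> * x)) \<bullet> (0, \<beta> * of_int m)))) = cis (2 * pi * of_int m * (\<gamma> / x))" for x and m :: int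
  proof -
    have "pi * (c / (2 / \<alpha> * x) * (\<beta> * of_int m)) = 2 * pi * of_int m * (\<gamma> / x)"
    proof -
      have "c * \<alpha> * \<beta> = 4 * \<gamma>" by (simp add: c_def \<gamma> field_simps)
      then have "c / (2 / \<alpha> * x) * \<beta> = 2 * (\<gamma> / x)" using pos by (simp add: field_simps)
      then show ?thesis by (metis (no_types, opaque_lifting) mult.assoc mult.commute)
    qed
    then show ?thesis unfolding cis_conv_exp by (simp add: inner_prod_def)
  qed
  have "curve_measure c k \<in> AC_vanishing (hyperbola_branch M) (lattice_cross \<alpha> \<beta>) \<longleftrightarrow>
    (\<forall>\<xi>\<in>lattice_cross \<alpha> \<beta>. (\<integral>x. exp (\<i> * complex_of_real (pi * ((x, c / x) \<bullet> \<xi>))) * k x \<partial>lborel) = 0)"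
    using curve_measure_AC[OF k pos(3)] fourier_transform_curve_measure[OF k pos(3)]
    by (simp add: AC_vanishing_def c_def)
  also have "\<dots> \<longleftrightarrow> (\<forall>m::int. (\<integral>x. exp (\<i> * complex_of_real (pi * ((x, c / x) \<bullet> (\<alpha> * of_int m, 0)))) * k x \<partial>lborel) = 0) \<and>
    (\<forall>m::int. (\<integral>x. exp (\<i> * complex_of_real (pi * ((x, c / x) \<bullet> (0, \<beta> * of_int m)))) * k x \<partial>lborel) = 0)"
    by (simp only: lattice_cross_def ball_Un) auto
  also have "\<dots> \<longleftrightarrow> (\<forall>m::int. (\<integral>x. cis (2 * pi * m * x) * K x \<partial>lborel) = 0) \<and>
    (\<forall>m::int. (\<integral>x. cis (2 * pi * m * (\<gamma> / x)) * K x \<partial>lborel) = 0)"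
    unfolding scale e1 e2 ..
  also have "\<dots> \<longleftrightarrow> critical_solution \<gamma> (\<lambda>x. Re (K x)) \<and> critical_solution \<gamma> (\<lambda>x. Im (K x))"
    using fourier_zero_Re_Im_iff[OF K, of "\<lambda>x. x"] fourier_zero_Re_Im_iff[OF K, of "\<lambda>x. \<gamma> / x"]
      integrable_Re[OF K] integrable_Im[OF K] K0
    unfolding critical_solution_def by auto
  finally show ?thesis unfolding c_def K_def .
qed

lemma critical_solution_scale:
  assumes "critical_solution \<gamma> k" shows "critical_solution \<gamma> (\<lambda>x. r * k x)"
proof -
  have "(\<integral>x. (r * k x) *\<^sub>R cis (F x) \<partial>lborel) = r *\<^sub>R (\<integral>x. k x *\<^sub>R cis (F x) \<partial>lborel)" for F
    unfolding integral_scaleR_right[symmetric] by simp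
  then show ?thesis using assms unfolding critical_solution_def by simp
qed

lemma critical_solution_0: "critical_solution \<gamma> (\<lambda>_. 0)"
  by (simp add: critical_solution_def)

lemma AE_rescale:
  fixes f g :: "real \<Rightarrow> complex"
  assumes "AE x in lborel. f (r * x) = g (r * x)" "r \<noteq> 0"
    and [measurable]: "f \<in> borel_measurable borel" "g \<in> borel_measurable borel"
  shows "AE x in lborel. f x = g x"
proof -
  have "AE x in lborel. f (r * (0 + 1 / r * x)) = g (r * (0 + 1 / r * x))"
    by (rule AE_borel_affine[where P = "\<lambda>x. f (r * x) = g (r * x)"]) (use assms in auto)
  then show ?thesis using assms(2) by simp
qed

lemma AC_vanishing_hyperbola_cases:
  assumes pos: "\<alpha> > 0" "\<beta> > 0" "M > 0" and \<gamma>: "\<gamma> = \<alpha> * \<beta> * M\<^sup>2 / (16 * pi\<^sup>2)"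
    and \<mu>: "\<mu> \<in> AC_vanishing (hyperbola_branch M) (lattice_cross \<alpha> \<beta>)"
  obtains k where "integrable lborel k" "\<mu> = curve_measure (M\<^sup>2 / (4 * pi\<^sup>2)) k"
    "critical_solution \<gamma> (\<lambda>x. Re (k (2 / \<alpha> * x)))" "critical_solution \<gamma> (\<lambda>x. Im (k (2 / \<alpha> * x)))"
proof -
  from \<mu> have "\<mu> \<in> AC (hyperbola_branch M)" by (simp add: AC_vanishing_def)
  then show ?thesis
  proof (rule AC_hyperbola_density[OF _ pos(3)])
    fix k assume k: "integrable lborel k" "\<And>x. x \<le> 0 \<Longrightarrow> k x = 0" "\<mu> = curve_measure (M\<^sup>2 / (4 * pi\<^sup>2)) k"
    show ?thesis
      by (rule that[OF k(1,3)]) (use curve_measure_vanishing_iff[OF pos k(1,2) \<gamma>] \<mu> k(3) in auto)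
  qed
qed

lemma curve_measure_0: "curve_measure c (\<lambda>_. 0) = (\<lambda>E. 0)"
  by (auto simp: curve_measure_def)

lemma curve_measure_mult: "curve_measure c (\<lambda>x. z * k x) E = z * curve_measure c k E"
proof (cases "E \<in> sets borel")
  case True
  have "(\<integral>x. indicator E (x, c / x) *\<^sub>R (z * k x) \<partial>lborel) = (\<integral>x. z * (indicator E (x, c / x) *\<^sub>R k x) \<partial>lborel)"
    by (intro Bochner_Integration.integral_cong) auto
  also have "\<dots> = z * (\<integral>x. indicator E (x, c / x) *\<^sub>R k x \<partial>lborel)"
    by (rule integral_mult_right_zero)
  finally show ?thesis using True by (simp only: curve_measure_def if_True)
qed (simp add: curve_measure_def)

lemma zero_in_AC_vanishing:
  assumes "\<alpha> > 0" "\<beta> > 0" "M > 0"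
  shows "(\<lambda>E. 0) \<in> AC_vanishing (hyperbola_branch M) (lattice_cross \<alpha> \<beta>)"
  using curve_measure_vanishing_iff[OF assms, of "\<lambda>_. 0"] critical_solution_0 by (simp add: curve_measure_0)

section \<open>The three regimes\<close>

proposition heisenberg_subcritical:
  assumes pos: "\<alpha> > 0" "\<beta> > 0" "M > 0" and sub: "\<alpha> * \<beta> * M\<^sup>2 < 16 * pi\<^sup>2"
  shows "heisenberg_uniqueness_pair (hyperbola_branch M) (lattice_cross \<alpha> \<beta>)"
proof -
  define \<gamma> where "\<gamma> = \<alpha> * \<beta> * M\<^sup>2 / (16 * pi\<^sup>2)"
  have g: "0 < \<gamma>" "\<gamma> < 1" using pos sub by (simp_all add: \<gamma>_def)
  have "\<mu> = (\<lambda>E. 0)" if "\<mu> \<in> AC_vanishing (hyperbola_branch M) (lattice_cross \<alpha> \<beta>)" for \<mu>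
  proof (rule AC_vanishing_hyperbola_cases[OF pos \<gamma>_def that])
    fix k assume k: "integrable lborel k" "\<mu> = curve_measure (M\<^sup>2 / (4 * pi\<^sup>2)) k"
      "critical_solution \<gamma> (\<lambda>x. Re (k (2 / \<alpha> * x)))" "critical_solution \<gamma> (\<lambda>x. Im (k (2 / \<alpha> * x)))"
    note [measurable] = borel_measurable_integrable[OF k(1)]
    have "AE x in lborel. k (2 / \<alpha> * x) = 0"
      using critical_solution_subcritical[OF k(3) g] critical_solution_subcritical[OF k(4) g]
      by eventually_elim (simp add: complex_eq_iff)
    then have "AE x in lborel. k x = 0"
      by (intro AE_rescale[of k "2 / \<alpha>" "\<lambda>_. 0"]) (use pos in auto)
    then show "\<mu> = (\<lambda>E. 0)"
      unfolding k(2) curve_measure_0[of "M\<^sup>2 / (4 * pi\<^sup>2)", symmetric] by (intro curve_measure_cong_AE) auto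
  qed
  then show ?thesis
    unfolding heisenberg_uniqueness_pair_def using zero_in_AC_vanishing[OF pos] by blast
qed

proposition heisenberg_supercritical:
  assumes pos: "\<alpha> > 0" "\<beta> > 0" "M > 0" and super: "\<alpha> * \<beta> * M\<^sup>2 > 16 * pi\<^sup>2"
  shows "\<not> heisenberg_uniqueness_pair (hyperbola_branch M) (lattice_cross \<alpha> \<beta>)"
proof -
  define \<gamma> where "\<gamma> = \<alpha> * \<beta> * M\<^sup>2 / (16 * pi\<^sup>2)"
  have "\<gamma> > 1" using super by (simp add: \<gamma>_def)
  then obtain f where f: "critical_solution \<gamma> f" "\<not> (AE x in lborel. f x = 0)"
    using critical_solution_supercritical by blast
  have fi: "integrable lborel f" and f0: "\<And>x. x \<le> 0 \<Longrightarrow> f x = 0" using f(1) by (auto simp: critical_solution_def)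
  note [measurable] = borel_measurable_integrable[OF fi]
  define k where "k t = complex_of_real (f (\<alpha> / 2 * t))" for t
  have ki: "integrable lborel k"
    unfolding k_def using lborel_integrable_real_affine[OF fi, of "\<alpha> / 2" 0] pos by simp
  have k0: "k x = 0" if "x \<le> 0" for x
    using that pos f0[of "\<alpha> / 2 * x"] by (simp add: k_def mult_nonneg_nonpos)
  have kf: "k (2 / \<alpha> * x) = complex_of_real (f x)" for x using pos by (simp add: k_def)
  have "curve_measure (M\<^sup>2 / (4 * pi\<^sup>2)) k \<in> AC_vanishing (hyperbola_branch M) (lattice_cross \<alpha> \<beta>)"
    using curve_measure_vanishing_iff[OF pos ki k0 \<gamma>_def] f(1) critical_solution_0
    by (simp only: kf Re_complex_of_real Im_complex_of_real)
  moreover have "curve_measure (M\<^sup>2 / (4 * pi\<^sup>2)) k \<noteq> (\<lambda>E. 0)"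
  proof
    assume "curve_measure (M\<^sup>2 / (4 * pi\<^sup>2)) k = (\<lambda>E. 0)"
    then have "AE x in lborel. k x = 0"
      by (intro curve_measure_eqD[OF ki, of "\<lambda>_. 0" "M\<^sup>2 / (4 * pi\<^sup>2)"]) (auto simp: curve_measure_0)
    then have "AE x in lborel. k (0 + 2 / \<alpha> * x) = 0"
      by (intro AE_borel_affine[where P = "\<lambda>x. k x = 0"]) (use pos borel_measurable_integrable[OF ki] in auto)
    then have "AE x in lborel. f x = 0" by (simp only: add_0 kf of_real_eq_0_iff)
    then show False using f(2) by simp
  qed
  ultimately show ?thesis unfolding heisenberg_uniqueness_pair_def by auto
qed

proposition heisenberg_critical:
  assumes pos: "\<alpha> > 0" "\<beta> > 0" "M > 0" and crit: "\<alpha> * \<beta> * M\<^sup>2 = 16 * pi\<^sup>2"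
  shows "\<exists>\<mu>0 \<in> AC_vanishing (hyperbola_branch M) (lattice_cross \<alpha> \<beta>).
     (\<forall>E\<in>sets borel. x1_compression \<mu>0 E =
        complex_of_real (set_lebesgue_integral lborel E (critical_density \<alpha>))) \<and>
     \<mu>0 \<noteq> (\<lambda>E. 0) \<and>
     AC_vanishing (hyperbola_branch M) (lattice_cross \<alpha> \<beta>) = range (\<lambda>c::complex. \<lambda>E. c * \<mu>0 E)"
proof -
  have g1: "1 = \<alpha> * \<beta> * M\<^sup>2 / (16 * pi\<^sup>2)" using crit by simp
  \<comment> \<open>The factor 1 / 4 turns 1 / (1 + x) at x = \<alpha> t / 2 into 1 / (2 (2 +
    \<alpha> t)), the normalization of \<open>critical_density\<close>.\<close>
  define f where "f t = critical_profile (\<alpha> / 2 * t) / 4" for t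
  define k where "k t = complex_of_real (f t)" for t
  have [measurable]: "f \<in> borel_measurable borel" unfolding f_def by measurable
  have fi: "integrable lborel f"
    unfolding f_def using lborel_integrable_real_affine[OF integrable_critical_profile, of "\<alpha> / 2" 0] pos by simp
  have ki: "integrable lborel k" unfolding k_def using fi by simp
  note [measurable] = borel_measurable_integrable[OF ki]
  have k0: "k x = 0" if "x \<le> 0" for x
  proof -
    have "\<alpha> / 2 * x \<le> 0" using that pos by (intro mult_nonneg_nonpos) auto
    then have "critical_profile (\<alpha> / 2 * x) = 0" unfolding critical_profile_def by simp
    then show ?thesis by (simp only: k_def f_def) simp
  qed
  have kp: "k (2 / \<alpha> * x) = complex_of_real (1 / 4 * critical_profile x)" for x using pos by (simp add: k_def f_def)
  let ?\<mu> = "curve_measure (M\<^sup>2 / (4 * pi\<^sup>2)) k"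
  have multiple: "(\<lambda>E. z * ?\<mu> E) \<in> AC_vanishing (hyperbola_branch M) (lattice_cross \<alpha> \<beta>)" for z
  proof -
    have "critical_solution 1 (\<lambda>x. Re z / 4 * critical_profile x)" "critical_solution 1 (\<lambda>x. Im z / 4 * critical_profile x)"
      by (intro critical_solution_scale critical_solution_critical_profile)+
    moreover have "(\<lambda>x. Re (z * k (2 / \<alpha> * x))) = (\<lambda>x. Re z / 4 * critical_profile x)"
      "(\<lambda>x. Im (z * k (2 / \<alpha> * x))) = (\<lambda>x. Im z / 4 * critical_profile x)"
      unfolding kp by simp_all
    moreover have "integrable lborel (\<lambda>x. z * k x)" "\<And>x. x \<le> 0 \<Longrightarrow> z * k x = 0" using ki k0 by simp_all
    note curve_measure_vanishing_iff[OF pos this g1]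
    ultimately have "curve_measure (M\<^sup>2 / (4 * pi\<^sup>2)) (\<lambda>x. z * k x) \<in> AC_vanishing (hyperbola_branch M) (lattice_cross \<alpha> \<beta>)"
      by simp
    then show ?thesis unfolding curve_measure_mult[abs_def] .
  qed
  have in_AC: "?\<mu> \<in> AC_vanishing (hyperbola_branch M) (lattice_cross \<alpha> \<beta>)" using multiple[of 1] by simp
  have fd: "AE t in lborel. f t = critical_density \<alpha> t"
  proof -
    \<comment> \<open>At 0 and at 2 / \<alpha> the two functions follow different endpoint
      conventions.\<close>
    have "AE t in lborel. t \<notin> {0, 2 / \<alpha>}" by (rule AE_notin_countable) simp
    then show ?thesis
    proof eventually_elim
      case (elim t)
      consider "t < 0" | "0 < t" "t < 2 / \<alpha>" | "2 / \<alpha> < t" using elim by fastforce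
      then show ?case
      proof cases
        case 1
        then have "\<not> 0 < \<alpha> / 2 * t" "\<not> 2 / \<alpha> \<le> t" using pos by (auto simp: zero_less_mult_iff not_le intro: less_trans)
        then show ?thesis using 1 by (simp add: f_def critical_profile_def critical_density_def)
      next
        case 2
        then have "0 < \<alpha> / 2 * t" "\<alpha> / 2 * t < 1" using pos by (auto simp: field_simps)
        then show ?thesis using 2
          by (simp add: f_def critical_profile_def critical_density_def field_simps)
      next
        case 3
        then have x: "\<alpha> / 2 * t > 1" "t > 0" using pos by (auto simp: field_simps intro: less_trans[of 0 "2 / \<alpha>" t])
        have "\<not> t \<le> 2 / \<alpha>" using 3 by simp
        then have "critical_density \<alpha> t = - 1 / (\<alpha> * t * (2 + \<alpha> * t))"
          using 3 by (simp add: critical_density_def)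
        moreover have "f t = - (1 / (\<alpha> / 2 * t * (\<alpha> / 2 * t + 1))) / 4"
          unfolding f_def critical_profile_def using x(1) by (simp only: indicator_def) simp
        moreover have "\<alpha> * t * (2 + \<alpha> * t) = \<alpha> / 2 * t * (\<alpha> / 2 * t + 1) * 4" by (simp add: algebra_simps)
        ultimately show ?thesis by simp
      qed
    qed
  qed
  show ?thesis
  proof (intro bexI[OF _ in_AC] conjI ballI)
    fix E :: "real set" assume E[measurable]: "E \<in> sets borel"
    have [measurable]: "critical_density \<alpha> \<in> borel_measurable borel" unfolding critical_density_def[abs_def] by measurable
    have "E \<times> (UNIV :: real set) = fst -` E" by auto
    then have EU: "E \<times> UNIV \<in> sets (borel :: (real \<times> real) measure)"
      using measurable_sets_borel[OF borel_measurable_fst_snd(1) E] by simp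
    have "x1_compression ?\<mu> E =
      (\<integral>x. indicator (E \<times> UNIV) (x, M\<^sup>2 / (4 * pi\<^sup>2) / x) *\<^sub>R k x \<partial>lborel)"
      unfolding x1_compression_def curve_measure_def if_P[OF EU] ..
    also have "\<dots> = (\<integral>x. complex_of_real (indicator E x * f x) \<partial>lborel)"
    proof (rule Bochner_Integration.integral_cong[OF refl])
      fix x
      show "indicator (E \<times> UNIV) (x, M\<^sup>2 / (4 * pi\<^sup>2) / x) *\<^sub>R k x = complex_of_real (indicator E x * f x)"
        by (cases "x \<in> E") (simp_all add: k_def)
    qed
    also have "\<dots> = complex_of_real (\<integral>x. indicator E x * f x \<partial>lborel)"
      by (rule integral_complex_of_real)
    also have "(\<integral>x. indicator E x * f x \<partial>lborel) = set_lebesgue_integral lborel E (critical_density \<alpha>)"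
      unfolding set_lebesgue_integral_def real_scaleR_def
      by (intro integral_cong_AE) (use fd in auto)
    finally show "x1_compression ?\<mu> E = complex_of_real (set_lebesgue_integral lborel E (critical_density \<alpha>))" .
  next
    show "?\<mu> \<noteq> (\<lambda>E. 0)"
    proof
      assume "?\<mu> = (\<lambda>E. 0)"
      then have "AE x in lborel. k x = 0"
        by (intro curve_measure_eqD[OF ki, of "\<lambda>_. 0" "M\<^sup>2 / (4 * pi\<^sup>2)"]) (auto simp: curve_measure_0)
      then have "AE x in lborel. k (0 + 2 / \<alpha> * x) = 0"
        by (intro AE_borel_affine[where P = "\<lambda>x. k x = 0"]) (use pos in auto)
      then have "AE x in lborel. critical_profile x = 0"
        unfolding add_0 kp by eventually_elim simp
      \<comment> \<open>The profile is positive on (0, 1), which is not a null set.\<close>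
      then have "AE x in lborel. x \<notin> {0<..<1::real}"
        by eventually_elim (auto simp: critical_profile_def)
      then have "{0<..<1::real} \<in> null_sets lborel" by (subst AE_iff_null_sets) auto
      then show False by (simp add: null_sets_def)
    qed
  next
    show "AC_vanishing (hyperbola_branch M) (lattice_cross \<alpha> \<beta>) = range (\<lambda>c::complex. \<lambda>E. c * ?\<mu> E)"
    proof
      show "range (\<lambda>c::complex. \<lambda>E. c * ?\<mu> E) \<subseteq> AC_vanishing (hyperbola_branch M) (lattice_cross \<alpha> \<beta>)"
        using multiple by auto
      show "AC_vanishing (hyperbola_branch M) (lattice_cross \<alpha> \<beta>) \<subseteq> range (\<lambda>c::complex. \<lambda>E. c * ?\<mu> E)"
      proof
        fix \<mu> assume "\<mu> \<in> AC_vanishing (hyperbola_branch M) (lattice_cross \<alpha> \<beta>)"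
        then show "\<mu> \<in> range (\<lambda>c::complex. \<lambda>E. c * ?\<mu> E)"
        proof (rule AC_vanishing_hyperbola_cases[OF pos g1])
          fix l assume l: "integrable lborel l" "\<mu> = curve_measure (M\<^sup>2 / (4 * pi\<^sup>2)) l"
            "critical_solution 1 (\<lambda>x. Re (l (2 / \<alpha> * x)))" "critical_solution 1 (\<lambda>x. Im (l (2 / \<alpha> * x)))"
          note [measurable] = borel_measurable_integrable[OF l(1)]
          obtain r s where r: "AE x in lborel. Re (l (2 / \<alpha> * x)) = r * critical_profile x"
            and s: "AE x in lborel. Im (l (2 / \<alpha> * x)) = s * critical_profile x"
            using critical_solution_critical[OF l(3)] critical_solution_critical[OF l(4)] by blast
          \<comment> \<open>Real and imaginary part are multiples of the profile with independent
            real factors r and s; the 4 cancels the 1 / 4 in \<open>k\<close>.\<close>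
          define z where "z = 4 * Complex r s"
          have "AE x in lborel. l (2 / \<alpha> * x) = z * k (2 / \<alpha> * x)"
            using r s
          proof eventually_elim
            case (elim x)
            then show ?case unfolding kp by (simp add: z_def complex_eq_iff)
          qed
          then have "AE x in lborel. l x = z * k x"
            by (intro AE_rescale[of l "2 / \<alpha>" "\<lambda>x. z * k x"]) (use pos in auto)
          then have "\<mu> = curve_measure (M\<^sup>2 / (4 * pi\<^sup>2)) (\<lambda>x. z * k x)"
            unfolding l(2) by (intro curve_measure_cong_AE) auto
          then show "\<mu> \<in> range (\<lambda>c::complex. \<lambda>E. c * ?\<mu> E)"
            unfolding curve_measure_mult[abs_def] by blast
        qed
      qed
    qed
  qed
qed

theorem theorem1p6p1:
  fixes \<alpha> \<beta> M :: real
  assumes "\<alpha> > 0" and "\<beta> > 0" and "M > 0"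
  shows "(heisenberg_uniqueness_pair (hyperbola_branch M) (lattice_cross \<alpha> \<beta>)
            \<longleftrightarrow> \<alpha> * \<beta> * M\<^sup>2 < 16 * pi\<^sup>2) \<and>
         (\<alpha> * \<beta> * M\<^sup>2 = 16 * pi\<^sup>2 \<longrightarrow>
            (\<exists>\<mu>0 \<in> AC_vanishing (hyperbola_branch M) (lattice_cross \<alpha> \<beta>).
               (\<forall>E\<in>sets borel. x1_compression \<mu>0 E =
                  complex_of_real (set_lebesgue_integral lborel E (critical_density \<alpha>))) \<and>
               \<mu>0 \<noteq> (\<lambda>E. 0) \<and>
               AC_vanishing (hyperbola_branch M) (lattice_cross \<alpha> \<beta>) =
                 range (\<lambda>c::complex. \<lambda>E. c * \<mu>0 E)))"
proof
  show "heisenberg_uniqueness_pair (hyperbola_branch M) (lattice_cross \<alpha> \<beta>) \<longleftrightarrow> \<alpha> * \<beta> * M\<^sup>2 < 16 * pi\<^sup>2"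
  proof (rule linorder_cases[of "\<alpha> * \<beta> * M\<^sup>2" "16 * pi\<^sup>2"])
    assume "\<alpha> * \<beta> * M\<^sup>2 < 16 * pi\<^sup>2"
    then show ?thesis using heisenberg_subcritical[OF assms] by simp
  next
    assume eq: "\<alpha> * \<beta> * M\<^sup>2 = 16 * pi\<^sup>2"
    have "\<not> heisenberg_uniqueness_pair (hyperbola_branch M) (lattice_cross \<alpha> \<beta>)"
      unfolding heisenberg_uniqueness_pair_def using heisenberg_critical[OF assms eq] by auto
    then show ?thesis using eq by simp
  next
    assume "16 * pi\<^sup>2 < \<alpha> * \<beta> * M\<^sup>2"
    then show ?thesis using heisenberg_supercritical[OF assms] by simp
  qed
qed (use heisenberg_critical[OF assms] in blast)

end
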